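(* Let $n\ge2$, $\gamma>0$, $|\Omega|<\gamma$, $\kappa\in\{1,-1\}$, and let $G:\mathbb{R}^n\times\mathbb{R}_+\to\mathbb{R}_+$ be continuous and differentiable and satisfy, for some constant $C>0$ and exponent $p$, $$0\le G(x,v)\le C\big(v+v^{\frac{p+1}{2}}\big)\quad\text{for all }x\in\mathbb{R}^n,\ v\ge0 .$$ For $c>0$ let $S_c=\{u\in\Sigma:\int|u|^2=c^2\}$, let $$E_{\Omega,\gamma}(u)=\int_{\mathbb{R}^n}\Big(\tfrac12|\nabla u|^2+\tfrac{\gamma^2}{2}|x|^2|u|^2-\kappa\,G(x,|u|^2)-\Omega\,\bar uL_zu\Big)dx ,$$ and $I_c=\inf\{E_{\Omega,\gamma}(u):u\in S_c\}$. (a) If $1\le p<1+\frac4n$ and $\kappa=1$, then there exists $u\in S_c$ with $E_{\Omega,\gamma}(u)=I_c$. (b) If $1\le p<1+\frac{4}{n-2}$ and $\kappa=-1$, then there exists $u\in S_c$ with $E_{\Omega,\gamma}(u)=I_c$.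
   Context: $\Sigma=\{f\in H^1(\mathbb{R}^n;\mathbb{C}):|x|f\in L^2\}$. $L_z=i(x_2\partial_{x_1}-x_1\partial_{x_2})$. $\mathbb{R}_+=[0,\infty)$. Convention: $1+\frac4{n-2}=+\infty$ when $n=2$. *)

theory Defs
  imports "HOL-Analysis.Analysis"
begin

definition partial_deriv :: "'n::finite \<Rightarrow> (real^'n \<Rightarrow> real) \<Rightarrow> real^'n \<Rightarrow> real" where
  "partial_deriv j \<phi> x = frechet_derivative \<phi> (at x) (axis j 1)"

primrec C_k :: "nat \<Rightarrow> (real^'n::finite \<Rightarrow> real) \<Rightarrow> bool" where
  "C_k 0 \<phi> \<longleftrightarrow> continuous_on UNIV \<phi>"
| "C_k (Suc k) \<phi> \<longleftrightarrow> \<phi> differentiable_on UNIV \<and> (\<forall>j. C_k k (partial_deriv j \<phi>))"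

definition test_function :: "(real^'n::finite \<Rightarrow> real) \<Rightarrow> bool" where
  "test_function \<phi> \<longleftrightarrow> (\<forall>k. C_k k \<phi>) \<and> compact (closure {x. \<phi> x \<noteq> 0})"

text \<open>Elements of function spaces are represented by Borel functions; every Lebesgue measurable
  function agrees almost everywhere with a Borel one.\<close>

definition square_integrable :: "('a::euclidean_space \<Rightarrow> complex) \<Rightarrow> bool" where
  "square_integrable f \<longleftrightarrow>
     f \<in> borel_measurable lborel \<and> integrable lborel (\<lambda>x. (cmod (f x))\<^sup>2)"

definition locally_integrable :: "('a::euclidean_space \<Rightarrow> complex) \<Rightarrow> bool" where
  "locally_integrable f \<longleftrightarrow>
     f \<in> borel_measurable lborel \<and> (\<forall>K. compact K \<longrightarrow> set_integrable lborel K f)"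

definition has_weak_partial ::
    "'n::finite \<Rightarrow> (real^'n \<Rightarrow> complex) \<Rightarrow> (real^'n \<Rightarrow> complex) \<Rightarrow> bool" where
  "has_weak_partial j f g \<longleftrightarrow> locally_integrable f \<and> locally_integrable g \<and>
     (\<forall>\<phi>. test_function \<phi> \<longrightarrow>
        (LINT x|lborel. partial_deriv j \<phi> x *\<^sub>R f x) = - (LINT x|lborel. \<phi> x *\<^sub>R g x))"

text \<open>A weak partial derivative is unique up to null sets, so the choice of representative does not
  affect any of the integrals below.\<close>

definition weak_partial :: "'n::finite \<Rightarrow> (real^'n \<Rightarrow> complex) \<Rightarrow> real^'n \<Rightarrow> complex" where
  "weak_partial j f = (SOME g. has_weak_partial j f g)"

definition H1 :: "(real^'n::finite \<Rightarrow> complex) set" where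
  "H1 = {f. square_integrable f \<and> (\<forall>j. \<exists>g. has_weak_partial j f g \<and> square_integrable g)}"

definition Sigma_space :: "(real^'n::finite \<Rightarrow> complex) set" where
  "Sigma_space = {f \<in> H1. square_integrable (\<lambda>x. of_real (norm x) * f x)}"

definition grad_norm_sq :: "(real^'n::finite \<Rightarrow> complex) \<Rightarrow> real^'n \<Rightarrow> real" where
  "grad_norm_sq u x = (\<Sum>j\<in>UNIV. (cmod (weak_partial j u x))\<^sup>2)"

text \<open>The index type \<^typ>\<open>'n\<close> carries no order, so the two coordinates in the rotation plane
  are passed as parameters \<open>i1\<close>, \<open>i2\<close>.\<close>

definition L_z :: "'n::finite \<Rightarrow> 'n \<Rightarrow> (real^'n \<Rightarrow> complex) \<Rightarrow> real^'n \<Rightarrow> complex" where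
  "L_z i1 i2 u x =
     \<i> * (of_real (x $ i2) * weak_partial i1 u x - of_real (x $ i1) * weak_partial i2 u x)"

text \<open>The rotation term is complex pointwise. Its integral is real for \<open>u\<close> in the space
  above, since \<^const>\<open>L_z\<close> is symmetric; \<^const>\<open>Re\<close> only changes the type.\<close>

definition energy ::
    "'n::finite \<Rightarrow> 'n \<Rightarrow> real \<Rightarrow> real \<Rightarrow> real \<Rightarrow> (real^'n \<Rightarrow> real \<Rightarrow> real)
       \<Rightarrow> (real^'n \<Rightarrow> complex) \<Rightarrow> real" where
  "energy i1 i2 \<Omega> \<gamma> \<kappa> G u = Re (LINT x|lborel.
      of_real (1/2 * grad_norm_sq u x + \<gamma>\<^sup>2 / 2 * (norm x)\<^sup>2 * (cmod (u x))\<^sup>2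
               - \<kappa> * G x ((cmod (u x))\<^sup>2))
      - of_real \<Omega> * cnj (u x) * L_z i1 i2 u x)"

definition mass_sphere :: "real \<Rightarrow> (real^'n::finite \<Rightarrow> complex) set" where
  "mass_sphere c = {u \<in> Sigma_space. (LINT x|lborel. (cmod (u x))\<^sup>2) = c\<^sup>2}"

text \<open>The infimum is taken in the extended reals, because \<^const>\<open>Inf\<close> on \<^typ>\<open>real\<close> is
  unspecified for sets that are not bounded below.\<close>

definition min_energy ::
    "'n::finite \<Rightarrow> 'n \<Rightarrow> real \<Rightarrow> real \<Rightarrow> real \<Rightarrow> (real^'n \<Rightarrow> real \<Rightarrow> real) \<Rightarrow> real \<Rightarrow> ereal"
  where
  "min_energy i1 i2 \<Omega> \<gamma> \<kappa> G c = (INF u \<in> mass_sphere c. ereal (energy i1 i2 \<Omega> \<gamma> \<kappa> G u))"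

definition energy_critical_exponent :: "nat \<Rightarrow> ereal" where
  "energy_critical_exponent n = (if n = 2 then \<infinity> else ereal (1 + 4 / (real n - 2)))"

end

theory Submission
  imports Defs "HOL-Real_Asymp.Real_Asymp" "HOL-Complex_Analysis.Great_Picard"
begin

text \<open>Completing the square, the quadratic part of the energy becomes \<open>\<parallel>T(u, \<nabla>u)\<parallel>\<^sup>2 / 2\<close> with \<open>T\<close>
  linear, and \<open>\<bar>\<Omega>\<bar> < \<gamma>\<close> makes it control \<open>\<parallel>\<nabla>u\<parallel>\<close> and \<open>\<parallel>\<bar>x\<bar> u\<parallel>\<close>. The basic inequality is
  \<open>\<parallel>u(\<cdot> + h) - u\<parallel> \<le> K \<bar>h\<bar> \<parallel>\<nabla>u\<parallel>\<close>. It shows that \<open>u\<close> is close to its averages over small balls, which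
  yields two things: sequences bounded in \<open>\<Sigma>\<close> have \<open>L\<^sup>2\<close>-convergent subsequences, and the sets
  \<open>{\<bar>u\<bar> > t}\<close> have measure at most \<open>K t powr (- 2 - 4/n) \<parallel>\<nabla>u\<parallel>\<^sup>2\<close>. Weak lower
  semicontinuity of the quadratic part follows from the parallelogram law, applied to almost-minimizers
  in the midpoint hulls of the tails of a sequence.

  For \<open>\<kappa> = 1\<close> and \<open>p < 1 + 4/n\<close> the level set estimate makes the contribution of \<open>{\<bar>u\<bar> > L}\<close> to the
  integral of \<open>G\<close> a small multiple of \<open>\<parallel>\<nabla>u\<parallel>\<^sup>2\<close>, which gives both coercivity and convergence of the
  nonlinear term. For \<open>\<kappa> = -1\<close> Fatou's lemma suffices, and no Sobolev embedding is needed: if \<open>G(x, \<bar>u\<bar>\<^sup>2)\<close>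
  fails to be integrable for some \<open>u\<close> in the sphere, the integral defining its energy has the junk
  value \<open>0\<close>, which is then the minimum.\<close>

section \<open>Test functions\<close>

text \<open>The basic inequality is proved on the dual side: in the integral of
  \<open>u(x + h) - u(x)\<close> against a test function the difference is shifted onto the test
  function, so \<open>u\<close> enters only through the definition of its weak derivatives. What
  then remains is the density of test functions in L2, drawn from the parallelogram law like the
  lower semicontinuity. The energy is defined through \<open>weak_partial\<close>, a
  \<open>SOME\<close> choice with no pointwise linearity or continuity. The gradient is therefore
  carried as an explicit function \<open>g\<close> next to \<open>u\<close>; such pairs can be
  averaged and pass to limits, and \<open>energy_cases\<close> reconciles them with
  \<open>weak_partial\<close> almost everywhere. The exponent 1 + 4/n comes from dyadic layers: over
  the layer 2^i L < |u| <= 2^(i+1) L the integral of |u|^(p+1) is at most a constant times (2^i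
  L)^(p - 1 - 4/n), which is summable exactly for p < 1 + 4/n. For the focusing sign Fatou's lemma
  points the wrong way for the density itself. It is applied to D |u|^2 minus the truncated density,
  whose first part has the same integral along the sequence and in the limit, because strong L2
  convergence preserves the mass.\<close>

lemma C_k_Suc_imp: "C_k (Suc k) \<phi> \<Longrightarrow> C_k k \<phi>"
proof (induction k arbitrary: \<phi>)
  case 0
  then show ?case by (auto intro: differentiable_imp_continuous_on)
next
  case (Suc k)
  then show ?case by (metis C_k.simps(2))
qed

lemma differentiable_has_frechet:
  "\<phi> differentiable_on UNIV \<Longrightarrow> (\<phi> has_derivative frechet_derivative \<phi> (at x)) (at x)"
  by (simp add: differentiable_on_def frechet_derivative_works)

lemma partial_deriv_eqI:
  "(\<phi> has_derivative D) (at x) \<Longrightarrow> partial_deriv j \<phi> x = D (axis j 1)"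
  unfolding partial_deriv_def by (metis frechet_derivative_at)

lemma C_k_const: "C_k k (\<lambda>x. a)"
proof (induction k arbitrary: a)
  case (Suc k)
  have "partial_deriv j (\<lambda>x::real^'a. a) = (\<lambda>x. 0)" for j
    by (rule ext, subst partial_deriv_eqI[OF has_derivative_const]) auto
  then show ?case using Suc by (auto simp: differentiable_on_def)
qed auto

lemma C_k_add: "C_k k \<phi> \<Longrightarrow> C_k k \<psi> \<Longrightarrow> C_k k (\<lambda>x. \<phi> x + \<psi> x)"
proof (induction k arbitrary: \<phi> \<psi>)
  case 0
  then show ?case by (auto intro: continuous_intros)
next
  case (Suc k)
  have "partial_deriv j (\<lambda>x. \<phi> x + \<psi> x) = (\<lambda>x. partial_deriv j \<phi> x + partial_deriv j \<psi> x)" for j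
  proof
    fix x
    show "partial_deriv j (\<lambda>x. \<phi> x + \<psi> x) x = partial_deriv j \<phi> x + partial_deriv j \<psi> x"
      unfolding partial_deriv_def[of j \<phi>] partial_deriv_def[of j \<psi>]
      using Suc.prems
      by (intro partial_deriv_eqI[where D="\<lambda>h. frechet_derivative \<phi> (at x) h + frechet_derivative \<psi> (at x) h"]
            has_derivative_add differentiable_has_frechet) auto
  qed
  then show ?case using Suc by (auto intro!: differentiable_on_add)
qed

lemma C_k_mult: "C_k k \<phi> \<Longrightarrow> C_k k \<psi> \<Longrightarrow> C_k k (\<lambda>x. \<phi> x * \<psi> x)"
proof (induction k arbitrary: \<phi> \<psi>)
  case 0
  then show ?case by (auto intro: continuous_intros)
next
  case (Suc k)
  have "partial_deriv j (\<lambda>x. \<phi> x * \<psi> x) =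
      (\<lambda>x. \<phi> x * partial_deriv j \<psi> x + partial_deriv j \<phi> x * \<psi> x)" for j
  proof
    fix x
    show "partial_deriv j (\<lambda>x. \<phi> x * \<psi> x) x = \<phi> x * partial_deriv j \<psi> x + partial_deriv j \<phi> x * \<psi> x"
      unfolding partial_deriv_def[of j \<phi>] partial_deriv_def[of j \<psi>]
      using Suc.prems
      by (intro partial_deriv_eqI[where D="\<lambda>h. \<phi> x * frechet_derivative \<psi> (at x) h + frechet_derivative \<phi> (at x) h * \<psi> x"]
            has_derivative_mult differentiable_has_frechet) auto
  qed
  moreover have "C_k k \<phi>" "C_k k \<psi>"
    using Suc.prems C_k_Suc_imp by blast+
  ultimately show ?case using Suc by (auto intro!: differentiable_on_mult C_k_add)
qed

lemma C_k_prod: "finite S \<Longrightarrow> (\<And>i. i \<in> S \<Longrightarrow> C_k k (\<phi> i)) \<Longrightarrow> C_k k (\<lambda>x. \<Prod>i\<in>S. \<phi> i x)"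
  by (induction S rule: finite_induct) (auto intro: C_k_const C_k_mult)

lemma C_k_translate: "C_k k \<phi> \<Longrightarrow> C_k k (\<lambda>x. \<phi> (x + h))"
  and partial_deriv_translate: "\<phi> differentiable_on UNIV \<Longrightarrow>
    partial_deriv j (\<lambda>x. \<phi> (x + h)) = (\<lambda>x. partial_deriv j \<phi> (x + h))"
proof -
  have der: "((\<lambda>x. \<phi> (x + h)) has_derivative frechet_derivative \<phi> (at (x + h))) (at x)"
    if "\<phi> differentiable_on UNIV" for x and \<phi> :: "real^'a \<Rightarrow> real"
  proof -
    have "(\<phi> has_derivative frechet_derivative \<phi> (at (x + h))) (at (x + h))"
      by (rule differentiable_has_frechet[OF that])
    moreover have "((\<lambda>x. x + h) has_derivative (\<lambda>y. y)) (at x)"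
      by (auto intro!: derivative_eq_intros)
    ultimately show ?thesis
      using has_derivative_compose by blast
  qed
  have pd: "partial_deriv j (\<lambda>x. \<phi> (x + h)) = (\<lambda>x. partial_deriv j \<phi> (x + h))"
    if "\<phi> differentiable_on UNIV" for j and \<phi> :: "real^'a \<Rightarrow> real"
    by (rule ext) (simp add: partial_deriv_eqI[OF der[OF that]], simp add: partial_deriv_def)
  show "\<phi> differentiable_on UNIV \<Longrightarrow>
    partial_deriv j (\<lambda>x. \<phi> (x + h)) = (\<lambda>x. partial_deriv j \<phi> (x + h))"
    by (rule pd)
  show "C_k k \<phi> \<Longrightarrow> C_k k (\<lambda>x. \<phi> (x + h))"
  proof (induction k arbitrary: \<phi>)
    case 0
    then show ?case
      by (auto intro!: continuous_on_compose2[of UNIV \<phi>] continuous_intros)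
  next
    case (Suc k)
    then have "(\<lambda>x. \<phi> (x + h)) differentiable_on UNIV"
      using der by (auto simp: differentiable_on_def differentiable_def)
    then show ?case using Suc pd by auto
  qed
qed

section \<open>Flat exponentials and smooth bumps on boxes\<close>

definition flat_exp :: "real \<Rightarrow> nat \<Rightarrow> real \<Rightarrow> real" where
  "flat_exp c m t = (if t > 0 then exp (- c / t) / t ^ m else 0)"

text \<open>The negative powers of t are included in \<open>flat_exp\<close> so that the family is
  closed under differentiation; smoothness is then an induction. Away from 0 this is the quotient
  rule, and at 0 the exponential beats every power.\<close>

lemma flat_exp_has_derivative:
  assumes "c > 0"
  shows "(flat_exp c m has_real_derivative c * flat_exp c (m + 2) t - m * flat_exp c (m + 1) t) (at t)"
proof -
  consider "t > 0" | "t < 0" | "t = 0" by linarith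
  then show ?thesis
  proof cases
    case 1
    have "((\<lambda>t. exp (- c / t) / t ^ m) has_real_derivative
        c * flat_exp c (m + 2) t - m * flat_exp c (m + 1) t) (at t)"
    proof -
      have "((\<lambda>t. exp (- c / t) / t ^ m) has_real_derivative
        ((exp (- c / t) * (c / t\<^sup>2)) * t ^ m - exp (- c / t) * (real m * t ^ (m - 1))) / (t ^ m * t ^ m)) (at t)"
        using 1 by (auto intro!: derivative_eq_intros simp: power2_eq_square)
      also have "((exp (- c / t) * (c / t\<^sup>2)) * t ^ m - exp (- c / t) * (real m * t ^ (m - 1))) / (t ^ m * t ^ m)
         = c * flat_exp c (m + 2) t - m * flat_exp c (m + 1) t"
        using 1 by (cases m) (simp_all add: flat_exp_def divide_simps power2_eq_square algebra_simps)
      finally show ?thesis .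
    qed
    moreover have "\<forall>\<^sub>F s in nhds t. flat_exp c m s = exp (- c / s) / s ^ m"
      using 1 eventually_nhds_in_open[of "{0<..}" t]
      by (auto simp: flat_exp_def elim: eventually_mono)
    ultimately show ?thesis
      by (subst DERIV_cong_ev[OF refl _ refl]) auto
  next
    case 2
    have "\<forall>\<^sub>F s in nhds t. flat_exp c m s = 0"
      using 2 eventually_nhds_in_open[of "{..<0}" t]
      by (auto simp: flat_exp_def elim: eventually_mono)
    moreover have "((\<lambda>_. 0) has_real_derivative 0) (at t)" by simp
    ultimately show ?thesis
      using 2 DERIV_cong_ev[of t t "flat_exp c m" "\<lambda>_. 0" 0] by (simp add: flat_exp_def)
  next
    case 3
    \<comment> \<open>This is the right difference quotient at 0, hence the exponent m + 1.
      Substituting z = c / s turns it into z^(m+1) / exp z up to a constant factor.\<close>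
    have r: "((\<lambda>s. exp (- c / s) / s ^ (m + 1)) \<longlongrightarrow> 0) (at_right 0)"
    proof -
      have "((\<lambda>z::real. z ^ (m + 1) / exp z) \<longlongrightarrow> 0) at_top"
        by (rule tendsto_power_div_exp_0)
      moreover have "LIM s at_right 0. c / s :> at_top"
        using assms by real_asymp
      ultimately have "((\<lambda>s. (c / s) ^ (m + 1) / exp (c / s)) \<longlongrightarrow> 0) (at_right 0)"
        by (rule filterlim_compose)
      then have "((\<lambda>s. (c / s) ^ (m + 1) / exp (c / s) / c ^ (m + 1)) \<longlongrightarrow> 0 / c ^ (m + 1)) (at_right 0)"
        using assms by (intro tendsto_divide) auto
      moreover have "(c / s) ^ (m + 1) / exp (c / s) / c ^ (m + 1) = exp (- c / s) / s ^ (m + 1)" for s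
        using assms by (simp add: power_divide exp_minus field_simps)
      ultimately show ?thesis by simp
    qed
    have "((\<lambda>s. flat_exp c m s / s) \<longlongrightarrow> 0) (at_right 0)"
      by (rule Lim_transform_eventually[OF r])
        (auto simp: flat_exp_def eventually_at_filter)
    moreover have "((\<lambda>s. flat_exp c m s / s) \<longlongrightarrow> 0) (at_left 0)"
      by (rule tendsto_eventually) (auto simp: flat_exp_def eventually_at_filter)
    ultimately have "((\<lambda>s. flat_exp c m s / s) \<longlongrightarrow> 0) (at 0)"
      by (simp add: filterlim_split_at)
    then show ?thesis
      using 3 by (simp add: has_field_derivative_iff flat_exp_def)
  qed
qed

text \<open>The induction keeps m arbitrary because each derivative raises it by one or two. The
  sign \<sigma> is 1 or -1 in use, one value for each of the two faces of a box in direction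
  j.\<close>

lemma C_k_flat_exp:
  fixes j :: "'n::finite"
  assumes "c > 0"
  shows "C_k k (\<lambda>x::real^'n. flat_exp c m (\<sigma> * (x $ j) + a))"
proof (induction k arbitrary: m)
  case 0
  have "continuous_on UNIV (flat_exp c m)"
    using flat_exp_has_derivative[OF assms] DERIV_isCont continuous_at_imp_continuous_on by blast
  then show ?case
    by (auto intro!: continuous_on_compose2[of UNIV "flat_exp c m"] continuous_intros)
next
  case (Suc k)
  let ?d = "\<lambda>x::real^'n. c * flat_exp c (m + 2) (\<sigma> * (x $ j) + a) - m * flat_exp c (m + 1) (\<sigma> * (x $ j) + a)"
  have der: "((\<lambda>x::real^'n. flat_exp c m (\<sigma> * (x $ j) + a)) has_derivative
      (\<lambda>h. ?d x * (\<sigma> * (h $ j)))) (at x)" for x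
  proof -
    have "(flat_exp c m has_derivative (\<lambda>h. ?d x * h)) (at (\<sigma> * (x $ j) + a))"
      using flat_exp_has_derivative[OF assms] by (simp add: has_field_derivative_def)
    moreover have "((\<lambda>x. \<sigma> * (x $ j) + a) has_derivative (\<lambda>h. \<sigma> * (h $ j))) (at x)"
      by (auto intro!: derivative_eq_intros bounded_linear_imp_has_derivative bounded_linear_vec_nth)
    ultimately show ?thesis using has_derivative_compose by blast
  qed
  have "partial_deriv i (\<lambda>x::real^'n. flat_exp c m (\<sigma> * (x $ j) + a)) =
     (\<lambda>x. (\<sigma> * (axis i 1 $ j)) * (c * flat_exp c (m + 2) (\<sigma> * (x $ j) + a) +
        (- m) * flat_exp c (m + 1) (\<sigma> * (x $ j) + a)))" for i
    by (rule ext, subst partial_deriv_eqI[OF der]) (simp add: algebra_simps)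
  moreover have "C_k k (\<lambda>x::real^'n. (\<sigma> * (axis i 1 $ j)) * (c * flat_exp c (m + 2) (\<sigma> * (x $ j) + a) +
        (- m) * flat_exp c (m + 1) (\<sigma> * (x $ j) + a)))" for i
    by (intro C_k_mult C_k_const C_k_add Suc)
  ultimately show ?case
    using der by (auto simp: differentiable_on_def differentiable_def)
qed

definition bump :: "real \<Rightarrow> real^'n::finite \<Rightarrow> real^'n \<Rightarrow> real^'n \<Rightarrow> real" where
  "bump c a b x = (\<Prod>j\<in>UNIV. flat_exp c 0 (x $ j - a $ j) * flat_exp c 0 (b $ j - x $ j))"

lemma bump_eq_0: "x \<notin> box a b \<Longrightarrow> bump c a b x = 0"
  by (force simp: bump_def mem_box_cart flat_exp_def prod_zero_iff)

lemma bump_pos: "x \<in> box a b \<Longrightarrow> bump c a b x > 0"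
  by (auto simp: bump_def mem_box_cart flat_exp_def intro!: prod_pos)

lemma bump_bounds: "c > 0 \<Longrightarrow> 0 \<le> bump c a b x \<and> bump c a b x \<le> 1"
proof -
  assume "c > 0"
  then have "0 \<le> flat_exp c 0 t \<and> flat_exp c 0 t \<le> 1" for t
    by (auto simp: flat_exp_def)
  then show ?thesis unfolding bump_def
    by (auto intro!: prod_nonneg prod_le_1 mult_le_one)
qed

text \<open>Every factor exp(-c/t) with t > 0 tends to 1 as c tends to 0. Together with the bounds 0
  and 1 this carries integral identities from test functions to boxes by dominated
  convergence.\<close>

lemma bump_tendsto_indicator:
  "(\<lambda>i. bump (1 / real (Suc i)) a b x) \<longlonglongrightarrow> indicator (box a b) x"
proof (cases "x \<in> box a b")
  case False
  then show ?thesis by (simp add: bump_eq_0)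
next
  case True
  have "(\<lambda>i. flat_exp (1 / real (Suc i)) 0 t) \<longlonglongrightarrow> 1" if "t > 0" for t
  proof -
    have "(\<lambda>i. exp (- (1 / real (Suc i)) / t)) \<longlonglongrightarrow> exp (- 0 / t)"
      using that by (intro tendsto_intros LIMSEQ_inverse_real_of_nat[unfolded inverse_eq_divide]) auto
    then show ?thesis using that by (simp add: flat_exp_def)
  qed
  then have "(\<lambda>i. bump (1 / real (Suc i)) a b x) \<longlonglongrightarrow> (\<Prod>j\<in>(UNIV::'a set). 1 * 1)"
    unfolding bump_def using True by (intro tendsto_prod tendsto_mult) (auto simp: mem_box_cart)
  then show ?thesis using True by simp
qed

lemma test_function_bump:
  assumes "c > 0"
  shows "test_function (bump c a b)"
proof -
  have "C_k k (bump c a b)" for k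
    unfolding bump_def[abs_def]
    using C_k_flat_exp[OF assms, of k 0 1 _ "- a $ _"] C_k_flat_exp[OF assms, of k 0 "-1" _ "b $ _"]
    by (intro C_k_prod C_k_mult) auto
  moreover have "{x. bump c a b x \<noteq> 0} \<subseteq> cbox a b"
    using bump_eq_0 box_subset_cbox by blast
  then have "bounded {x. bump c a b x \<noteq> 0}"
    using bounded_cbox bounded_subset by blast
  then have "compact (closure {x. bump c a b x \<noteq> 0})" by (simp add: compact_closure)
  ultimately show ?thesis by (simp add: test_function_def)
qed

section \<open>Supports, bounds and differentials of test functions\<close>

lemma test_function_differentiable: "test_function \<phi> \<Longrightarrow> \<phi> differentiable_on UNIV"
  unfolding test_function_def by (metis C_k.simps(2))

lemma test_function_continuous: "test_function \<phi> \<Longrightarrow> continuous_on UNIV \<phi>"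
  using differentiable_imp_continuous_on test_function_differentiable by blast

lemma test_function_borel [measurable_dest]: "test_function \<phi> \<Longrightarrow> \<phi> \<in> borel_measurable borel"
  by (simp add: borel_measurable_continuous_onI test_function_continuous)

lemma test_function_partial_deriv:
  assumes "test_function \<phi>"
  shows "test_function (partial_deriv j \<phi>)"
proof -
  have "C_k k (partial_deriv j \<phi>)" for k
    using assms unfolding test_function_def by (metis C_k.simps(2))
  moreover have "{x. partial_deriv j \<phi> x \<noteq> 0} \<subseteq> closure {x. \<phi> x \<noteq> 0}"
  proof clarify
    fix x assume nz: "partial_deriv j \<phi> x \<noteq> 0"
    show "x \<in> closure {x. \<phi> x \<noteq> 0}"
    proof (rule ccontr)
      assume x: "x \<notin> closure {x. \<phi> x \<noteq> 0}"
      \<comment> \<open>Off the closed support the function vanishes on a whole open set, so its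
        differential is zero there.\<close>
      have "(\<phi> has_derivative (\<lambda>_. 0)) (at x)"
      proof (rule has_derivative_transform_within_open[where f="\<lambda>_. 0" and s="- closure {x. \<phi> x \<noteq> 0}"])
        show "0 = \<phi> y" if "y \<in> - closure {x. \<phi> x \<noteq> 0}" for y
          using that closure_subset[of "{x. \<phi> x \<noteq> 0}"] by fastforce
      qed (use x in auto)
      with nz show False by (simp add: partial_deriv_eqI)
    qed
  qed
  then have "bounded {x. partial_deriv j \<phi> x \<noteq> 0}"
    using assms bounded_subset compact_imp_bounded unfolding test_function_def by blast
  then have "compact (closure {x. partial_deriv j \<phi> x \<noteq> 0})" by (simp add: compact_closure)
  ultimately show ?thesis by (simp add: test_function_def)
qed

lemma test_function_translate:
  assumes "test_function \<phi>"
  shows "test_function (\<lambda>x. \<phi> (x + h))"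
proof -
  have "{x. \<phi> (x + h) \<noteq> 0} \<subseteq> (\<lambda>x. x - h) ` closure {x. \<phi> x \<noteq> 0}"
  proof clarify
    fix x assume "\<phi> (x + h) \<noteq> 0"
    then have "x + h \<in> closure {x. \<phi> x \<noteq> 0}"
      using closure_subset[of "{x. \<phi> x \<noteq> 0}"] by auto
    moreover have "x = (x + h) - h" by simp
    ultimately show "x \<in> (\<lambda>x. x - h) ` closure {x. \<phi> x \<noteq> 0}" by (rule rev_image_eqI)
  qed
  moreover have "compact ((\<lambda>x. x - h) ` closure {x. \<phi> x \<noteq> 0})"
    using assms by (auto simp: test_function_def intro!: compact_continuous_image continuous_intros)
  ultimately have "bounded {x. \<phi> (x + h) \<noteq> 0}"
    using bounded_subset compact_imp_bounded by blast
  then have "compact (closure {x. \<phi> (x + h) \<noteq> 0})" by (simp add: compact_closure)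
  with assms show ?thesis by (auto simp: test_function_def C_k_translate)
qed

lemma test_function_supportE:
  assumes "test_function \<phi>"
  obtains R where "R > 0" "\<And>x. norm x > R \<Longrightarrow> \<phi> x = 0"
proof -
  have "bounded {x. \<phi> x \<noteq> 0}"
    using assms bounded_subset[OF _ closure_subset] compact_imp_bounded unfolding test_function_def by blast
  then obtain R where "R > 0" "\<forall>x\<in>{x. \<phi> x \<noteq> 0}. norm x \<le> R"
    using bounded_pos by blast
  with that show ?thesis by force
qed

lemma test_function_boundedE:
  assumes "test_function \<phi>"
  obtains B where "B > 0" "\<And>x. \<bar>\<phi> x\<bar> \<le> B"
proof -
  obtain R where R: "R > 0" "\<And>x. norm x > R \<Longrightarrow> \<phi> x = 0"
    using test_function_supportE[OF assms] by blast
  have "compact (\<phi> ` cball 0 R)"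
    by (intro compact_continuous_image) (auto intro: continuous_on_subset[OF test_function_continuous[OF assms]])
  then obtain B where B: "B > 0" "\<forall>y\<in>\<phi> ` cball 0 R. norm y \<le> B"
    using bounded_pos compact_imp_bounded by blast
  have "\<bar>\<phi> x\<bar> \<le> B" for x
    using B R(2)[of x] by (cases "norm x \<le> R") (auto simp: less_imp_le)
  with B(1) that show ?thesis by blast
qed

text \<open>The differential is expanded in coordinate partials because weak derivatives are tested
  against those only.\<close>

definition dir_deriv :: "(real^'n::finite \<Rightarrow> real) \<Rightarrow> real^'n \<Rightarrow> real^'n \<Rightarrow> real" where
  "dir_deriv \<phi> h x = (\<Sum>j\<in>UNIV. h $ j * partial_deriv j \<phi> x)"

lemma test_function_has_derivative:
  assumes "test_function \<phi>"
  shows "(\<phi> has_derivative (\<lambda>h. dir_deriv \<phi> h x)) (at x)"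
proof -
  have d: "(\<phi> has_derivative frechet_derivative \<phi> (at x)) (at x)"
    by (rule differentiable_has_frechet[OF test_function_differentiable[OF assms]])
  have "frechet_derivative \<phi> (at x) h = dir_deriv \<phi> h x" for h
  proof -
    have lin: "linear (frechet_derivative \<phi> (at x))"
      using d has_derivative_linear by blast
    have "frechet_derivative \<phi> (at x) h = frechet_derivative \<phi> (at x) (\<Sum>j\<in>UNIV. h $ j *\<^sub>R axis j 1)"
      by (simp add: basis_expansion flip: scalar_mult_eq_scaleR)
    also have "\<dots> = dir_deriv \<phi> h x"
      by (simp add: linear_sum[OF lin] linear_cmul[OF lin] dir_deriv_def partial_deriv_def)
    finally show ?thesis .
  qed
  then have "frechet_derivative \<phi> (at x) = (\<lambda>h. dir_deriv \<phi> h x)" by (rule ext)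
  with d show ?thesis by simp
qed

text \<open>The partials are test functions, hence bounded, and the mean value inequality applies.
  The constant later dominates difference quotients under an integral.\<close>

lemma test_function_lipschitzE:
  assumes "test_function \<phi>"
  obtains L where "L > 0" "\<And>x y. \<bar>\<phi> x - \<phi> y\<bar> \<le> L * norm (x - y)"
proof -
  have "\<exists>B. \<forall>j. B j > 0 \<and> (\<forall>x. \<bar>partial_deriv j \<phi> x\<bar> \<le> B j)"
    by (intro choice allI) (rule test_function_boundedE[OF test_function_partial_deriv[OF assms]], blast)
  then obtain B where B: "\<And>j. B j > 0" "\<And>j x. \<bar>partial_deriv j \<phi> x\<bar> \<le> B j" by blast
  have dd: "\<bar>dir_deriv \<phi> h x\<bar> \<le> sum B UNIV * norm h" for h x
  proof -
    have "\<bar>dir_deriv \<phi> h x\<bar> \<le> (\<Sum>j\<in>UNIV. \<bar>h $ j * partial_deriv j \<phi> x\<bar>)"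
      unfolding dir_deriv_def by (rule sum_abs)
    also have "\<dots> \<le> (\<Sum>j\<in>UNIV. norm h * B j)"
      by (intro sum_mono) (auto simp: abs_mult component_le_norm_cart less_imp_le B intro!: mult_mono)
    finally show ?thesis by (simp add: sum_distrib_left mult.commute)
  qed
  have "\<bar>\<phi> x - \<phi> y\<bar> \<le> sum B UNIV * norm (x - y)" for x y
  proof -
    have "norm (\<phi> x - \<phi> y) \<le> sum B UNIV * norm (x - y)"
      using test_function_has_derivative[OF assms]
      by (intro differentiable_bound[of UNIV \<phi> "\<lambda>x h. dir_deriv \<phi> h x"])
        (auto intro!: onorm_le simp: dd)
    then show ?thesis by simp
  qed
  moreover have "sum B UNIV > 0" by (intro sum_pos) (auto simp: B)
  ultimately show ?thesis using that by blast
qed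

section \<open>Square-integrable functions\<close>

text \<open>Coincides with \<open>square_integrable\<close> for complex values. The general codomain
  lets real test functions, vector-valued gradients and the pairs made by \<open>energy_root\<close>
  share one L2 calculus.\<close>

definition sq_int :: "('a::euclidean_space \<Rightarrow> 'b::euclidean_space) \<Rightarrow> bool" where
  "sq_int f \<longleftrightarrow> f \<in> borel_measurable lborel \<and> integrable lborel (\<lambda>x. (norm (f x))\<^sup>2)"

definition l2norm :: "('a::euclidean_space \<Rightarrow> 'b::euclidean_space) \<Rightarrow> real" where
  "l2norm f = sqrt (LINT x|lborel. (norm (f x))\<^sup>2)"

lemma square_integrable_iff: "square_integrable f \<longleftrightarrow> sq_int f"
  by (simp add: square_integrable_def sq_int_def)

lemma sq_int_measurable [measurable_dest]: "sq_int f \<Longrightarrow> f \<in> borel_measurable borel"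
  by (simp add: sq_int_def)

lemma sq_int_integrable: "sq_int f \<Longrightarrow> integrable lborel (\<lambda>x. (norm (f x))\<^sup>2)"
  by (simp add: sq_int_def)

lemma l2norm_nonneg [simp]: "0 \<le> l2norm f"
  by (simp add: l2norm_def)

lemma l2norm_sq: "(l2norm f)\<^sup>2 = (LINT x|lborel. (norm (f x))\<^sup>2)"
  by (simp add: l2norm_def)

lemma l2norm_zero [simp]: "l2norm (\<lambda>x. 0) = 0"
  by (simp add: l2norm_def)

lemma sq_int_zero [simp]: "sq_int (\<lambda>x. 0)"
  by (simp add: sq_int_def)

lemma sq_int_bound:
  assumes "sq_int f" and [measurable]: "g \<in> borel_measurable borel"
    and "AE x in lborel. norm (g x) \<le> C * norm (f x)"
  shows "sq_int g"
proof -
  have "AE x in lborel. norm ((norm (g x))\<^sup>2) \<le> norm (C\<^sup>2 * (norm (f x))\<^sup>2)"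
    using assms(3)
  proof eventually_elim
    case (elim x)
    then have "(norm (g x))\<^sup>2 \<le> (C * norm (f x))\<^sup>2" by (intro power_mono) auto
    then show ?case by (simp add: power_mult_distrib)
  qed
  moreover have "integrable lborel (\<lambda>x. C\<^sup>2 * (norm (f x))\<^sup>2)"
    using assms(1) by (simp add: sq_int_def)
  moreover have "(\<lambda>x. (norm (g x))\<^sup>2) \<in> borel_measurable lborel" by measurable
  ultimately have "integrable lborel (\<lambda>x. (norm (g x))\<^sup>2)"
    using Bochner_Integration.integrable_bound by blast
  then show ?thesis by (simp add: sq_int_def)
qed

lemma l2norm_mono:
  assumes "sq_int f" "g \<in> borel_measurable borel"
    and "AE x in lborel. norm (g x) \<le> C * norm (f x)" "C \<ge> 0"
  shows "l2norm g \<le> C * l2norm f"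
proof -
  have g: "sq_int g" by (rule sq_int_bound[OF assms(1-3)])
  have "(LINT x|lborel. (norm (g x))\<^sup>2) \<le> (LINT x|lborel. C\<^sup>2 * (norm (f x))\<^sup>2)"
  proof (rule integral_mono_AE)
    show "AE x in lborel. (norm (g x))\<^sup>2 \<le> C\<^sup>2 * (norm (f x))\<^sup>2"
      using assms(3)
    proof eventually_elim
      case (elim x)
      then have "(norm (g x))\<^sup>2 \<le> (C * norm (f x))\<^sup>2" by (intro power_mono) auto
      then show ?case by (simp add: power_mult_distrib)
    qed
  qed (use g assms(1) in \<open>auto simp: sq_int_def\<close>)
  then have "(l2norm g)\<^sup>2 \<le> (C * l2norm f)\<^sup>2"
    by (simp add: power_mult_distrib l2norm_sq)
  then show ?thesis
    using assms(4) by (meson l2norm_nonneg mult_nonneg_nonneg power2_le_imp_le)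
qed

lemma l2norm_cong_AE:
  assumes "f \<in> borel_measurable borel" "g \<in> borel_measurable borel" "AE x in lborel. f x = g x"
  shows "l2norm f = l2norm g"
  unfolding l2norm_def
  by (intro arg_cong[of _ _ sqrt] integral_cong_AE) (use assms in auto)

lemma sq_int_add:
  assumes "sq_int f" "sq_int g"
  shows "sq_int (\<lambda>x. f x + g x)"
proof -
  have [measurable]: "f \<in> borel_measurable borel" "g \<in> borel_measurable borel"
    using assms by (auto simp: sq_int_def)
  have "integrable lborel (\<lambda>x. (norm (f x + g x))\<^sup>2)"
  proof (rule Bochner_Integration.integrable_bound[of lborel "\<lambda>x. 2 * (norm (f x))\<^sup>2 + 2 * (norm (g x))\<^sup>2"])
    have "(norm (f x + g x))\<^sup>2 \<le> 2 * (norm (f x))\<^sup>2 + 2 * (norm (g x))\<^sup>2" for x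
    proof -
      have "(norm (f x + g x))\<^sup>2 \<le> (norm (f x) + norm (g x))\<^sup>2"
        by (intro power_mono norm_triangle_ineq) auto
      also have "\<dots> \<le> 2 * (norm (f x))\<^sup>2 + 2 * (norm (g x))\<^sup>2"
        using zero_le_power2[of "norm (f x) - norm (g x)"] by (simp add: power2_eq_square algebra_simps)
      finally show ?thesis .
    qed
    then show "AE x in lborel. norm ((norm (f x + g x))\<^sup>2) \<le> norm (2 * (norm (f x))\<^sup>2 + 2 * (norm (g x))\<^sup>2)"
      by simp
  qed (use assms in \<open>auto simp: sq_int_def\<close>)
  then show ?thesis by (simp add: sq_int_def)
qed

lemma sq_int_scaleR: "sq_int f \<Longrightarrow> sq_int (\<lambda>x. c *\<^sub>R f x)"
  by (rule sq_int_bound[of f _ "\<bar>c\<bar>"]) (auto simp: sq_int_def)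

lemma sq_int_minus: "sq_int f \<Longrightarrow> sq_int (\<lambda>x. - f x)"
  using sq_int_scaleR[of f "-1"] by simp

lemma sq_int_diff: "sq_int f \<Longrightarrow> sq_int g \<Longrightarrow> sq_int (\<lambda>x. f x - g x)"
  using sq_int_add[of f "\<lambda>x. - g x"] sq_int_minus[of g] by simp

lemma l2norm_scaleR: "l2norm (\<lambda>x. c *\<^sub>R f x) = \<bar>c\<bar> * l2norm f"
  by (simp add: l2norm_def power_mult_distrib real_sqrt_mult)

lemma l2norm_minus_commute: "l2norm (\<lambda>x. f x - g x) = l2norm (\<lambda>x. g x - f x)"
  by (simp add: l2norm_def norm_minus_commute)

lemma l2_Cauchy_Schwarz:
  assumes "sq_int f" "sq_int g"
  shows "integrable lborel (\<lambda>x. norm (f x) * norm (g x))"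
    and "(LINT x|lborel. norm (f x) * norm (g x)) \<le> l2norm f * l2norm g"
proof -
  have [measurable]: "f \<in> borel_measurable borel" "g \<in> borel_measurable borel"
    using assms by (auto simp: sq_int_def)
  show int: "integrable lborel (\<lambda>x. norm (f x) * norm (g x))"
  proof (rule Bochner_Integration.integrable_bound[of lborel "\<lambda>x. (norm (f x))\<^sup>2 + (norm (g x))\<^sup>2"])
    have "norm (f x) * norm (g x) \<le> (norm (f x))\<^sup>2 + (norm (g x))\<^sup>2" for x
    proof -
      have "2 * (norm (f x) * norm (g x)) \<le> (norm (f x))\<^sup>2 + (norm (g x))\<^sup>2"
        using zero_le_power2[of "norm (f x) - norm (g x)"] by (simp add: power2_eq_square algebra_simps)
      then show ?thesis
        by (smt (verit) mult_nonneg_nonneg norm_ge_zero)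
    qed
    then show "AE x in lborel. norm (norm (f x) * norm (g x)) \<le> norm ((norm (f x))\<^sup>2 + (norm (g x))\<^sup>2)"
      by simp
  qed (use assms in \<open>auto simp: sq_int_def\<close>)
  let ?B = "LINT x|lborel. norm (f x) * norm (g x)"
  have nn: "(\<integral>\<^sup>+x. (ennreal (norm (h x)))\<^sup>2 \<partial>lborel) = ennreal ((l2norm h)\<^sup>2)" if "sq_int h" for h :: "'a \<Rightarrow> 'd::euclidean_space"
    using that by (simp add: l2norm_sq ennreal_power sq_int_def nn_integral_eq_integral)
  have "ennreal ?B = (\<integral>\<^sup>+x. ennreal (norm (f x)) * ennreal (norm (g x)) \<partial>lborel)"
    using int by (simp add: nn_integral_eq_integral flip: ennreal_mult)
  then have "(ennreal ?B)\<^sup>2 \<le> ennreal ((l2norm f)\<^sup>2) * ennreal ((l2norm g)\<^sup>2)"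
    using Cauchy_Schwarz_nn_integral[of "\<lambda>x. ennreal (norm (f x))" lborel "\<lambda>x. ennreal (norm (g x))"] assms
    by (simp add: nn)
  then have "?B\<^sup>2 \<le> (l2norm f * l2norm g)\<^sup>2"
    by (simp add: ennreal_power power_mult_distrib flip: ennreal_mult)
  then show "?B \<le> l2norm f * l2norm g"
    by (meson l2norm_nonneg mult_nonneg_nonneg power2_le_imp_le)
qed

lemma l2norm_triangle:
  assumes "sq_int f" "sq_int g"
  shows "l2norm (\<lambda>x. f x + g x) \<le> l2norm f + l2norm g"
proof -
  have "(LINT x|lborel. (norm (f x + g x))\<^sup>2) \<le>
      (LINT x|lborel. (norm (f x))\<^sup>2 + 2 * (norm (f x) * norm (g x)) + (norm (g x))\<^sup>2)"
  proof (rule integral_mono)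
    fix x
    have "(norm (f x + g x))\<^sup>2 \<le> (norm (f x) + norm (g x))\<^sup>2"
      by (intro power_mono norm_triangle_ineq) auto
    then show "(norm (f x + g x))\<^sup>2 \<le> (norm (f x))\<^sup>2 + 2 * (norm (f x) * norm (g x)) + (norm (g x))\<^sup>2"
      by (simp add: power2_eq_square algebra_simps)
  qed (use assms sq_int_add[OF assms] l2_Cauchy_Schwarz(1)[OF assms] in \<open>auto simp: sq_int_def\<close>)
  also have "\<dots> = (l2norm f)\<^sup>2 + 2 * (LINT x|lborel. norm (f x) * norm (g x)) + (l2norm g)\<^sup>2"
    using assms l2_Cauchy_Schwarz(1)[OF assms] by (simp add: l2norm_sq sq_int_def)
  also have "\<dots> \<le> (l2norm f + l2norm g)\<^sup>2"
    using l2_Cauchy_Schwarz(2)[OF assms] by (simp add: power2_eq_square algebra_simps)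
  finally have "(l2norm (\<lambda>x. f x + g x))\<^sup>2 \<le> (l2norm f + l2norm g)\<^sup>2"
    by (simp add: l2norm_sq)
  then show ?thesis
    by (meson add_nonneg_nonneg l2norm_nonneg power2_le_imp_le)
qed

lemma l2norm_triangle_diff:
  assumes "sq_int f" "sq_int g" "sq_int h"
  shows "l2norm (\<lambda>x. f x - h x) \<le> l2norm (\<lambda>x. f x - g x) + l2norm (\<lambda>x. g x - h x)"
  using l2norm_triangle[of "\<lambda>x. f x - g x" "\<lambda>x. g x - h x"] assms by (simp add: sq_int_diff)

lemma l2norm_triangle_le:
  assumes "sq_int f" "sq_int g"
  shows "l2norm f \<le> l2norm g + l2norm (\<lambda>x. f x - g x)"
  using l2norm_triangle[of g "\<lambda>x. f x - g x"] assms by (simp add: sq_int_diff)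

lemma l2_parallelogram:
  assumes "sq_int f" "sq_int g"
  shows "(l2norm (\<lambda>x. f x - g x))\<^sup>2 =
    2 * (l2norm f)\<^sup>2 + 2 * (l2norm g)\<^sup>2 - 4 * (l2norm (\<lambda>x. (1/2) *\<^sub>R (f x + g x)))\<^sup>2"
proof -
  have *: "(norm (f x - g x))\<^sup>2 = 2 * (norm (f x))\<^sup>2 + 2 * (norm (g x))\<^sup>2 - 4 * (norm ((1/2) *\<^sub>R (f x + g x)))\<^sup>2" for x
    by (simp add: power_mult_distrib power2_norm_eq_inner inner_add inner_diff inner_commute power_divide field_simps)
  have i: "integrable lborel (\<lambda>x. 4 * (norm ((1/2) *\<^sub>R (f x + g x)))\<^sup>2)"
    using sq_int_scaleR[OF sq_int_add[OF assms], of "1/2"] unfolding sq_int_def by (intro integrable_mult_right) blast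
  have "(l2norm (\<lambda>x. f x - g x))\<^sup>2 = (LINT x|lborel. (2 * (norm (f x))\<^sup>2 + 2 * (norm (g x))\<^sup>2) - 4 * (norm ((1/2) *\<^sub>R (f x + g x)))\<^sup>2)"
    unfolding l2norm_sq * ..
  also have "\<dots> = (LINT x|lborel. (2 * (norm (f x))\<^sup>2 + 2 * (norm (g x))\<^sup>2)) - (LINT x|lborel. 4 * (norm ((1/2) *\<^sub>R (f x + g x)))\<^sup>2)"
    using assms by (intro Bochner_Integration.integral_diff i) (auto simp: sq_int_def)
  also have "\<dots> = 2 * (l2norm f)\<^sup>2 + 2 * (l2norm g)\<^sup>2 - 4 * (l2norm (\<lambda>x. (1/2) *\<^sub>R (f x + g x)))\<^sup>2"
    using assms unfolding l2norm_sq by (subst Bochner_Integration.integral_add) (auto simp: sq_int_def)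
  finally show ?thesis .
qed

text \<open>Fatou's lemma for the squared norms. The bound is assumed only eventually, which fits
  tails of Cauchy sequences and norms that converge.\<close>

lemma l2_fatou:
  assumes f: "\<And>i. sq_int (f i)" and [measurable]: "h \<in> borel_measurable borel"
    and lim: "AE x in lborel. (\<lambda>i. f i x) \<longlonglongrightarrow> h x"
    and bd: "\<forall>\<^sub>F i in sequentially. l2norm (f i) \<le> B"
  shows "sq_int h" "l2norm h \<le> B"
proof -
  have [measurable]: "\<And>i. f i \<in> borel_measurable borel" using f by (simp add: sq_int_def)
  have B: "B \<ge> 0"
    using bd by (metis (mono_tags, lifting) eventually_sequentially dual_order.trans l2norm_nonneg order_refl)
  have "(\<integral>\<^sup>+x. ennreal ((norm (h x))\<^sup>2) \<partial>lborel) = (\<integral>\<^sup>+x. liminf (\<lambda>i. ennreal ((norm (f i x))\<^sup>2)) \<partial>lborel)"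
  proof (rule nn_integral_cong_AE)
    show "AE x in lborel. ennreal ((norm (h x))\<^sup>2) = liminf (\<lambda>i. ennreal ((norm (f i x))\<^sup>2))"
      using lim
    proof eventually_elim
      case (elim x)
      then have "(\<lambda>i. ennreal ((norm (f i x))\<^sup>2)) \<longlonglongrightarrow> ennreal ((norm (h x))\<^sup>2)"
        by (intro tendsto_ennrealI tendsto_intros)
      then show ?case by (metis lim_imp_Liminf trivial_limit_sequentially)
    qed
  qed
  also have "\<dots> \<le> liminf (\<lambda>i. \<integral>\<^sup>+x. ennreal ((norm (f i x))\<^sup>2) \<partial>lborel)"
    by (rule nn_integral_liminf) measurable
  also have "\<dots> = liminf (\<lambda>i. ennreal ((l2norm (f i))\<^sup>2))"
    using f by (simp add: nn_integral_eq_integral sq_int_def l2norm_sq)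
  also have "\<dots> \<le> liminf (\<lambda>i. ennreal (B\<^sup>2))"
    by (intro Liminf_mono eventually_mono[OF bd] ennreal_leI power_mono) auto
  also have "\<dots> = ennreal (B\<^sup>2)" by (simp add: Liminf_const)
  finally have le: "(\<integral>\<^sup>+x. ennreal ((norm (h x))\<^sup>2) \<partial>lborel) \<le> ennreal (B\<^sup>2)" .
  then have int: "integrable lborel (\<lambda>x. (norm (h x))\<^sup>2)"
    by (intro integrableI_bounded) (auto simp: less_top[symmetric] top_unique intro: le_less_trans)
  then show "sq_int h" by (simp add: sq_int_def)
  have "ennreal ((l2norm h)\<^sup>2) \<le> ennreal (B\<^sup>2)"
    using le int by (simp add: nn_integral_eq_integral l2norm_sq)
  then have "(l2norm h)\<^sup>2 \<le> B\<^sup>2" by simp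
  then show "l2norm h \<le> B" using B power2_le_imp_le by blast
qed

text \<open>Convergence in L2 is L1 convergence of the squared distances to 0, and this holds almost
  everywhere along a subsequence.\<close>

lemma l2_AE_subseq:
  assumes "\<And>i. sq_int (f i)" "sq_int h" "(\<lambda>i. l2norm (\<lambda>x. f i x - h x)) \<longlonglongrightarrow> 0"
  obtains r where "strict_mono r" "AE x in lborel. (\<lambda>i. f (r i) x) \<longlonglongrightarrow> h x"
proof -
  have s: "sq_int (\<lambda>x. f i x - h x)" for i using assms by (simp add: sq_int_diff)
  have "(\<lambda>i. (l2norm (\<lambda>x. f i x - h x))\<^sup>2) \<longlonglongrightarrow> 0\<^sup>2"
    by (intro tendsto_intros assms)
  then have "(\<lambda>i. LINT x|lborel. norm ((norm (f i x - h x))\<^sup>2)) \<longlonglongrightarrow> 0"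
    by (simp add: l2norm_sq)
  then obtain r :: "nat \<Rightarrow> nat" where r: "strict_mono r"
    "AE x in lborel. (\<lambda>i. (norm (f (r i) x - h x))\<^sup>2) \<longlonglongrightarrow> 0"
    using tendsto_L1_AE_subseq[of lborel "\<lambda>i x. (norm (f i x - h x))\<^sup>2"] sq_int_integrable[OF s] by blast
  have "AE x in lborel. (\<lambda>i. f (r i) x) \<longlonglongrightarrow> h x"
    using r(2)
  proof eventually_elim
    case (elim x)
    have "(\<lambda>i. sqrt ((norm (f (r i) x - h x))\<^sup>2)) \<longlonglongrightarrow> sqrt 0"
      by (intro tendsto_intros elim)
    then have "(\<lambda>i. norm (f (r i) x - h x)) \<longlonglongrightarrow> 0" by simp
    then show ?case using LIM_zero_cancel tendsto_norm_zero_iff by blast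
  qed
  with r(1) that show ?thesis by blast
qed

section \<open>Completeness of L2 and almost-minimizers of the norm\<close>

definition l2_Cauchy :: "(nat \<Rightarrow> 'a::euclidean_space \<Rightarrow> 'b::euclidean_space) \<Rightarrow> bool" where
  "l2_Cauchy f \<longleftrightarrow> (\<forall>e>0. \<exists>N. \<forall>i\<ge>N. \<forall>j\<ge>N. l2norm (\<lambda>x. f i x - f j x) < e)"

text \<open>A strictly positive integrable weight \<open>w\<close>, bounded by 1 and hence square
  integrable, makes the sequence Cauchy in L1 by the Cauchy-Schwarz inequality. A subsequence of the
  weighted functions converges almost everywhere, and dividing by the weight gives the
  limit.\<close>

lemma l2_complete:
  fixes f :: "nat \<Rightarrow> 'a::euclidean_space \<Rightarrow> 'b::euclidean_space"
  assumes f: "\<And>i. sq_int (f i)" and C: "l2_Cauchy f"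
  obtains h where "sq_int h" "(\<lambda>i. l2norm (\<lambda>x. f i x - h x)) \<longlonglongrightarrow> 0"
proof -
  have [measurable]: "\<And>i. f i \<in> borel_measurable borel" using f by (simp add: sq_int_def)
  obtain w :: "'a \<Rightarrow> real" where w [measurable]: "w \<in> borel_measurable lborel"
    and w01: "\<And>x. w x > 0" "\<And>x. w x \<le> 1" and wi: "integrable lborel w"
    using sigma_finite_measure.obtain_positive_integrable_function[OF sigma_finite_lborel] by blast
  have w2: "sq_int w"
    unfolding sq_int_def
  proof (intro conjI w Bochner_Integration.integrable_bound[OF wi])
    show "AE x in lborel. norm ((norm (w x))\<^sup>2) \<le> norm (w x)"
      using w01 by (intro AE_I2) (simp add: power2_eq_square less_imp_le mult_left_le)
  qed auto
  have wL: "integrable lborel (\<lambda>x. w x *\<^sub>R f i x)" for i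
    using l2_Cauchy_Schwarz(1)[OF w2 f[of i]] w01
    by (subst integrable_norm_iff[symmetric]) (auto simp: less_imp_le)
  have "\<exists>N. \<forall>i\<ge>N. \<forall>j\<ge>N. LINT x|lborel. norm (w x *\<^sub>R f i x - w x *\<^sub>R f j x) < e" if "e > 0" for e
  proof -
    have "e / (l2norm w + 1) > 0" using that by (simp add: add_nonneg_pos)
    then obtain N where N: "\<And>i j. i \<ge> N \<Longrightarrow> j \<ge> N \<Longrightarrow> l2norm (\<lambda>x. f i x - f j x) < e / (l2norm w + 1)"
      using C unfolding l2_Cauchy_def by meson
    have "LINT x|lborel. norm (w x *\<^sub>R f i x - w x *\<^sub>R f j x) < e" if "i \<ge> N" "j \<ge> N" for i j
    proof -
      have "(LINT x|lborel. norm (w x *\<^sub>R f i x - w x *\<^sub>R f j x)) = (LINT x|lborel. norm (w x) * norm (f i x - f j x))"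
        by (simp flip: scaleR_diff_right)
      also have "\<dots> \<le> l2norm w * l2norm (\<lambda>x. f i x - f j x)"
        by (intro l2_Cauchy_Schwarz w2 sq_int_diff f)
      also have "\<dots> \<le> (l2norm w + 1) * l2norm (\<lambda>x. f i x - f j x)"
        by (intro mult_right_mono) auto
      also have "\<dots> < e"
        using N[OF that] by (simp add: less_divide_eq add_nonneg_pos mult.commute)
      finally show ?thesis .
    qed
    then show ?thesis by blast
  qed
  then obtain r where r: "strict_mono r" "AE x in lborel. Cauchy (\<lambda>i. w x *\<^sub>R f (r i) x)"
    using cauchy_L1_AE_cauchy_subseq[of lborel "\<lambda>i x. w x *\<^sub>R f i x"] wL by blast
  define h where "h x = lim (\<lambda>i. f (r i) x)" for x
  have hm [measurable]: "h \<in> borel_measurable borel"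
    unfolding h_def[abs_def] by measurable
  have lim: "AE x in lborel. (\<lambda>i. f (r i) x) \<longlonglongrightarrow> h x"
    using r(2)
  proof eventually_elim
    case (elim x)
    then obtain l where "(\<lambda>i. w x *\<^sub>R f (r i) x) \<longlonglongrightarrow> l"
      using Cauchy_convergent_iff convergent_def by blast
    then have "(\<lambda>i. inverse (w x) *\<^sub>R (w x *\<^sub>R f (r i) x)) \<longlonglongrightarrow> inverse (w x) *\<^sub>R l"
      by (intro tendsto_intros)
    then have "(\<lambda>i. f (r i) x) \<longlonglongrightarrow> inverse (w x) *\<^sub>R l"
      using w01(1)[of x] by simp
    then show ?case by (simp add: h_def limI)
  qed
  \<comment> \<open>With \<open>f i\<close> fixed, Fatou along the subsequence turns the Cauchy
    estimate into a bound on the distance to \<open>h\<close>; it also shows that this distance is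
    finite.\<close>
  have key: "sq_int (\<lambda>x. f i x - h x) \<and> l2norm (\<lambda>x. f i x - h x) \<le> e"
    if N: "\<And>i j. i \<ge> N \<Longrightarrow> j \<ge> N \<Longrightarrow> l2norm (\<lambda>x. f i x - f j x) < e" and "i \<ge> N" for i e N
  proof -
    have "AE x in lborel. (\<lambda>j. f i x - f (r j) x) \<longlonglongrightarrow> f i x - h x"
      using lim by eventually_elim (intro tendsto_intros)
    moreover have "\<forall>\<^sub>F j in sequentially. l2norm (\<lambda>x. f i x - f (r j) x) \<le> e"
      using eventually_ge_at_top[of N]
    proof eventually_elim
      case (elim j)
      then have "r j \<ge> N" using seq_suble[OF r(1), of j] by linarith
      then show ?case using N[OF \<open>i \<ge> N\<close>] less_imp_le by blast
    qed
    moreover have "sq_int (\<lambda>x. f i x - f (r j) x)" for j by (intro sq_int_diff f)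
    moreover have "(\<lambda>x. f i x - h x) \<in> borel_measurable borel" by measurable
    ultimately show ?thesis
      using l2_fatou[of "\<lambda>j x. f i x - f (r j) x" "\<lambda>x. f i x - h x" e] by blast
  qed
  have CN: "\<exists>N. \<forall>i\<ge>N. \<forall>j\<ge>N. l2norm (\<lambda>x. f i x - f j x) < e" if "e > 0" for e
    using C that unfolding l2_Cauchy_def by blast
  obtain N where "\<forall>i\<ge>N. \<forall>j\<ge>N. l2norm (\<lambda>x. f i x - f j x) < 1" using CN[of 1] by auto
  then have "sq_int (\<lambda>x. f N x - h x)" using key[of N 1 N] by blast
  then have "sq_int h" using sq_int_diff[OF f[of N], of "\<lambda>x. f N x - h x"] by simp
  moreover have "(\<lambda>i. l2norm (\<lambda>x. f i x - h x)) \<longlonglongrightarrow> 0"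
  proof (rule LIMSEQ_I)
    fix e :: real assume "e > 0"
    then obtain N where "\<forall>i\<ge>N. \<forall>j\<ge>N. l2norm (\<lambda>x. f i x - f j x) < e / 2" using CN[of "e / 2"] by auto
    then have "\<forall>i\<ge>N. l2norm (\<lambda>x. f i x - h x) \<le> e / 2" using key[of N "e / 2"] by blast
    then show "\<exists>N. \<forall>i\<ge>N. norm (l2norm (\<lambda>x. f i x - h x) - 0) < e"
      using \<open>e > 0\<close> by (intro exI[of _ N]) auto
  qed
  ultimately show ?thesis using that by blast
qed

lemma l2_Cauchy_mono:
  assumes "l2_Cauchy f" "C > 0"
    "\<And>i j. l2norm (\<lambda>x. g i x - g j x) \<le> C * l2norm (\<lambda>x. f i x - f j x)"
  shows "l2_Cauchy g"
  unfolding l2_Cauchy_def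
proof (intro allI impI)
  fix e :: real assume "e > 0"
  then have "e / C > 0" using assms by simp
  then obtain N where "\<forall>i\<ge>N. \<forall>j\<ge>N. l2norm (\<lambda>x. f i x - f j x) < e / C"
    using assms(1) unfolding l2_Cauchy_def by blast
  then show "\<exists>N. \<forall>i\<ge>N. \<forall>j\<ge>N. l2norm (\<lambda>x. g i x - g j x) < e"
  proof (intro exI[of _ N] allI impI)
    fix i j assume "i \<ge> N" "j \<ge> N"
    then have "l2norm (\<lambda>x. f i x - f j x) < e / C"
      using \<open>\<forall>i\<ge>N. \<forall>j\<ge>N. l2norm (\<lambda>x. f i x - f j x) < e / C\<close> by blast
    then have "C * l2norm (\<lambda>x. f i x - f j x) < e"
      using assms(2) by (simp add: field_simps)
    then show "l2norm (\<lambda>x. g i x - g j x) < e"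
      using assms(3)[of i j] by (rule le_less_trans[rotated])
  qed
qed

text \<open>This replaces weak compactness of balls: almost-minimizers of the norm over a decreasing
  sequence of midpoint-closed sets are Cauchy by the parallelogram law.\<close>

lemma midpoint_closed_Cauchy_minimizers:
  fixes S :: "nat \<Rightarrow> ('a::euclidean_space \<Rightarrow> 'b::euclidean_space) set"
  assumes sq: "\<And>m f. f \<in> S m \<Longrightarrow> sq_int f"
    and dec: "\<And>m. S (Suc m) \<subseteq> S m"
    and mid: "\<And>m f g. f \<in> S m \<Longrightarrow> g \<in> S m \<Longrightarrow> (\<lambda>x. (1/2) *\<^sub>R (f x + g x)) \<in> S m"
    and bd: "\<And>m. \<exists>f\<in>S m. l2norm f \<le> B"
  obtains f where "\<And>m. f m \<in> S m" "l2_Cauchy f"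
    "\<And>m g. g \<in> S m \<Longrightarrow> (l2norm (f m))\<^sup>2 \<le> (l2norm g)\<^sup>2 + 1 / real (Suc m)"
proof -
  define d where "d m = (INF f\<in>S m. (l2norm f)\<^sup>2)" for m
  have ne: "S m \<noteq> {}" for m using bd by blast
  have bb: "bdd_below ((\<lambda>f. (l2norm f)\<^sup>2) ` S m)" for m by (rule bdd_belowI2[of _ 0]) simp
  have dle: "d m \<le> (l2norm g)\<^sup>2" if "g \<in> S m" for g m
    unfolding d_def using bb that by (rule cINF_lower)
  \<comment> \<open>The infimum grows as the sets shrink and stays below the square of
    \<open>B\<close>. Its convergence is what makes almost-minimizers over different sets
    comparable.\<close>
  have "d m \<le> d (Suc m)" for m
    unfolding d_def using ne[of "Suc m"] bb[of m] dec[of m] by (intro cINF_superset_mono) auto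
  then have "incseq d" by (rule incseq_SucI)
  moreover have "d m \<le> B\<^sup>2" for m
    using bd[of m] dle by (meson l2norm_nonneg order_trans power_mono)
  ultimately have "convergent d"
    using incseq_convergent[of d] by (metis convergent_def)
  then have Cd: "Cauchy d" by (rule convergent_Cauchy)
  have "\<exists>f. f \<in> S m \<and> (l2norm f)\<^sup>2 < d m + 1 / real (Suc m)" for m
  proof -
    have "d m < d m + 1 / real (Suc m)" by simp
    then show ?thesis
      unfolding d_def using cINF_less_iff[OF ne bb] by blast
  qed
  then obtain f where f: "\<And>m. f m \<in> S m" "\<And>m. (l2norm (f m))\<^sup>2 < d m + 1 / real (Suc m)" by metis
  have sub: "S j \<subseteq> S i" if "i \<le> j" for i j using lift_Suc_antimono_le[of S i j] dec that by blast
  \<comment> \<open>Both functions lie in the larger set \<open>S i\<close>, so their midpoint does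
    too and has squared norm at least \<open>d i\<close>. The parallelogram law then bounds the
    distance.\<close>
  have est: "(l2norm (\<lambda>x. f i x - f j x))\<^sup>2 \<le> 2 * (d j - d i) + 4 / real (Suc i)" if "i \<le> j" for i j
  proof -
    have "(\<lambda>x. (1/2) *\<^sub>R (f i x + f j x)) \<in> S i"
      using f(1) sub[OF that] by (intro mid) auto
    moreover define A where "A = (l2norm (\<lambda>x. (1/2) *\<^sub>R (f i x + f j x)))\<^sup>2"
    ultimately have "d i \<le> A" using dle by blast
    moreover have "(l2norm (\<lambda>x. f i x - f j x))\<^sup>2 = 2 * (l2norm (f i))\<^sup>2 + 2 * (l2norm (f j))\<^sup>2 - 4 * A"
      unfolding A_def by (rule l2_parallelogram) (use sq f(1) in blast)+
    ultimately have "(l2norm (\<lambda>x. f i x - f j x))\<^sup>2 \<le> 2 * (d i + 1 / real (Suc i)) + 2 * (d j + 1 / real (Suc j)) - 4 * d i"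
      using f(2)[of i] f(2)[of j] by simp
    moreover have "1 / real (Suc j) \<le> 1 / real (Suc i)"
      using that by (simp add: frac_le)
    moreover have "4 / real (Suc i) = 4 * (1 / real (Suc i))" by simp
    ultimately show ?thesis by argo
  qed
  have "l2_Cauchy f"
    unfolding l2_Cauchy_def
  proof (intro allI impI)
    fix e :: real assume e: "e > 0"
    then have "e\<^sup>2 / 4 > 0" by simp
    then obtain N1 where N1: "\<And>i j. i \<ge> N1 \<Longrightarrow> j \<ge> N1 \<Longrightarrow> \<bar>d i - d j\<bar> < e\<^sup>2 / 4"
      using Cd unfolding Cauchy_def dist_real_def by blast
    obtain N2 where N2: "1 / real (Suc N2) < e\<^sup>2 / 8"
      using nat_approx_posE[of "e\<^sup>2 / 8"] e by (metis \<open>0 < e\<^sup>2 / 4\<close> divide_pos_pos zero_less_numeral zero_less_power)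
    have *: "l2norm (\<lambda>x. f i x - f j x) < e" if "i \<ge> max N1 N2" "i \<le> j" for i j
    proof -
      have "1 / real (Suc i) \<le> 1 / real (Suc N2)" using that by (simp add: frac_le)
      then have "(l2norm (\<lambda>x. f i x - f j x))\<^sup>2 < e\<^sup>2"
      proof -
        have "d j - d i < e\<^sup>2 / 4" by (rule le_less_trans[OF abs_ge_self N1]) (use that in auto)
        moreover have "4 / real (Suc i) = 4 * (1 / real (Suc i))" by simp
        moreover have "1 / real (Suc i) < e\<^sup>2 / 8"
          using N2 \<open>1 / real (Suc i) \<le> 1 / real (Suc N2)\<close> by (rule le_less_trans[rotated])
        ultimately show ?thesis using est[OF that(2)] by argo
      qed
      then show ?thesis using e by (simp add: power_less_imp_less_base)
    qed
    have "l2norm (\<lambda>x. f i x - f j x) < e" if "i \<ge> max N1 N2" "j \<ge> max N1 N2" for i j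
      using *[of i j] *[of j i] that by (metis l2norm_minus_commute nle_le)
    then show "\<exists>N. \<forall>i\<ge>N. \<forall>j\<ge>N. l2norm (\<lambda>x. f i x - f j x) < e" by blast
  qed
  moreover have "(l2norm (f m))\<^sup>2 \<le> (l2norm g)\<^sup>2 + 1 / real (Suc m)" if "g \<in> S m" for m g
    using f(2)[of m] dle[OF that] by linarith
  ultimately show ?thesis using that f(1) by blast
qed

section \<open>Weak partial derivatives\<close>

lemma sets_borel_induct_box [consumes 1, case_names box empty compl disjoint_union]:
  fixes A :: "'a::euclidean_space set"
  assumes "A \<in> sets borel"
    and "\<And>a b. P (box a b)"
    and "P {}"
    and "\<And>A. A \<in> sets borel \<Longrightarrow> P A \<Longrightarrow> P (- A)"
    and "\<And>A::nat \<Rightarrow> 'a set. disjoint_family A \<Longrightarrow> (\<And>i. A i \<in> sets borel) \<Longrightarrow> (\<And>i. P (A i)) \<Longrightarrow> P (\<Union>i. A i)"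
  shows "P A"
proof -
  let ?G = "range (\<lambda>(a, b). box a b :: 'a set)"
  have b: "sets (borel :: 'a measure) = sigma_sets UNIV ?G"
    by (simp add: borel_eq_box)
  have "Int_stable ?G"
    by (auto simp: Int_stable_def box_Int_box)
  moreover have "?G \<subseteq> Pow UNIV" by simp
  moreover have "A \<in> sigma_sets UNIV ?G" using assms(1) b by simp
  ultimately show ?thesis
  proof (induction rule: sigma_sets_induct_disjoint)
    case (compl A)
    then show ?case using assms(4)[of A] b by (simp add: Compl_eq_Diff_UNIV)
  next
    case (union A)
    then show ?case using assms(5)[of A] b by auto
  qed (use assms(2,3) in auto)
qed

text \<open>Boxes form an intersection-stable generator, so the signed measure with density
  \<open>w\<close> vanishes on all Borel sets; the sets where \<open>w\<close> is positive or
  negative are then tested.\<close>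

lemma integrable_AE_zero_if_box_zero:
  fixes w :: "'a::euclidean_space \<Rightarrow> real"
  assumes w: "integrable lborel w" and box: "\<And>a b. (LINT x|lborel. indicator (box a b) x * w x) = 0"
  shows "AE x in lborel. w x = 0"
proof -
  have wm [measurable]: "w \<in> borel_measurable borel" using w by simp
  have int: "integrable lborel (\<lambda>x. indicator A x * w x)" if "A \<in> sets borel" for A
    using integrable_mult_indicator[of A lborel w] w that by simp
  \<comment> \<open>The whole space is not a box, but the complement step of the induction needs its
    integral; growing boxes exhaust it.\<close>
  have lim: "(LINT x|lborel. w x) = 0"
  proof -
    let ?B = "\<lambda>k::nat. box (- real k *\<^sub>R One) (real k *\<^sub>R One) :: 'a set"
    have "(\<lambda>k. LINT x|lborel. indicator (?B k) x * w x) \<longlonglongrightarrow> (LINT x|lborel. w x)"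
    proof (rule integral_dominated_convergence[where w="\<lambda>x. norm (w x)"])
      show "AE x in lborel. (\<lambda>k. indicator (?B k) x * w x) \<longlonglongrightarrow> w x"
      proof (rule AE_I2, rule tendsto_eventually)
        fix x :: 'a
        obtain k0 where k0: "norm x < real k0" using reals_Archimedean2 by blast
        have "x \<in> ?B k" if "k \<ge> k0" for k
        proof -
          have "\<bar>x \<bullet> i\<bar> < real k" if "i \<in> Basis" for i
            using Basis_le_norm[OF that, of x] k0 \<open>k \<ge> k0\<close> by linarith
          then show ?thesis by (auto simp: mem_box abs_less_iff minus_less_iff)
        qed
        then show "\<forall>\<^sub>F k in sequentially. indicator (?B k) x * w x = w x"
          unfolding eventually_sequentially by (intro exI[of _ k0]) simp
      qed
      show "AE x in lborel. norm (indicator (?B k) x * w x) \<le> norm (w x)" for k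
        by (intro AE_I2) (simp add: indicator_def)
    qed (use w in auto)
    then show ?thesis by (simp add: box LIMSEQ_const_iff)
  qed
  have zero: "(LINT x|lborel. indicator A x * w x) = 0" if "A \<in> sets borel" for A
    using that
  proof (induction rule: sets_borel_induct_box)
    case (box a b)
    then show ?case by (rule assms(2))
  next
    case empty
    then show ?case by simp
  next
    case (compl A)
    have "(LINT x|lborel. indicator (- A) x * w x) = (LINT x|lborel. w x - indicator A x * w x)"
      by (intro Bochner_Integration.integral_cong) (auto simp: indicator_def)
    also have "\<dots> = 0" using compl w int lim by simp
    finally show ?case .
  next
    case (disjoint_union A)
    have "(\<lambda>k. LINT x|lborel. (\<Sum>i<k. indicator (A i) x * w x)) \<longlonglongrightarrow> (LINT x|lborel. indicator (\<Union>i. A i) x * w x)"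
    proof (rule integral_dominated_convergence[where w="\<lambda>x. norm (w x)"])
      have s: "(\<Sum>i<k. indicator (A i) x * w x) = indicator (\<Union>i<k. A i) x * w x" for k x
        using disjoint_union(1)
        by (simp add: sum_distrib_right[symmetric] indicator_UN_disjoint disjoint_family_on_mono[of _ UNIV])
      show "AE x in lborel. (\<lambda>k. \<Sum>i<k. indicator (A i) x * w x) \<longlonglongrightarrow> indicator (\<Union>i. A i) x * w x"
      proof (rule AE_I2, rule tendsto_eventually)
        fix x
        show "\<forall>\<^sub>F k in sequentially. (\<Sum>i<k. indicator (A i) x * w x) = indicator (\<Union>i. A i) x * w x"
        proof (cases "\<exists>i. x \<in> A i")
          case True
          then obtain i where "x \<in> A i" by blast
          then show ?thesis unfolding s eventually_sequentially
            by (intro exI[of _ "Suc i"]) (auto simp: indicator_def)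
        qed (auto simp: indicator_def)
      qed
      show "AE x in lborel. norm (\<Sum>i<k. indicator (A i) x * w x) \<le> norm (w x)" for k
        unfolding s by (intro AE_I2) (simp add: indicator_def)
    qed (use w disjoint_union in auto)
    moreover have "(LINT x|lborel. (\<Sum>i<k. indicator (A i) x * w x)) = 0" for k
      using int disjoint_union by (subst Bochner_Integration.integral_sum) auto
    ultimately show ?case by (simp add: LIMSEQ_const_iff)
  qed
  have "AE x in lborel. 0 = indicator A x * w x" if A: "A \<in> sets borel" "\<And>x. indicator A x * w x \<ge> 0" for A
    using integral_nonneg_eq_0_iff_AE[OF int[OF A(1)]] zero[OF A(1)] A(2) by auto
  from this[of "{x. w x > 0}"] have 1: "AE x in lborel. \<not> w x > 0"
    by (auto simp: indicator_def elim: eventually_mono)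
  have "AE x in lborel. 0 = indicator {x. w x < 0} x * (- w x)"
  proof -
    have "{x. w x < 0} \<in> sets borel" by measurable
    then have "integrable lborel (\<lambda>x. indicator {x. w x < 0} x * (- w x))"
      "(LINT x|lborel. indicator {x. w x < 0} x * (- w x)) = 0"
      using int zero by auto
    then show ?thesis
      using integral_nonneg_eq_0_iff_AE[of lborel "\<lambda>x. indicator {x. w x < 0} x * (- w x)"]
      by (auto simp: indicator_def)
  qed
  then have 2: "AE x in lborel. \<not> w x < 0"
    by (auto simp: indicator_def elim: eventually_mono)
  from 1 2 show ?thesis by eventually_elim simp
qed

lemma locally_integrable_mult:
  fixes w :: "'a::euclidean_space \<Rightarrow> complex" and \<phi> :: "'a \<Rightarrow> real"
  assumes w: "locally_integrable w" and [measurable]: "\<phi> \<in> borel_measurable borel"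
    and b: "\<And>x. \<bar>\<phi> x\<bar> \<le> B" and s: "\<And>x. norm x > R \<Longrightarrow> \<phi> x = 0"
  shows "integrable lborel (\<lambda>x. \<phi> x *\<^sub>R w x)"
proof (rule Bochner_Integration.integrable_bound)
  have [measurable]: "w \<in> borel_measurable borel" using w by (simp add: locally_integrable_def)
  show "integrable lborel (\<lambda>x. B *\<^sub>R (indicator (cball 0 R) x *\<^sub>R w x))"
    using w by (intro integrable_scaleR_right) (auto simp: locally_integrable_def set_integrable_def)
  show "(\<lambda>x. \<phi> x *\<^sub>R w x) \<in> borel_measurable lborel" by measurable
  have "B \<ge> 0" using b[of 0] by linarith
  show "AE x in lborel. norm (\<phi> x *\<^sub>R w x) \<le> norm (B *\<^sub>R indicat_real (cball 0 R) x *\<^sub>R w x)"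
  proof (rule AE_I2)
    fix x show "norm (\<phi> x *\<^sub>R w x) \<le> norm (B *\<^sub>R indicat_real (cball 0 R) x *\<^sub>R w x)"
      using b[of x] s[of x] \<open>B \<ge> 0\<close> by (cases "norm x \<le> R") (auto intro!: mult_right_mono)
  qed
qed

lemma test_function_mult_integrable:
  assumes "test_function \<phi>" "locally_integrable w"
  shows "integrable lborel (\<lambda>x. \<phi> x *\<^sub>R w x)"
proof -
  obtain R where "\<And>x. norm x > R \<Longrightarrow> \<phi> x = 0" using test_function_supportE[OF assms(1)] by blast
  moreover obtain B where "\<And>x. \<bar>\<phi> x\<bar> \<le> B" using test_function_boundedE[OF assms(1)] by blast
  ultimately show ?thesis
    using locally_integrable_mult[OF assms(2)] test_function_borel[OF assms(1)] by blast
qed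

lemma locally_integrable_bounded_indicator:
  assumes "locally_integrable (w :: 'a::euclidean_space \<Rightarrow> complex)" "bounded A" "A \<in> sets borel"
  shows "integrable lborel (\<lambda>x. indicator A x *\<^sub>R w x)"
proof -
  obtain R where R: "\<forall>x\<in>A. norm x \<le> R" using assms(2) bounded_iff by blast
  show ?thesis
    by (rule locally_integrable_mult[OF assms(1), of _ 1 R])
      (use assms(3) R in \<open>auto simp: indicator_def not_le[symmetric]\<close>)
qed

text \<open>The bumps on a box converge to its indicator under the integrable majorant given by |w|
  on the box, so \<open>w\<close> has integral zero over every box.\<close>

lemma test_function_orthogonal_AE_zero:
  fixes w :: "real^'n::finite \<Rightarrow> complex"
  assumes w: "locally_integrable w"
    and z: "\<And>\<phi>. test_function \<phi> \<Longrightarrow> (LINT x|lborel. \<phi> x *\<^sub>R w x) = 0"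
  shows "AE x in lborel. w x = 0"
proof -
  have [measurable]: "w \<in> borel_measurable borel" using w by (simp add: locally_integrable_def)
  have box0: "(LINT x|lborel. indicator (box a b) x *\<^sub>R w x) = 0" for a b
  proof -
    have "(\<lambda>i. LINT x|lborel. bump (1 / real (Suc i)) a b x *\<^sub>R w x) \<longlonglongrightarrow> (LINT x|lborel. indicator (box a b) x *\<^sub>R w x)"
    proof (rule integral_dominated_convergence[where w="\<lambda>x. norm (indicator (box a b) x *\<^sub>R w x)"])
      show "integrable lborel (\<lambda>x. norm (indicat_real (box a b) x *\<^sub>R w x))"
        by (intro integrable_norm locally_integrable_bounded_indicator w) auto
      show "AE x in lborel. (\<lambda>i. bump (1 / real (Suc i)) a b x *\<^sub>R w x) \<longlonglongrightarrow> indicat_real (box a b) x *\<^sub>R w x"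
        by (intro AE_I2 tendsto_scaleR bump_tendsto_indicator tendsto_const)
      show "AE x in lborel. norm (bump (1 / real (Suc i)) a b x *\<^sub>R w x) \<le> norm (indicat_real (box a b) x *\<^sub>R w x)" for i
      proof (rule AE_I2)
        fix x
        show "norm (bump (1 / real (Suc i)) a b x *\<^sub>R w x) \<le> norm (indicat_real (box a b) x *\<^sub>R w x)"
          using bump_bounds[of "1 / real (Suc i)" a b x] bump_eq_0[of x a b "1 / real (Suc i)"]
          by (cases "x \<in> box a b") (auto intro!: mult_left_le_one_le)
      qed
      show "(\<lambda>x. bump (1 / real (Suc i)) a b x *\<^sub>R w x) \<in> borel_measurable lborel" for i
        using test_function_borel[OF test_function_bump[of "1 / real (Suc i)" a b]] by simp
    qed measurable
    moreover have "(LINT x|lborel. bump (1 / real (Suc i)) a b x *\<^sub>R w x) = 0" for i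
      by (intro z test_function_bump) simp
    ultimately show ?thesis by (simp add: LIMSEQ_const_iff)
  qed
  \<comment> \<open>Since \<open>w\<close> is only locally integrable, the criterion is applied to
    \<open>w\<close> cut off to one box. An intersection of two boxes is a box, so the cut-off
    function again has zero integral over every box.\<close>
  have loc: "AE x in lborel. x \<in> box a b \<longrightarrow> w x = 0" for a b
  proof -
    let ?v = "\<lambda>x. indicat_real (box a b) x *\<^sub>R w x"
    have i: "integrable lborel (\<lambda>x. indicator (box c d) x *\<^sub>R ?v x)"
      "(LINT x|lborel. indicator (box c d) x *\<^sub>R ?v x) = 0" for c d
    proof -
      obtain e f where ef: "box c d \<inter> box a b = box e f" using box_Int_box[of c d a b] that by blast
      have "(\<lambda>x. indicat_real (box c d) x *\<^sub>R ?v x) = (\<lambda>x. indicat_real (box e f) x *\<^sub>R w x)"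
        unfolding ef[symmetric] by (rule ext) (simp add: indicator_def)
      then show "integrable lborel (\<lambda>x. indicator (box c d) x *\<^sub>R ?v x)"
        "(LINT x|lborel. indicator (box c d) x *\<^sub>R ?v x) = 0"
        using box0 locally_integrable_bounded_indicator[OF w, of "box e f"] by auto
    qed
    have v: "integrable lborel ?v" using w by (intro locally_integrable_bounded_indicator) auto
    have "AE x in lborel. Re (?v x) = 0"
    proof (rule integrable_AE_zero_if_box_zero)
      fix c d
      have "(LINT x|lborel. Re (indicator (box c d) x *\<^sub>R ?v x)) = Re 0"
        by (subst integral_Re[OF i(1)]) (simp only: i(2))
      then show "(LINT x|lborel. indicator (box c d) x * Re (?v x)) = 0" by (simp add: mult.assoc)
    qed (intro integrable_Re v)
    moreover have "AE x in lborel. Im (?v x) = 0"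
    proof (rule integrable_AE_zero_if_box_zero)
      fix c d
      have "(LINT x|lborel. Im (indicator (box c d) x *\<^sub>R ?v x)) = Im 0"
        by (subst integral_Im[OF i(1)]) (simp only: i(2))
      then show "(LINT x|lborel. indicator (box c d) x * Im (?v x)) = 0" by (simp add: mult.assoc)
    qed (intro integrable_Im v)
    ultimately show ?thesis by eventually_elim (auto simp: complex_eq_iff)
  qed
  have "AE x in lborel. \<forall>k::nat. x \<in> box (- real k *\<^sub>R One) (real k *\<^sub>R One) \<longrightarrow> w x = 0"
    by (subst AE_all_countable) (intro allI loc)
  then show ?thesis
  proof eventually_elim
    case (elim x)
    obtain k where k: "norm x < real k" using reals_Archimedean2 by blast
    have "\<bar>x \<bullet> i\<bar> < real k" if "i \<in> Basis" for i
      using Basis_le_norm[OF that, of x] k by linarith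
    then have "x \<in> box (- real k *\<^sub>R One) (real k *\<^sub>R One)"
      by (auto simp: mem_box abs_less_iff minus_less_iff)
    with elim show ?case by blast
  qed
qed

lemma locally_integrable_add:
  "locally_integrable f \<Longrightarrow> locally_integrable g \<Longrightarrow> locally_integrable (\<lambda>x. f x + g x)"
  unfolding locally_integrable_def by (auto intro!: set_integral_add)

lemma locally_integrable_diff:
  "locally_integrable f \<Longrightarrow> locally_integrable g \<Longrightarrow> locally_integrable (\<lambda>x. f x - g x)"
  unfolding locally_integrable_def by (auto intro!: set_integral_diff)

lemma has_weak_partial_unique:
  assumes "has_weak_partial j f g" "has_weak_partial j f h"
  shows "AE x in lborel. g x = h x"
proof -
  have l: "locally_integrable g" "locally_integrable h" using assms by (auto simp: has_weak_partial_def)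
  have "AE x in lborel. g x - h x = 0"
  proof (rule test_function_orthogonal_AE_zero[OF locally_integrable_diff[OF l]])
    fix \<phi> :: "real^'a \<Rightarrow> real" assume \<phi>: "test_function \<phi>"
    then have "(LINT x|lborel. \<phi> x *\<^sub>R g x) = (LINT x|lborel. \<phi> x *\<^sub>R h x)"
      using assms by (simp add: has_weak_partial_def)
    then show "(LINT x|lborel. \<phi> x *\<^sub>R (g x - h x)) = 0"
      using test_function_mult_integrable[OF \<phi>] l by (simp add: scaleR_diff_right)
  qed
  then show ?thesis by simp
qed

text \<open>Any witness for the weak derivative determines the \<open>SOME\<close> choice up to a
  null set. This is the bridge from explicit gradients back to the energy.\<close>

lemma weak_partial_AE:
  assumes "has_weak_partial j f g"
  shows "has_weak_partial j f (weak_partial j f)" "AE x in lborel. weak_partial j f x = g x"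
proof -
  show "has_weak_partial j f (weak_partial j f)"
    unfolding weak_partial_def by (rule someI[where P="has_weak_partial j f", OF assms])
  then show "AE x in lborel. weak_partial j f x = g x"
    using assms by (rule has_weak_partial_unique)
qed

section \<open>Differentiation under the integral and integration by parts\<close>

lemma sq_int_set_integrable:
  fixes f :: "'a::euclidean_space \<Rightarrow> 'b::euclidean_space"
  assumes f: "sq_int f" and K: "K \<in> sets borel" "emeasure lborel K < \<infinity>"
  shows "set_integrable lborel K f"
proof -
  have [measurable]: "f \<in> borel_measurable borel" using f by (simp add: sq_int_def)
  have "sq_int (indicat_real K)"
  proof -
    have "(\<lambda>x. (norm (indicat_real K x))\<^sup>2) = indicat_real K" by (auto simp: indicator_def)
    then show ?thesis using K by (simp add: sq_int_def)
  qed
  from l2_Cauchy_Schwarz(1)[OF this f] have "integrable lborel (\<lambda>x. norm (indicat_real K x *\<^sub>R f x))"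
    by simp
  then show ?thesis
    using K(1) unfolding set_integrable_def by (subst (asm) integrable_norm_iff) auto
qed

lemma sq_int_locally_integrable:
  assumes "sq_int f" shows "locally_integrable f"
  using assms sq_int_set_integrable[OF assms] emeasure_compact_finite
  by (auto simp: locally_integrable_def sq_int_def intro: borel_compact)

lemma test_function_sq_int:
  assumes "test_function \<phi>"
  shows "sq_int \<phi>"
proof -
  obtain B where B: "\<And>x. \<bar>\<phi> x\<bar> \<le> B" using test_function_boundedE[OF assms] by blast
  obtain R where R: "\<And>x. norm x > R \<Longrightarrow> \<phi> x = 0" using test_function_supportE[OF assms] by blast
  have m: "\<phi> \<in> borel_measurable borel" using assms by (rule test_function_borel)
  have "sq_int (indicat_real (cball 0 R :: (real^'a) set))"
  proof -
    have "(\<lambda>x. (norm (indicat_real (cball 0 R :: (real^'a) set) x))\<^sup>2) = indicat_real (cball 0 R)"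
      by (auto simp: indicator_def)
    then show ?thesis using emeasure_bounded_finite[of "cball 0 R :: (real^'a) set"]
      by (auto simp: sq_int_def intro!: borel_measurable_indicator borel_closed)
  qed
  then show ?thesis
    by (rule sq_int_bound[OF _ m, where C=B]) (use B R in \<open>auto simp: indicator_def not_le[symmetric]\<close>)
qed

text \<open>All derivatives fall on the test function, so dominated convergence applies although
  \<open>u\<close> is merely locally integrable: the Lipschitz constant bounds the quotients, and
  their supports stay in one ball.\<close>

lemma has_derivative_integral_translate:
  fixes u :: "real^'n::finite \<Rightarrow> complex"
  assumes \<phi>: "test_function \<phi>" and u: "locally_integrable u"
  shows "((\<lambda>t. LINT y|lborel. \<phi> (y + t *\<^sub>R h) *\<^sub>R u y) has_vector_derivative
    (LINT y|lborel. dir_deriv \<phi> h (y + t *\<^sub>R h) *\<^sub>R u y)) (at t)"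
    (is "(?F has_vector_derivative ?D) _")
proof -
  have [measurable]: "u \<in> borel_measurable borel" using u by (simp add: locally_integrable_def)
  have [measurable]: "\<phi> \<in> borel_measurable borel" using test_function_borel[OF \<phi>] .
  have [measurable]: "dir_deriv \<phi> h \<in> borel_measurable borel"
    unfolding dir_deriv_def[abs_def]
    using test_function_borel[OF test_function_partial_deriv[OF \<phi>]] by measurable
  obtain L where L: "L > 0" "\<And>x y. \<bar>\<phi> x - \<phi> y\<bar> \<le> L * norm (x - y)"
    using test_function_lipschitzE[OF \<phi>] by blast
  obtain R where R: "R > 0" "\<And>x. norm x > R \<Longrightarrow> \<phi> x = 0" using test_function_supportE[OF \<phi>] by blast
  let ?q = "\<lambda>s y. ((\<phi> (y + (t + s) *\<^sub>R h) - \<phi> (y + t *\<^sub>R h)) / s) *\<^sub>R u y"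
  have "((\<lambda>s. LINT y|lborel. ?q s y) \<longlongrightarrow> (LINT y|lborel. dir_deriv \<phi> h (y + t *\<^sub>R h) *\<^sub>R u y)) (at 0)"
    unfolding tendsto_at_iff_sequentially comp_def
  proof (intro allI impI)
    fix S :: "nat \<Rightarrow> real"
    assume S: "\<forall>i. S i \<in> UNIV - {0}" "S \<longlonglongrightarrow> 0"
    obtain M where M: "\<And>i. \<bar>S i\<bar> \<le> M"
      using S(2) convergent_imp_Bseq[of S] unfolding convergent_def Bseq_def by auto
    have M0: "M \<ge> 0" using M[of 0] by linarith
    \<comment> \<open>Outside this ball every shift of \<open>y\<close> by r h with |r| <= |t| + M
      leaves the support of the test function, in particular both points of each quotient.\<close>
    define R' where "R' = R + (\<bar>t\<bar> + M) * norm h"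
    show "(\<lambda>i. LINT y|lborel. ?q (S i) y) \<longlonglongrightarrow> (LINT y|lborel. dir_deriv \<phi> h (y + t *\<^sub>R h) *\<^sub>R u y)"
    proof (rule integral_dominated_convergence[where w="\<lambda>y. norm ((L * norm h) *\<^sub>R (indicat_real (cball 0 R') y *\<^sub>R u y))"])
      show "integrable lborel (\<lambda>y. norm ((L * norm h) *\<^sub>R (indicat_real (cball 0 R') y *\<^sub>R u y)))"
        by (intro integrable_norm integrable_scaleR_right locally_integrable_bounded_indicator u) auto
      show "AE y in lborel. (\<lambda>i. ?q (S i) y) \<longlonglongrightarrow> dir_deriv \<phi> h (y + t *\<^sub>R h) *\<^sub>R u y"
      proof (rule AE_I2, rule tendsto_scaleR)
        fix y
        have "((\<lambda>s. \<phi> (y + s *\<^sub>R h)) has_derivative (\<lambda>s. dir_deriv \<phi> (s *\<^sub>R h) (y + t *\<^sub>R h))) (at t)"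
          by (rule has_derivative_compose[OF _ test_function_has_derivative[OF \<phi>]])
            (auto intro!: derivative_eq_intros)
        then have "((\<lambda>s. \<phi> (y + s *\<^sub>R h)) has_real_derivative dir_deriv \<phi> h (y + t *\<^sub>R h)) (at t)"
          unfolding has_field_derivative_def
          by (rule has_derivative_eq_rhs)
            (simp add: fun_eq_iff dir_deriv_def sum_distrib_right sum_distrib_left mult_ac)
        then have "((\<lambda>s. (\<phi> (y + (t + s) *\<^sub>R h) - \<phi> (y + t *\<^sub>R h)) / s) \<longlongrightarrow> dir_deriv \<phi> h (y + t *\<^sub>R h)) (at 0)"
          by (simp add: DERIV_def)
        then show "(\<lambda>i. (\<phi> (y + (t + S i) *\<^sub>R h) - \<phi> (y + t *\<^sub>R h)) / S i) \<longlonglongrightarrow> dir_deriv \<phi> h (y + t *\<^sub>R h)"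
          using S unfolding tendsto_at_iff_sequentially comp_def by blast
      qed (rule tendsto_const)
      show "AE y in lborel. norm (?q (S i) y) \<le> norm ((L * norm h) *\<^sub>R (indicat_real (cball 0 R') y *\<^sub>R u y))" for i
      proof (rule AE_I2)
        fix y
        show "norm (?q (S i) y) \<le> norm ((L * norm h) *\<^sub>R (indicat_real (cball 0 R') y *\<^sub>R u y))"
        proof (cases "norm y \<le> R'")
          case True
          have "\<bar>\<phi> (y + (t + S i) *\<^sub>R h) - \<phi> (y + t *\<^sub>R h)\<bar> \<le> L * norm (S i *\<^sub>R h)"
            using L(2)[of "y + (t + S i) *\<^sub>R h" "y + t *\<^sub>R h"] by (simp add: algebra_simps)
          moreover have "S i \<noteq> 0" using S(1) by simp
          ultimately have "\<bar>\<phi> (y + (t + S i) *\<^sub>R h) - \<phi> (y + t *\<^sub>R h)\<bar> / \<bar>S i\<bar> \<le> L * norm h"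
            by (simp add: field_simps)
          then show ?thesis
            using True L(1) mult_right_mono[of _ _ "norm (u y)"] by (fastforce simp: abs_mult)
        next
          case False
          have far: "\<phi> (y + r *\<^sub>R h) = 0" if "\<bar>r\<bar> \<le> \<bar>t\<bar> + M" for r
          proof (rule R(2))
            have "\<bar>r\<bar> * norm h \<le> (\<bar>t\<bar> + M) * norm h" using that by (intro mult_right_mono) auto
            moreover have "norm y - \<bar>r\<bar> * norm h \<le> norm (y + r *\<^sub>R h)"
              using norm_diff_ineq[of y "r *\<^sub>R h"] by simp
            ultimately show "norm (y + r *\<^sub>R h) > R" using False by (simp add: R'_def)
          qed
          have "\<bar>t + S i\<bar> \<le> \<bar>t\<bar> + M" using M[of i] by linarith
          then show ?thesis using far[of t] far[of "t + S i"] M0 by simp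
        qed
      qed
    qed measurable
  qed
  moreover have "(LINT y|lborel. ?q s y) = (1 / s) *\<^sub>R ((LINT y|lborel. \<phi> (y + (t + s) *\<^sub>R h) *\<^sub>R u y) - (LINT y|lborel. \<phi> (y + t *\<^sub>R h) *\<^sub>R u y))" for s
  proof -
    have i: "integrable lborel (\<lambda>y. \<phi> (y + r *\<^sub>R h) *\<^sub>R u y)" for r
      by (rule test_function_mult_integrable[OF test_function_translate[OF \<phi>] u])
    have "?q s y = (1 / s) *\<^sub>R (\<phi> (y + (t + s) *\<^sub>R h) *\<^sub>R u y - \<phi> (y + t *\<^sub>R h) *\<^sub>R u y)" for y
      by (simp add: scaleR_diff_left scaleR_diff_right diff_divide_distrib)
    then have "(LINT y|lborel. ?q s y) =
        (1 / s) *\<^sub>R (LINT y|lborel. \<phi> (y + (t + s) *\<^sub>R h) *\<^sub>R u y - \<phi> (y + t *\<^sub>R h) *\<^sub>R u y)"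
      using Bochner_Integration.integrable_diff[OF i i] by (simp only: integral_scaleR_right)
    then show ?thesis by (simp only: Bochner_Integration.integral_diff[OF i i])
  qed
  ultimately have L1: "((\<lambda>s. norm ((1 / s) *\<^sub>R (?F (t + s) - ?F t) - ?D)) \<longlongrightarrow> 0) (at 0)"
    by (simp add: tendsto_norm_zero_iff LIM_zero_iff)
  have L2: "norm ((1 / s) *\<^sub>R (?F (t + s) - ?F t) - ?D) = norm (?F (t + s) - ?F t - s *\<^sub>R ?D) / norm s"
    if "s \<noteq> 0" for s
  proof -
    have "(1 / s) *\<^sub>R (?F (t + s) - ?F t) - ?D = (1 / s) *\<^sub>R (?F (t + s) - ?F t - s *\<^sub>R ?D)"
      using that by (simp add: scaleR_diff_right)
    then show ?thesis by simp
  qed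
  have "((\<lambda>s. norm (?F (t + s) - ?F t - s *\<^sub>R ?D) / norm s) \<longlongrightarrow> 0) (at 0)"
    by (rule Lim_transform_eventually[OF L1]) (unfold eventually_at_filter, intro always_eventually allI impI L2)
  then show ?thesis
    by (simp add: has_vector_derivative_def has_derivative_at bounded_linear_scaleR_left)
qed

text \<open>The integral of a translate is constant in the translation parameter, and its derivative
  is the integral in question. The previous lemma is used with the constant function 1.\<close>

lemma integral_partial_deriv_eq_0:
  assumes \<phi>: "test_function \<phi>"
  shows "(LINT x|lborel. partial_deriv j \<phi> x) = 0"
proof -
  let ?h = "axis j 1 :: real^'a"
  have loc1: "locally_integrable (\<lambda>x::real^'a. 1 :: complex)"
    unfolding locally_integrable_def set_integrable_def
    by (auto intro!: integrable_scaleR_left integrable_real_indicator borel_compact emeasure_compact_finite)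
  have eq: "(LINT y|lborel. \<phi> (y + t *\<^sub>R ?h) *\<^sub>R (1::complex)) = (LINT y|lborel. \<phi> y *\<^sub>R (1::complex))" for t
  proof -
    have "(LINT y|lborel. \<phi> y *\<^sub>R (1::complex)) = (LINT y|distr lborel borel ((+) (t *\<^sub>R ?h)). \<phi> y *\<^sub>R (1::complex))"
      by (simp add: lborel_distr_plus)
    also have "\<dots> = (LINT y|lborel. \<phi> (t *\<^sub>R ?h + y) *\<^sub>R (1::complex))"
      using test_function_borel[OF \<phi>] by (intro integral_distr) auto
    finally show ?thesis by (simp add: add.commute)
  qed
  have "((\<lambda>t. LINT y|lborel. \<phi> (y + t *\<^sub>R ?h) *\<^sub>R (1::complex)) has_vector_derivative
    (LINT y|lborel. dir_deriv \<phi> ?h (y + 0 *\<^sub>R ?h) *\<^sub>R 1)) (at 0)"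
    by (rule has_derivative_integral_translate[OF \<phi> loc1])
  moreover have "((\<lambda>t. LINT y|lborel. \<phi> (y + t *\<^sub>R ?h) *\<^sub>R (1::complex)) has_vector_derivative 0) (at 0)"
    unfolding eq by simp
  ultimately have "(LINT y|lborel. dir_deriv \<phi> ?h (y + 0 *\<^sub>R ?h) *\<^sub>R (1::complex)) = 0"
    using vector_derivative_unique_at by blast
  moreover have "dir_deriv \<phi> ?h y = partial_deriv j \<phi> y" for y
    by (simp add: dir_deriv_def axis_def if_distrib[of "\<lambda>z. z * _"] cong: if_cong)
  ultimately have "(LINT y|lborel. complex_of_real (partial_deriv j \<phi> y)) = 0"
    by (simp add: scaleR_conv_of_real)
  then show ?thesis by (simp add: integral_complex_of_real)
qed

lemma test_function_mult:
  assumes "test_function \<phi>" "test_function \<psi>"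
  shows "test_function (\<lambda>x. \<phi> x * \<psi> x)"
proof -
  have "bounded {x. \<phi> x \<noteq> 0}"
    using assms bounded_subset[OF _ closure_subset] compact_imp_bounded unfolding test_function_def by blast
  then have "bounded {x. \<phi> x * \<psi> x \<noteq> 0}" by (rule bounded_subset) auto
  then show ?thesis using assms by (auto simp: test_function_def compact_closure C_k_mult)
qed

text \<open>The product rule and the vanishing integral of a partial derivative of the product give
  integration by parts.\<close>

lemma test_function_has_weak_partial:
  assumes \<psi>: "test_function \<psi>"
  shows "has_weak_partial j (\<lambda>x. complex_of_real (\<psi> x)) (\<lambda>x. complex_of_real (partial_deriv j \<psi> x))"
proof -
  have loc: "locally_integrable (\<lambda>x. complex_of_real (\<phi> x))" if "test_function \<phi>" for \<phi> :: "real^'a \<Rightarrow> real"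
  proof -
    have "sq_int (\<lambda>x. complex_of_real (\<phi> x))"
      using test_function_sq_int[OF that] by (auto simp: sq_int_def)
    then show ?thesis by (rule sq_int_locally_integrable)
  qed
  have "(LINT x|lborel. partial_deriv j \<phi> x *\<^sub>R complex_of_real (\<psi> x)) =
     - (LINT x|lborel. \<phi> x *\<^sub>R complex_of_real (partial_deriv j \<psi> x))" if \<phi>: "test_function \<phi>" for \<phi>
  proof -
    have i1: "integrable lborel (\<lambda>x. partial_deriv j \<phi> x *\<^sub>R complex_of_real (\<psi> x))"
      by (intro test_function_mult_integrable test_function_partial_deriv \<phi> loc \<psi>)
    have i2: "integrable lborel (\<lambda>x. \<phi> x *\<^sub>R complex_of_real (partial_deriv j \<psi> x))"
      by (intro test_function_mult_integrable test_function_partial_deriv \<phi> loc \<psi>)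
    have pd: "partial_deriv j (\<lambda>x. \<phi> x * \<psi> x) x = \<phi> x * partial_deriv j \<psi> x + partial_deriv j \<phi> x * \<psi> x" for x
      unfolding partial_deriv_def[of j \<phi>] partial_deriv_def[of j \<psi>]
      using \<phi> \<psi>
      by (intro partial_deriv_eqI[where D="\<lambda>h. \<phi> x * frechet_derivative \<psi> (at x) h + frechet_derivative \<phi> (at x) h * \<psi> x"]
            has_derivative_mult differentiable_has_frechet test_function_differentiable)
    have "(LINT x|lborel. partial_deriv j \<phi> x *\<^sub>R complex_of_real (\<psi> x)) + (LINT x|lborel. \<phi> x *\<^sub>R complex_of_real (partial_deriv j \<psi> x))
      = (LINT x|lborel. complex_of_real (partial_deriv j (\<lambda>x. \<phi> x * \<psi> x) x))"
      by (subst Bochner_Integration.integral_add[OF i1 i2, symmetric])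
        (simp add: pd scaleR_conv_of_real add.commute)
    also have "\<dots> = 0"
      using integral_partial_deriv_eq_0[OF test_function_mult[OF \<phi> \<psi>], of j] by (simp add: integral_complex_of_real)
    finally show ?thesis by (simp add: add_eq_0_iff2)
  qed
  then show ?thesis
    by (simp add: has_weak_partial_def loc \<psi> test_function_partial_deriv)
qed

section \<open>Translation invariance, density of test functions and duality\<close>

lemma integral_translate:
  fixes f :: "'a::euclidean_space \<Rightarrow> 'b::{banach, second_countable_topology}"
  assumes [measurable]: "f \<in> borel_measurable borel"
  shows "integrable lborel (\<lambda>x. f (x + h)) \<longleftrightarrow> integrable lborel f"
    "(LINT x|lborel. f (x + h)) = (LINT x|lborel. f x)"
proof -
  have "integrable lborel f \<longleftrightarrow> integrable (distr lborel borel ((+) h)) f"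
    by (simp add: lborel_distr_plus)
  also have "\<dots> \<longleftrightarrow> integrable lborel (\<lambda>x. f (h + x))"
    by (intro integrable_distr_eq) auto
  finally show "integrable lborel (\<lambda>x. f (x + h)) \<longleftrightarrow> integrable lborel f"
    by (simp add: add.commute)
  have "(LINT x|lborel. f x) = (LINT x|distr lborel borel ((+) h). f x)"
    by (simp add: lborel_distr_plus)
  also have "\<dots> = (LINT x|lborel. f (h + x))"
    by (intro integral_distr) auto
  finally show "(LINT x|lborel. f (x + h)) = (LINT x|lborel. f x)"
    by (simp add: add.commute)
qed

lemma l2norm_translate: "f \<in> borel_measurable borel \<Longrightarrow> l2norm (\<lambda>x. f (x + h)) = l2norm f"
  unfolding l2norm_def using integral_translate(2)[of "\<lambda>x. (norm (f x))\<^sup>2" h] by simp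

lemma sq_int_translate:
  assumes "sq_int f"
  shows "sq_int (\<lambda>x. f (x + h))"
proof -
  have [measurable]: "f \<in> borel_measurable borel" using assms by (simp add: sq_int_def)
  have "(\<lambda>x. f (x + h)) \<in> borel_measurable borel" by measurable
  then show ?thesis
    using assms integral_translate(1)[of "\<lambda>x. (norm (f x))\<^sup>2" h] by (simp add: sq_int_def)
qed

lemma norm_integral_mult_le:
  assumes "sq_int (\<phi> :: 'a::euclidean_space \<Rightarrow> real)" "sq_int (w :: 'a \<Rightarrow> 'b::euclidean_space)"
  shows "integrable lborel (\<lambda>x. \<phi> x *\<^sub>R w x)" "norm (LINT x|lborel. \<phi> x *\<^sub>R w x) \<le> l2norm \<phi> * l2norm w"
proof -
  have m: "(\<lambda>x. \<phi> x *\<^sub>R w x) \<in> borel_measurable borel" using assms by (auto simp: sq_int_def)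
  have "integrable lborel (\<lambda>x. norm (\<phi> x *\<^sub>R w x))" using l2_Cauchy_Schwarz(1)[OF assms] by simp
  then show "integrable lborel (\<lambda>x. \<phi> x *\<^sub>R w x)" using m by (subst (asm) integrable_norm_iff) auto
  have "norm (LINT x|lborel. \<phi> x *\<^sub>R w x) \<le> (LINT x|lborel. norm (\<phi> x *\<^sub>R w x))"
    by (rule integral_norm_bound)
  also have "\<dots> \<le> l2norm \<phi> * l2norm w" using l2_Cauchy_Schwarz(2)[OF assms] by simp
  finally show "norm (LINT x|lborel. \<phi> x *\<^sub>R w x) \<le> l2norm \<phi> * l2norm w" .
qed

text \<open>The limit \<open>r\<close> of a minimising sequence of \<open>w - \<phi>\<close> satisfies \<open>\<parallel>r\<parallel> \<le> \<parallel>r - t \<phi>\<parallel>\<close> for all test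
  functions \<open>\<phi>\<close> and all \<open>t\<close>, so it is orthogonal to all of them and vanishes.\<close>

lemma test_functions_dense:
  fixes w :: "real^'n::finite \<Rightarrow> real"
  assumes w: "sq_int w" and e: "e > 0"
  obtains \<phi> where "test_function \<phi>" "l2norm (\<lambda>x. w x - \<phi> x) < e"
proof -
  let ?S = "{f. \<exists>\<phi>. test_function \<phi> \<and> f = (\<lambda>x. w x - \<phi> x)}"
  have lin: "test_function (\<lambda>x. a * \<phi> x + b * \<psi> x)" if "test_function \<phi>" "test_function \<psi>" for a b and \<phi> \<psi> :: "real^'n \<Rightarrow> real"
  proof -
    have "bounded {x. \<phi> x \<noteq> 0}" "bounded {x. \<psi> x \<noteq> 0}"
      using that bounded_subset[OF _ closure_subset] compact_imp_bounded unfolding test_function_def by blast+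
    then have "bounded ({x. \<phi> x \<noteq> 0} \<union> {x. \<psi> x \<noteq> 0})" by simp
    then have "bounded {x. a * \<phi> x + b * \<psi> x \<noteq> 0}"
      by (rule bounded_subset) auto
    then show ?thesis using that
      by (auto simp: test_function_def compact_closure intro!: C_k_add C_k_mult C_k_const)
  qed
  have z: "test_function (\<lambda>x::real^'n. 0)" by (simp add: test_function_def C_k_const)
  obtain f where f: "\<And>m. f m \<in> ?S" "l2_Cauchy f"
    and min: "\<And>m g. g \<in> ?S \<Longrightarrow> (l2norm (f m))\<^sup>2 \<le> (l2norm g)\<^sup>2 + 1 / real (Suc m)"
  proof (rule midpoint_closed_Cauchy_minimizers[of "\<lambda>m. ?S" "l2norm w"])
    show "\<And>f. f \<in> ?S \<Longrightarrow> sq_int f" using sq_int_diff[OF w test_function_sq_int] by auto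
    show "(\<lambda>x. (1/2) *\<^sub>R (f x + g x)) \<in> ?S" if f: "f \<in> ?S" and g: "g \<in> ?S" for f g
    proof -
      obtain \<phi> \<psi> where eq: "test_function \<phi>" "f = (\<lambda>x. w x - \<phi> x)" "test_function \<psi>" "g = (\<lambda>x. w x - \<psi> x)"
        using f g by blast
      have "(\<lambda>x. (1/2) *\<^sub>R (f x + g x)) = (\<lambda>x. w x - ((1/2) * \<phi> x + (1/2) * \<psi> x))"
        unfolding eq by (rule ext) (simp add: field_simps)
      then show ?thesis using lin[OF eq(1,3)] by blast
    qed
    show "\<exists>f\<in>?S. l2norm f \<le> l2norm w" using z by (intro bexI[of _ w]) auto
  qed auto
  have fsq: "sq_int (f m)" for m using f(1)[of m] sq_int_diff[OF w test_function_sq_int] by auto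
  obtain r where r: "sq_int r" and rl: "(\<lambda>m. l2norm (\<lambda>x. f m x - r x)) \<longlonglongrightarrow> 0"
    using l2_complete[OF fsq f(2)] by blast
  have orth: "(LINT x|lborel. \<phi> x *\<^sub>R r x) = 0" if \<phi>: "test_function \<phi>" for \<phi>
  proof -
    have \<phi>sq: "sq_int \<phi>" by (rule test_function_sq_int[OF \<phi>])
    \<comment> \<open>Subtracting a multiple of a test function from \<open>f m\<close> stays inside
      \<open>?S\<close>, so almost-minimality compares the two. \<open>D m\<close> is the price of
      replacing \<open>f m\<close> by its limit on either side.\<close>
    have ge: "(l2norm r)\<^sup>2 \<le> (l2norm (\<lambda>x. r x - t * \<phi> x))\<^sup>2" for t
    proof -
      define D where "D m = l2norm (\<lambda>x. f m x - r x)" for m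
      have D0: "D \<longlonglongrightarrow> 0" using rl unfolding D_def[abs_def] .
      have tsq: "sq_int (\<lambda>x. t * \<phi> x)" using sq_int_scaleR[OF \<phi>sq, of t] by simp
      have "l2norm r \<le> sqrt ((l2norm (\<lambda>x. r x - t * \<phi> x) + D m)\<^sup>2 + 1 / real (Suc m)) + D m" for m
      proof -
        obtain \<psi> where \<psi>: "test_function \<psi>" "f m = (\<lambda>x. w x - \<psi> x)" using f(1) by blast
        have "(\<lambda>x. f m x - t * \<phi> x) \<in> ?S"
        proof -
          have "(\<lambda>x. f m x - t * \<phi> x) = (\<lambda>x. w x - (1 * \<psi> x + t * \<phi> x))"
            unfolding \<psi>(2) by (rule ext) simp
          then show ?thesis using lin[OF \<psi>(1) \<phi>] by blast
        qed
        then have "(l2norm (f m))\<^sup>2 \<le> (l2norm (\<lambda>x. f m x - t * \<phi> x))\<^sup>2 + 1 / real (Suc m)" by (rule min)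
        also have "\<dots> \<le> (l2norm (\<lambda>x. r x - t * \<phi> x) + D m)\<^sup>2 + 1 / real (Suc m)"
          using l2norm_triangle_diff[OF fsq[of m] r tsq] by (intro add_right_mono power_mono) (auto simp: D_def)
        finally have "l2norm (f m) \<le> sqrt ((l2norm (\<lambda>x. r x - t * \<phi> x) + D m)\<^sup>2 + 1 / real (Suc m))"
          by (rule real_le_rsqrt)
        moreover have "l2norm r \<le> l2norm (f m) + D m"
          using l2norm_triangle_le[OF r fsq[of m]] l2norm_minus_commute[of r "f m"] by (simp add: D_def)
        ultimately show ?thesis by simp
      qed
      moreover have "(\<lambda>m. sqrt ((l2norm (\<lambda>x. r x - t * \<phi> x) + D m)\<^sup>2 + 1 / real (Suc m)) + D m)
          \<longlonglongrightarrow> sqrt ((l2norm (\<lambda>x. r x - t * \<phi> x) + 0)\<^sup>2 + 0) + 0"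
        by (intro tendsto_intros D0 LIMSEQ_inverse_real_of_nat[unfolded inverse_eq_divide])
      ultimately have "l2norm r \<le> sqrt ((l2norm (\<lambda>x. r x - t * \<phi> x) + 0)\<^sup>2 + 0) + 0"
        by (intro LIMSEQ_le_const) auto
      then show ?thesis by (simp add: power_mono)
    qed
    define a where "a = (LINT x|lborel. \<phi> x *\<^sub>R r x)"
    have int: "integrable lborel (\<lambda>x. \<phi> x *\<^sub>R r x)" by (rule norm_integral_mult_le[OF \<phi>sq r])
    have ex: "(l2norm (\<lambda>x. r x - t * \<phi> x))\<^sup>2 = (l2norm r)\<^sup>2 - 2 * t * a + t\<^sup>2 * (l2norm \<phi>)\<^sup>2" for t
    proof -
      have "(l2norm (\<lambda>x. r x - t * \<phi> x))\<^sup>2 = (LINT x|lborel. (norm (r x))\<^sup>2 - 2 * t * (\<phi> x *\<^sub>R r x) + t\<^sup>2 * (norm (\<phi> x))\<^sup>2)"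
        unfolding l2norm_sq by (intro Bochner_Integration.integral_cong) (auto simp: power2_eq_square algebra_simps)
      also have "\<dots> = (l2norm r)\<^sup>2 - 2 * t * a + t\<^sup>2 * (l2norm \<phi>)\<^sup>2"
        unfolding l2norm_sq a_def using int sq_int_integrable[OF r] sq_int_integrable[OF \<phi>sq]
        by (subst Bochner_Integration.integral_add Bochner_Integration.integral_diff; (intro Bochner_Integration.integrable_diff)?; simp)+
      finally show ?thesis .
    qed
    have q: "2 * t * a \<le> t\<^sup>2 * (l2norm \<phi>)\<^sup>2" for t using ge[of t] ex[of t] by simp
    \<comment> \<open>The choice t = a / b in the quadratic inequality forces a = 0. Adding 1 covers
      a test function of norm zero.\<close>
    define b where "b = (l2norm \<phi>)\<^sup>2 + 1"
    have b: "b > 0" unfolding b_def by (simp add: add_nonneg_pos)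
    have "2 * (a / b) * a \<le> (a / b)\<^sup>2 * (b - 1)" using q[of "a / b"] by (simp add: b_def)
    then have "2 * a\<^sup>2 * b \<le> a\<^sup>2 * (b - 1)" using b by (simp add: field_simps power2_eq_square)
    then have "a\<^sup>2 * (b + 1) \<le> 0" by (simp add: algebra_simps)
    then have "a = 0" using b by (simp add: mult_le_0_iff)
    then show ?thesis by (simp add: a_def)
  qed
  have rc: "sq_int (\<lambda>x. complex_of_real (r x))" using r by (auto simp: sq_int_def)
  have "AE x in lborel. complex_of_real (r x) = 0"
  proof (rule test_function_orthogonal_AE_zero[OF sq_int_locally_integrable[OF rc]])
    fix \<phi> :: "real^'n \<Rightarrow> real" assume "test_function \<phi>"
    then have "complex_of_real (LINT x|lborel. \<phi> x *\<^sub>R r x) = 0" using orth by simp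
    then show "(LINT x|lborel. \<phi> x *\<^sub>R complex_of_real (r x)) = 0"
      by (simp add: scaleR_conv_of_real flip: integral_complex_of_real)
  qed
  then have "l2norm r = l2norm (\<lambda>x::real^'n. 0 :: real)"
    using r by (intro l2norm_cong_AE) (auto simp: sq_int_def)
  then have r0: "l2norm r = 0" by simp
  obtain m where m: "l2norm (\<lambda>x. f m x - r x) < e"
    using order_tendstoD(2)[OF rl e] eventually_sequentially by auto
  have "l2norm (f m) < e" using l2norm_triangle_le[OF fsq[of m] r] r0 m by simp
  moreover obtain \<phi> where "test_function \<phi>" "f m = (\<lambda>x. w x - \<phi> x)" using f(1) by blast
  ultimately show ?thesis using that by auto
qed

text \<open>Replacing one factor in the integral of w * w by a nearby test function costs an
  arbitrarily small error. Real values suffice because real and imaginary parts are treated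
  separately.\<close>

lemma l2norm_le_by_duality:
  fixes w :: "real^'n::finite \<Rightarrow> real"
  assumes w: "sq_int w" and M: "M \<ge> 0"
    and d: "\<And>\<phi>. test_function \<phi> \<Longrightarrow> \<bar>LINT x|lborel. \<phi> x *\<^sub>R w x\<bar> \<le> M * l2norm \<phi>"
  shows "l2norm w \<le> M"
proof -
  have *: "(l2norm w)\<^sup>2 \<le> M * l2norm w + e * (M + l2norm w)" if e: "e > 0" for e
  proof -
    obtain \<phi> where \<phi>: "test_function \<phi>" "l2norm (\<lambda>x. w x - \<phi> x) < e"
      using test_functions_dense[OF w e] by blast
    have \<phi>sq: "sq_int \<phi>" by (rule test_function_sq_int[OF \<phi>(1)])
    have dsq: "sq_int (\<lambda>x. w x - \<phi> x)" by (rule sq_int_diff[OF w \<phi>sq])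
    have "(l2norm w)\<^sup>2 = (LINT x|lborel. \<phi> x *\<^sub>R w x + (w x - \<phi> x) *\<^sub>R w x)"
      unfolding l2norm_sq by (intro Bochner_Integration.integral_cong) (auto simp: power2_eq_square algebra_simps)
    also have "\<dots> = (LINT x|lborel. \<phi> x *\<^sub>R w x) + (LINT x|lborel. (w x - \<phi> x) *\<^sub>R w x)"
      by (intro Bochner_Integration.integral_add norm_integral_mult_le \<phi>sq dsq w)
    also have "\<dots> \<le> M * l2norm \<phi> + l2norm (\<lambda>x. w x - \<phi> x) * l2norm w"
      using d[OF \<phi>(1)] norm_integral_mult_le(2)[OF dsq w] by simp
    also have "\<dots> \<le> M * (l2norm w + e) + e * l2norm w"
    proof (intro add_mono mult_left_mono mult_right_mono)
      have "l2norm \<phi> \<le> l2norm w + l2norm (\<lambda>x. w x - \<phi> x)"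
        using l2norm_triangle_le[OF \<phi>sq w] l2norm_minus_commute[of \<phi> w] by simp
      then show "l2norm \<phi> \<le> l2norm w + e" using \<phi>(2) by simp
    qed (use M \<phi>(2) in auto)
    finally show ?thesis by (simp add: algebra_simps)
  qed
  have "(l2norm w)\<^sup>2 \<le> M * l2norm w"
  proof (rule field_le_epsilon)
    fix e :: real assume "e > 0"
    then have p: "e / (M + l2norm w + 1) > 0" using M by (simp add: add_nonneg_pos)
    have "e / (M + l2norm w + 1) * (M + l2norm w) \<le> e / (M + l2norm w + 1) * (M + l2norm w + 1)"
      using p by (intro mult_left_mono) auto
    also have "\<dots> = e" using M add_nonneg_pos[of "M + l2norm w" 1] by simp
    finally show "(l2norm w)\<^sup>2 \<le> M * l2norm w + e" using *[OF p] by simp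
  qed
  then show ?thesis
    using M by (cases "l2norm w = 0") (auto simp: power2_eq_square less_le)
qed

section \<open>Translations and averages over balls\<close>

text \<open>A relation rather than a function of \<open>u\<close>, so that midpoints and limits of
  gradients can be named directly.\<close>

definition weak_gradient :: "(real^'n::finite \<Rightarrow> complex) \<Rightarrow> (real^'n \<Rightarrow> complex^'n) \<Rightarrow> bool" where
  "weak_gradient u g \<longleftrightarrow> sq_int u \<and> sq_int g \<and> (\<forall>j. has_weak_partial j u (\<lambda>x. g x $ j))"

lemma weak_gradient_sq_int: "weak_gradient u g \<Longrightarrow> sq_int u" "weak_gradient u g \<Longrightarrow> sq_int g"
  by (auto simp: weak_gradient_def)

lemma sq_int_component:
  fixes g :: "'a::euclidean_space \<Rightarrow> complex^'n::finite"
  assumes "sq_int g"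
  shows "sq_int (\<lambda>x. g x $ j)" "l2norm (\<lambda>x. g x $ j) \<le> l2norm g"
proof -
  have [measurable]: "g \<in> borel_measurable borel" using assms by (simp add: sq_int_def)
  have m: "(\<lambda>x. g x $ j) \<in> borel_measurable borel"
    using borel_measurable_continuous_on[OF linear_continuous_on[OF bounded_linear_vec_nth]] by measurable
  show "sq_int (\<lambda>x. g x $ j)"
    by (rule sq_int_bound[OF assms m, of 1]) (simp add: component_le_norm_cart Finite_Cartesian_Product.norm_nth_le)
  show "l2norm (\<lambda>x. g x $ j) \<le> l2norm g"
    using l2norm_mono[OF assms m, of 1] by (simp add: component_le_norm_cart Finite_Cartesian_Product.norm_nth_le)
qed

text \<open>Along the shifts of the test function by -t h the integral has derivative equal to the
  sum over j of h_j times the integral of the shifted test function against g_j; the mean value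
  inequality on [0, 1] concludes. The factor \<open>CARD('n)\<close> comes from bounding each |h_j|
  by the norm of h.\<close>

lemma translation_estimate_dual:
  fixes u :: "real^'n::finite \<Rightarrow> complex"
  assumes ug: "weak_gradient u g" and \<phi>: "test_function \<phi>"
  shows "norm (LINT y|lborel. (\<phi> (y - h) - \<phi> y) *\<^sub>R u y) \<le> real CARD('n) * norm h * l2norm g * l2norm \<phi>"
proof -
  have u: "locally_integrable u" using ug sq_int_locally_integrable weak_gradient_sq_int by blast
  define F where "F t = (LINT y|lborel. \<phi> (y + t *\<^sub>R (- h)) *\<^sub>R u y)" for t
  define F' where "F' t = (LINT y|lborel. dir_deriv \<phi> (- h) (y + t *\<^sub>R (- h)) *\<^sub>R u y)" for t
  have der: "(F has_vector_derivative F' t) (at t)" for t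
    unfolding F_def[abs_def] F'_def by (rule has_derivative_integral_translate[OF \<phi> u])
  have bd: "norm (F' t) \<le> real CARD('n) * norm h * l2norm g * l2norm \<phi>" for t
  proof -
    let ?\<phi> = "\<lambda>y. \<phi> (y + t *\<^sub>R (- h))"
    have t\<phi>: "test_function ?\<phi>" by (rule test_function_translate[OF \<phi>])
    have int: "integrable lborel (\<lambda>y. partial_deriv j ?\<phi> y *\<^sub>R u y)" for j
      by (intro test_function_mult_integrable test_function_partial_deriv t\<phi> u)
    have "F' t = (LINT y|lborel. (\<Sum>j\<in>UNIV. (- h $ j) *\<^sub>R (partial_deriv j ?\<phi> y *\<^sub>R u y)))"
      unfolding F'_def dir_deriv_def partial_deriv_translate[OF test_function_differentiable[OF \<phi>]]
      by (simp add: scaleR_sum_left)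
    also have "\<dots> = (\<Sum>j\<in>UNIV. (- h $ j) *\<^sub>R (LINT y|lborel. partial_deriv j ?\<phi> y *\<^sub>R u y))"
      by (subst Bochner_Integration.integral_sum) (intro integrable_scaleR_right int sum.cong refl integral_scaleR_right)+
    also have "\<dots> = (\<Sum>j\<in>UNIV. (h $ j) *\<^sub>R (LINT y|lborel. ?\<phi> y *\<^sub>R (g y $ j)))"
      using ug t\<phi> by (intro sum.cong refl) (simp add: weak_gradient_def has_weak_partial_def)
    finally have F'_eq: "F' t = (\<Sum>j\<in>UNIV. (h $ j) *\<^sub>R (LINT y|lborel. ?\<phi> y *\<^sub>R (g y $ j)))" .
    have "norm (F' t) \<le> (\<Sum>j\<in>UNIV. norm ((h $ j) *\<^sub>R (LINT y|lborel. ?\<phi> y *\<^sub>R (g y $ j))))"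
      unfolding F'_eq by (rule norm_sum)
    also have "\<dots> \<le> (\<Sum>j\<in>(UNIV::'n set). norm h * (l2norm \<phi> * l2norm g))"
    proof (rule sum_mono)
      fix j :: 'n
      have "norm (LINT y|lborel. ?\<phi> y *\<^sub>R (g y $ j)) \<le> l2norm ?\<phi> * l2norm (\<lambda>y. g y $ j)"
        using ug by (intro norm_integral_mult_le test_function_sq_int t\<phi> sq_int_component weak_gradient_sq_int)
      also have "l2norm ?\<phi> = l2norm \<phi>"
        using l2norm_translate[OF test_function_borel[OF \<phi>]] .
      also have "l2norm \<phi> * l2norm (\<lambda>y. g y $ j) \<le> l2norm \<phi> * l2norm g"
        using ug by (intro mult_left_mono sq_int_component weak_gradient_sq_int) auto
      finally show "norm ((h $ j) *\<^sub>R (LINT y|lborel. ?\<phi> y *\<^sub>R (g y $ j))) \<le> norm h * (l2norm \<phi> * l2norm g)"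
        by (simp add: mult_mono component_le_norm_cart)
    qed
    finally show ?thesis by (simp add: mult_ac)
  qed
  have "norm (F 1 - F 0) \<le> real CARD('n) * norm h * l2norm g * l2norm \<phi> * norm (1 - 0 :: real)"
  proof (rule differentiable_bound[of UNIV])
    show "(F has_derivative (\<lambda>r. r *\<^sub>R F' t)) (at t within UNIV)" for t
      using der by (simp add: has_vector_derivative_def)
    show "onorm (\<lambda>r. r *\<^sub>R F' t) \<le> real CARD('n) * norm h * l2norm g * l2norm \<phi>" for t
    proof (rule onorm_le)
      show "norm (r *\<^sub>R F' t) \<le> real CARD('n) * norm h * l2norm g * l2norm \<phi> * norm r" for r
        using mult_left_mono[OF bd[of t], of "\<bar>r\<bar>"] by (simp add: mult_ac)
    qed
  qed auto
  moreover have "F 1 - F 0 = (LINT y|lborel. (\<phi> (y - h) - \<phi> y) *\<^sub>R u y)"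
  proof -
    have "F 1 - F 0 = (LINT y|lborel. \<phi> (y + 1 *\<^sub>R (- h)) *\<^sub>R u y - \<phi> (y + 0 *\<^sub>R (- h)) *\<^sub>R u y)"
      unfolding F_def using test_function_mult_integrable[OF test_function_translate[OF \<phi>] u]
      by (intro Bochner_Integration.integral_diff[symmetric])
    then show ?thesis by (simp add: scaleR_diff_left)
  qed
  ultimately show ?thesis by simp
qed

text \<open>Duality is applied to the real and the imaginary part; recombining them costs the square
  root of 2, rounded up to 2.\<close>

lemma translation_estimate:
  fixes u :: "real^'n::finite \<Rightarrow> complex"
  assumes ug: "weak_gradient u g"
  shows "l2norm (\<lambda>x. u (x + h) - u x) \<le> 2 * real CARD('n) * norm h * l2norm g"
proof -
  let ?M = "real CARD('n) * norm h * l2norm g"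
  have u: "sq_int u" using ug weak_gradient_sq_int by blast
  then have [measurable]: "u \<in> borel_measurable borel" by (simp add: sq_int_def)
  define w where "w x = u (x + h) - u x" for x
  have w: "sq_int w" unfolding w_def[abs_def] by (intro sq_int_diff sq_int_translate u)
  have dual: "norm (LINT x|lborel. \<phi> x *\<^sub>R w x) \<le> ?M * l2norm \<phi>" if \<phi>: "test_function \<phi>" for \<phi>
  proof -
    have \<phi>s: "sq_int \<phi>" by (rule test_function_sq_int[OF \<phi>])
    have [measurable]: "\<phi> \<in> borel_measurable borel" by (rule test_function_borel[OF \<phi>])
    have t: "sq_int (\<lambda>y. \<phi> (y - h))" using sq_int_translate[OF \<phi>s, of "- h"] by simp
    have "(LINT x|lborel. \<phi> x *\<^sub>R u (x + h)) = (LINT x|lborel. \<phi> ((x + h) - h) *\<^sub>R u (x + h))" by simp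
    also have "\<dots> = (LINT y|lborel. \<phi> (y - h) *\<^sub>R u y)"
      by (rule integral_translate(2)[of "\<lambda>y. \<phi> (y - h) *\<^sub>R u y"]) measurable
    finally have "(LINT x|lborel. \<phi> x *\<^sub>R w x) = (LINT y|lborel. (\<phi> (y - h) - \<phi> y) *\<^sub>R u y)"
      unfolding w_def scaleR_diff_right scaleR_diff_left
      using norm_integral_mult_le(1)[OF \<phi>s u] norm_integral_mult_le(1)[OF t u]
        norm_integral_mult_le(1)[OF \<phi>s sq_int_translate[OF u, of h]]
      by simp
    then show ?thesis using translation_estimate_dual[OF ug \<phi>, of h] by simp
  qed
  have wR: "sq_int (\<lambda>x. Re (w x))" and wI: "sq_int (\<lambda>x. Im (w x))"
    using sq_int_measurable[OF w]
    by (auto intro!: sq_int_bound[OF w, where C=1] simp: abs_Re_le_cmod abs_Im_le_cmod)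
  have M0: "?M \<ge> 0" by simp
  have "l2norm (\<lambda>x. Re (w x)) \<le> ?M"
  proof (rule l2norm_le_by_duality[OF wR M0])
    fix \<phi> :: "real^'n \<Rightarrow> real" assume \<phi>: "test_function \<phi>"
    have "(LINT x|lborel. \<phi> x *\<^sub>R Re (w x)) = Re (LINT x|lborel. \<phi> x *\<^sub>R w x)"
      by (subst integral_Re[symmetric]) (auto intro!: norm_integral_mult_le test_function_sq_int \<phi> w)
    then show "\<bar>LINT x|lborel. \<phi> x *\<^sub>R Re (w x)\<bar> \<le> ?M * l2norm \<phi>"
      using dual[OF \<phi>] abs_Re_le_cmod by (metis order_trans)
  qed
  moreover have "l2norm (\<lambda>x. Im (w x)) \<le> ?M"
  proof (rule l2norm_le_by_duality[OF wI M0])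
    fix \<phi> :: "real^'n \<Rightarrow> real" assume \<phi>: "test_function \<phi>"
    have "(LINT x|lborel. \<phi> x *\<^sub>R Im (w x)) = Im (LINT x|lborel. \<phi> x *\<^sub>R w x)"
      by (subst integral_Im[symmetric]) (auto intro!: norm_integral_mult_le test_function_sq_int \<phi> w)
    then show "\<bar>LINT x|lborel. \<phi> x *\<^sub>R Im (w x)\<bar> \<le> ?M * l2norm \<phi>"
      using dual[OF \<phi>] abs_Im_le_cmod by (metis order_trans)
  qed
  moreover have "(l2norm w)\<^sup>2 = (l2norm (\<lambda>x. Re (w x)))\<^sup>2 + (l2norm (\<lambda>x. Im (w x)))\<^sup>2"
    using sq_int_integrable[OF wR] sq_int_integrable[OF wI]
    unfolding l2norm_sq by (simp add: cmod_power2)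
  ultimately have "(l2norm w)\<^sup>2 \<le> ?M\<^sup>2 + ?M\<^sup>2"
    by (simp only:) (intro add_mono power_mono l2norm_nonneg)
  also have "\<dots> \<le> (2 * ?M)\<^sup>2" by (simp add: power2_eq_square)
  finally have "l2norm w \<le> 2 * ?M"
    by (rule power2_le_imp_le) simp
  then show ?thesis by (simp add: w_def[abs_def] mult.assoc)
qed

section \<open>Averages over balls\<close>

definition ball_average :: "real \<Rightarrow> ('a::euclidean_space \<Rightarrow> complex) \<Rightarrow> 'a \<Rightarrow> complex" where
  "ball_average s u x = (1 / measure lborel (ball (0::'a) s)) *\<^sub>R (LINT h|lborel. indicator (ball 0 s) h *\<^sub>R u (x + h))"

lemma measure_ball_pos: "s > 0 \<Longrightarrow> measure lborel (ball (x::'a::euclidean_space) s) > 0"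
  using content_ball_pos[of s x] by simp

lemma sq_int_indicator_ball:
  "sq_int (indicat_real (ball (0::'a::euclidean_space) s))"
  "(l2norm (indicat_real (ball (0::'a::euclidean_space) s)))\<^sup>2 = measure lborel (ball (0::'a) s)"
proof -
  have eq: "(\<lambda>x. (norm (indicat_real (ball (0::'a) s) x))\<^sup>2) = indicat_real (ball 0 s)" by (auto simp: indicator_def)
  show "sq_int (indicat_real (ball (0::'a) s))"
    unfolding sq_int_def eq using emeasure_bounded_finite[of "ball (0::'a) s"]
    by (auto intro!: borel_measurable_indicator)
  show "(l2norm (indicat_real (ball (0::'a) s)))\<^sup>2 = measure lborel (ball (0::'a) s)"
    unfolding l2norm_sq eq by simp
qed

lemma ball_average_integrable:
  assumes "sq_int u" 
  shows "integrable lborel (\<lambda>h. indicat_real (ball 0 s) h *\<^sub>R u (x + h))"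
  using norm_integral_mult_le(1)[OF sq_int_indicator_ball(1) sq_int_translate[OF assms, of x]]
  by (simp add: add.commute)

lemma ball_average_diff:
  assumes "sq_int u" "sq_int v"
  shows "ball_average s (\<lambda>x. u x - v x) x = ball_average s u x - ball_average s v x"
  unfolding ball_average_def scaleR_diff_right
  by (subst Bochner_Integration.integral_diff) (auto intro!: ball_average_integrable assms simp: scaleR_diff_right)

text \<open>Cauchy-Schwarz against the indicator of the ball. The bound is uniform in x, which is
  what turns L2 information into pointwise information.\<close>

lemma ball_average_bound:
  fixes u :: "'a::euclidean_space \<Rightarrow> complex"
  assumes u: "sq_int u" and s: "s > 0"
  shows "norm (ball_average s u x) \<le> l2norm u / sqrt (measure lborel (ball (0::'a) s))"
proof -
  let ?m = "measure lborel (ball (0::'a) s)"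
  have m: "?m > 0" using measure_ball_pos[OF s] .
  have um: "u \<in> borel_measurable borel" using u by (simp add: sq_int_def)
  have "norm (LINT h|lborel. indicat_real (ball 0 s) h *\<^sub>R u (h + x)) \<le> l2norm (indicat_real (ball (0::'a) s)) * l2norm (\<lambda>h. u (h + x))"
    by (intro norm_integral_mult_le sq_int_indicator_ball sq_int_translate u)
  also have "\<dots> = sqrt ?m * l2norm u"
    using sq_int_indicator_ball(2)[of s, where 'a='a] by (simp add: l2norm_translate[OF um] real_sqrt_unique)
  finally have "norm (ball_average s u x) \<le> (1 / ?m) * (sqrt ?m * l2norm u)"
    using m unfolding ball_average_def by (simp add: add.commute divide_right_mono)
  also have "\<dots> = l2norm u / sqrt ?m"
    using m by (simp add: field_simps)
  finally show ?thesis .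
qed

lemma ball_average_measurable [measurable]:
  fixes u :: "'a::euclidean_space \<Rightarrow> complex"
  assumes [measurable]: "u \<in> borel_measurable borel"
  shows "ball_average s u \<in> borel_measurable borel"
proof -
  have [measurable]: "ball (0::'a) s \<in> sets borel" by simp
  have "(\<lambda>(x, h). indicat_real (ball 0 s) h *\<^sub>R u (x + h)) \<in> borel_measurable (borel \<Otimes>\<^sub>M borel)"
    by measurable
  then have [measurable]: "(\<lambda>(x, h). indicat_real (ball 0 s) h *\<^sub>R u (x + h)) \<in> borel_measurable (borel \<Otimes>\<^sub>M lborel)"
    by (subst measurable_cong_sets[OF sets_pair_measure_cong refl]) auto
  have "(\<lambda>x. LINT h|lborel. indicat_real (ball 0 s) h *\<^sub>R u (x + h)) \<in> borel_measurable borel"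
    by (rule lborel.borel_measurable_lebesgue_integral) measurable
  then show ?thesis unfolding ball_average_def[abs_def] by measurable
qed

text \<open>The difference of the averages at x and y is the average at y of a translation
  difference of \<open>u\<close>. For a fixed radius this gives equicontinuity under a gradient
  bound.\<close>

lemma ball_average_lipschitz:
  fixes u :: "real^'n::finite \<Rightarrow> complex"
  assumes ug: "weak_gradient u g" and s: "s > 0"
  shows "norm (ball_average s u x - ball_average s u y)
    \<le> 2 * real CARD('n) * norm (x - y) * l2norm g / sqrt (measure lborel (ball (0::real^'n) s))"
proof -
  have u: "sq_int u" using ug weak_gradient_sq_int by blast
  have ut: "sq_int (\<lambda>z. u (z + (x - y)))" by (rule sq_int_translate[OF u])
  have "ball_average s u x = ball_average s (\<lambda>z. u (z + (x - y))) y"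
    unfolding ball_average_def by (simp add: algebra_simps)
  then have "ball_average s u x - ball_average s u y = ball_average s (\<lambda>z. u (z + (x - y)) - u z) y"
    by (simp add: ball_average_diff[OF ut u])
  also have "norm \<dots> \<le> l2norm (\<lambda>z. u (z + (x - y)) - u z) / sqrt (measure lborel (ball (0::real^'n) s))"
    by (intro ball_average_bound sq_int_diff ut u s)
  also have "\<dots> \<le> (2 * real CARD('n) * norm (x - y) * l2norm g) / sqrt (measure lborel (ball (0::real^'n) s))"
    by (intro divide_right_mono translation_estimate ug) simp
  finally show ?thesis .
qed

text \<open>Jensen's inequality bounds the squared deviation at x by the mean of |u(x + h) - u(x)|^2
  over the ball. Exchanging the integrals leaves the translation estimate for each h of norm below
  s.\<close>

lemma ball_average_close:
  fixes u :: "real^'n::finite \<Rightarrow> complex"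
  assumes ug: "weak_gradient u g" and s: "s > 0"
  shows "sq_int (\<lambda>x. u x - ball_average s u x)"
    "l2norm (\<lambda>x. u x - ball_average s u x) \<le> 2 * real CARD('n) * s * l2norm g"
proof -
  have u: "sq_int u" using ug weak_gradient_sq_int by blast
  then have [measurable]: "u \<in> borel_measurable borel" by (simp add: sq_int_def)
  let ?B = "ball (0::real^'n) s" and ?K = "2 * real CARD('n) * s * l2norm g"
  let ?m = "measure lborel ?B"
  have m: "?m > 0" using measure_ball_pos[OF s] .
  have [measurable]: "?B \<in> sets borel" by simp
  have K0: "?K \<ge> 0" using s by simp
  have pt: "ennreal ((norm (u x - ball_average s u x))\<^sup>2)
      \<le> ennreal (1 / ?m) * (\<integral>\<^sup>+h. indicator ?B h * ennreal ((norm (u (x + h) - u x))\<^sup>2) \<partial>lborel)" for x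
  proof -
    \<comment> \<open>The indicator is kept inside because the constant \<open>u x\<close> is square
      integrable in h only over the ball.\<close>
    let ?w = "\<lambda>h. indicat_real ?B h *\<^sub>R (u (h + x) - u x)"
    have c: "sq_int (\<lambda>h. indicat_real ?B h *\<^sub>R u x)"
    proof (rule sq_int_bound[OF sq_int_indicator_ball(1)[of s]])
      show "(\<lambda>h. indicat_real ?B h *\<^sub>R u x) \<in> borel_measurable borel"
        by (intro borel_measurable_scaleR borel_measurable_indicator borel_measurable_const) simp
      show "AE h in lborel. norm (indicat_real ?B h *\<^sub>R u x) \<le> norm (u x) * norm (indicat_real ?B h)"
        by (simp add: mult.commute)
    qed
    have "sq_int (\<lambda>h. indicat_real ?B h *\<^sub>R u (h + x))"
      by (rule sq_int_bound[OF sq_int_translate[OF u, of x], of _ 1]) (measurable, auto simp: indicator_def)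
    from sq_int_diff[OF this c] have w: "sq_int ?w" by (simp add: scaleR_diff_right)
    have i: "integrable lborel (\<lambda>h. indicat_real ?B h *\<^sub>R u x)"
      using emeasure_bounded_finite[of ?B] by (intro integrable_scaleR_left integrable_real_indicator) auto
    have iv: "(LINT h|lborel. indicat_real ?B h *\<^sub>R u x) = ?m *\<^sub>R u x"
      using emeasure_bounded_finite[of ?B] by (subst integral_scaleR_left) auto
    have "(LINT h|lborel. indicat_real ?B h *\<^sub>R (u (x + h) - u x)) = ?m *\<^sub>R ball_average s u x - ?m *\<^sub>R u x"
      unfolding ball_average_def scaleR_diff_right
      using m by (subst Bochner_Integration.integral_diff) (auto intro!: ball_average_integrable u i simp: iv)
    then have "?m * norm (u x - ball_average s u x) = norm (LINT h|lborel. indicat_real ?B h *\<^sub>R (u (x + h) - u x))"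
      using m by (simp add: norm_minus_commute flip: scaleR_diff_right)
    also have "(LINT h|lborel. indicat_real ?B h *\<^sub>R (u (x + h) - u x)) = (LINT h|lborel. indicat_real ?B h *\<^sub>R ?w h)"
      by (intro Bochner_Integration.integral_cong) (auto simp: indicator_def add.commute)
    also have "norm \<dots> \<le> l2norm (indicat_real ?B) * l2norm ?w"
      by (intro norm_integral_mult_le sq_int_indicator_ball w)
    finally have "(?m * norm (u x - ball_average s u x))\<^sup>2 \<le> (l2norm (indicat_real ?B) * l2norm ?w)\<^sup>2"
      using m by (intro power_mono) auto
    then have "?m * (?m * (norm (u x - ball_average s u x))\<^sup>2) \<le> ?m * (l2norm ?w)\<^sup>2"
      unfolding power_mult_distrib sq_int_indicator_ball(2) by (simp add: power2_eq_square mult.assoc)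
    then have "(norm (u x - ball_average s u x))\<^sup>2 \<le> (1 / ?m) * (l2norm ?w)\<^sup>2"
      using m by (simp add: field_simps)
    then have "ennreal ((norm (u x - ball_average s u x))\<^sup>2) \<le> ennreal (1 / ?m) * ennreal ((l2norm ?w)\<^sup>2)"
      using m by (subst ennreal_mult[symmetric]) (auto intro!: ennreal_leI)
    moreover have "ennreal ((l2norm ?w)\<^sup>2) = (\<integral>\<^sup>+h. indicator ?B h * ennreal ((norm (u (x + h) - u x))\<^sup>2) \<partial>lborel)"
    proof -
      have "ennreal ((l2norm ?w)\<^sup>2) = (\<integral>\<^sup>+h. ennreal ((norm (?w h))\<^sup>2) \<partial>lborel)"
        unfolding l2norm_sq using sq_int_integrable[OF w] by (simp add: nn_integral_eq_integral)
      also have "\<dots> = (\<integral>\<^sup>+h. indicator ?B h * ennreal ((norm (u (x + h) - u x))\<^sup>2) \<partial>lborel)"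
        by (intro nn_integral_cong) (auto simp: indicator_def add.commute)
      finally show ?thesis .
    qed
    ultimately show ?thesis by simp
  qed
  have "(\<integral>\<^sup>+x. ennreal ((norm (u x - ball_average s u x))\<^sup>2) \<partial>lborel)
      \<le> (\<integral>\<^sup>+x. ennreal (1 / ?m) * (\<integral>\<^sup>+h. indicator ?B h * ennreal ((norm (u (x + h) - u x))\<^sup>2) \<partial>lborel) \<partial>lborel)"
    by (intro nn_integral_mono pt)
  also have "\<dots> = ennreal (1 / ?m) * (\<integral>\<^sup>+x. (\<integral>\<^sup>+h. indicator ?B h * ennreal ((norm (u (x + h) - u x))\<^sup>2) \<partial>lborel) \<partial>lborel)"
    by (intro nn_integral_cmult) measurable
  also have "(\<integral>\<^sup>+x. (\<integral>\<^sup>+h. indicator ?B h * ennreal ((norm (u (x + h) - u x))\<^sup>2) \<partial>lborel) \<partial>lborel)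
     = (\<integral>\<^sup>+h. (\<integral>\<^sup>+x. indicator ?B h * ennreal ((norm (u (x + h) - u x))\<^sup>2) \<partial>lborel) \<partial>lborel)"
    by (rule lborel_pair.Fubini') measurable
  also have "\<dots> \<le> (\<integral>\<^sup>+h. ennreal (?K\<^sup>2) * indicator ?B h \<partial>lborel)"
  proof (rule nn_integral_mono)
    fix h :: "real^'n"
    show "(\<integral>\<^sup>+x. indicator ?B h * ennreal ((norm (u (x + h) - u x))\<^sup>2) \<partial>lborel) \<le> ennreal (?K\<^sup>2) * indicator ?B h"
    proof (cases "h \<in> ?B")
      case True
      have d: "sq_int (\<lambda>x. u (x + h) - u x)" by (intro sq_int_diff sq_int_translate u)
      have "l2norm (\<lambda>x. u (x + h) - u x) \<le> 2 * real CARD('n) * norm h * l2norm g"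
        by (rule translation_estimate[OF ug])
      also have "\<dots> \<le> ?K" using True by (intro mult_right_mono mult_left_mono) auto
      finally have "(l2norm (\<lambda>x. u (x + h) - u x))\<^sup>2 \<le> ?K\<^sup>2" by (intro power_mono) auto
      moreover have "(\<integral>\<^sup>+x. ennreal ((norm (u (x + h) - u x))\<^sup>2) \<partial>lborel) = ennreal ((l2norm (\<lambda>x. u (x + h) - u x))\<^sup>2)"
        unfolding l2norm_sq using sq_int_integrable[OF d] by (simp add: nn_integral_eq_integral)
      ultimately show ?thesis using True by (simp add: ennreal_leI)
    qed simp
  qed
  also have "\<dots> = ennreal (?K\<^sup>2) * ennreal ?m"
    using emeasure_bounded_finite[of ?B]
    by (simp add: nn_integral_cmult emeasure_eq_ennreal_measure less_top)
  finally have "(\<integral>\<^sup>+x. ennreal ((norm (u x - ball_average s u x))\<^sup>2) \<partial>lborel) \<le> ennreal (1 / ?m) * (ennreal (?K\<^sup>2) * ennreal ?m)"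
    by (simp add: mult_left_mono)
  also have "\<dots> = ennreal (?K\<^sup>2)"
    using m by (simp flip: ennreal_mult)
  finally have le: "(\<integral>\<^sup>+x. ennreal ((norm (u x - ball_average s u x))\<^sup>2) \<partial>lborel) \<le> ennreal (?K\<^sup>2)" .
  then have "integrable lborel (\<lambda>x. (norm (u x - ball_average s u x))\<^sup>2)"
    by (intro integrableI_bounded) (auto simp: intro: le_less_trans)
  then show sq: "sq_int (\<lambda>x. u x - ball_average s u x)" by (simp add: sq_int_def)
  have "ennreal ((l2norm (\<lambda>x. u x - ball_average s u x))\<^sup>2) \<le> ennreal (?K\<^sup>2)"
    using le sq_int_integrable[OF sq] by (simp add: nn_integral_eq_integral l2norm_sq)
  then have "(l2norm (\<lambda>x. u x - ball_average s u x))\<^sup>2 \<le> ?K\<^sup>2" by simp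
  then show "l2norm (\<lambda>x. u x - ball_average s u x) \<le> ?K" using K0 power2_le_imp_le by blast
qed

section \<open>Compactness\<close>

text \<open>For each radius the averages are equibounded and equicontinuous, so a diagonal
  subsequence converges at every point for all radii at once. On a large ball dominated convergence
  makes this L2 convergence; small radii control the distance of \<open>u\<close> to its averages,
  and the weight controls the outside of the ball.\<close>

lemma rellich:
  fixes u :: "nat \<Rightarrow> real^'n::finite \<Rightarrow> complex"
  assumes ug: "\<And>k. weak_gradient (u k) (g k)"
    and xu: "\<And>k. sq_int (\<lambda>x. norm x *\<^sub>R u k x)"
    and M: "\<And>k. l2norm (u k) \<le> M" "\<And>k. l2norm (g k) \<le> M" "\<And>k. l2norm (\<lambda>x. norm x *\<^sub>R u k x) \<le> M"
  obtains r v where "strict_mono r" "sq_int v" "(\<lambda>k. l2norm (\<lambda>x. u (r k) x - v x)) \<longlonglongrightarrow> 0"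
proof -
  have M0: "M \<ge> 0" using M(1)[of 0] l2norm_nonneg order_trans by blast
  have u: "sq_int (u k)" for k using ug weak_gradient_sq_int by blast
  then have um [measurable]: "u k \<in> borel_measurable borel" for k by (simp add: sq_int_def)
  define s where "s m = 1 / real (Suc m)" for m
  have s0: "s m > 0" for m by (simp add: s_def)
  define \<mu> where "\<mu> m = sqrt (measure lborel (ball (0::real^'n) (s m)))" for m
  have \<mu>0: "\<mu> m > 0" for m using measure_ball_pos[OF s0] by (simp add: \<mu>_def)
  define a where "a k m x = ball_average (s m) (u k) x" for k m x
  have am: "a k m \<in> borel_measurable borel" for k m
    unfolding a_def[abs_def] by (rule ball_average_measurable[OF um])
  have ab: "norm (a k m x) \<le> M / \<mu> m" for k m x
  proof -
    have "norm (a k m x) \<le> l2norm (u k) / \<mu> m"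
      unfolding a_def \<mu>_def by (rule ball_average_bound[OF u s0])
    also have "\<dots> \<le> M / \<mu> m" using M(1) \<mu>0[of m] by (intro divide_right_mono) auto
    finally show ?thesis .
  qed
  have al: "norm (a k m x - a k m y) \<le> (2 * real CARD('n) * M / \<mu> m) * norm (x - y)" for k m x y
  proof -
    have "norm (a k m x - a k m y) \<le> 2 * real CARD('n) * norm (x - y) * l2norm (g k) / \<mu> m"
      unfolding a_def \<mu>_def by (rule ball_average_lipschitz[OF ug s0])
    also have "\<dots> \<le> 2 * real CARD('n) * norm (x - y) * M / \<mu> m"
      using M(2) \<mu>0[of m] by (intro divide_right_mono mult_left_mono) auto
    finally show ?thesis by (simp add: mult_ac)
  qed
  obtain D :: "(real^'n) set" where D: "countable D" "\<And>X. open X \<Longrightarrow> X \<noteq> {} \<Longrightarrow> \<exists>d\<in>D. d \<in> X"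
    using countable_dense_setE by metis
  \<comment> \<open>The scaling by \<open>\<mu> m\<close> makes \<open>M\<close> a common bound for
    all radii, so one extraction handles all pairs of a radius and a point of
    \<open>D\<close>.\<close>
  define f where "f k = (\<lambda>(m, x). \<mu> m *\<^sub>R a k m x)" for k
  have "countable (UNIV \<times> D :: (nat \<times> (real^'n)) set)" using D(1) by simp
  moreover have "norm (f k z) \<le> M" for k z
  proof -
    obtain m x where z: "z = (m, x)" by (cases z)
    have "\<mu> m * norm (a k m x) \<le> \<mu> m * (M / \<mu> m)" using ab \<mu>0[of m] by (intro mult_left_mono) auto
    then show ?thesis using \<mu>0[of m] by (simp add: f_def z)
  qed
  ultimately obtain r :: "nat \<Rightarrow> nat" where r: "strict_mono r"
    and conv: "\<And>z. z \<in> UNIV \<times> D \<Longrightarrow> \<exists>l. (\<lambda>k. f (r k) z) \<longlonglongrightarrow> l"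
    using function_convergent_subsequence[of "UNIV \<times> D" f M] by blast
  have cD: "Cauchy (\<lambda>k. a (r k) m x)" if xD: "x \<in> D" for m x
  proof -
    obtain l where "(\<lambda>k. f (r k) (m, x)) \<longlonglongrightarrow> l" using conv[of "(m, x)"] xD by blast
    then have "(\<lambda>k. (1 / \<mu> m) *\<^sub>R f (r k) (m, x)) \<longlonglongrightarrow> (1 / \<mu> m) *\<^sub>R l" by (intro tendsto_intros)
    then have "(\<lambda>k. a (r k) m x) \<longlonglongrightarrow> (1 / \<mu> m) *\<^sub>R l" using \<mu>0[of m] by (simp add: f_def)
    then show ?thesis by (rule LIMSEQ_imp_Cauchy)
  qed
  \<comment> \<open>Convergence on the dense set spreads to all points by the uniform Lipschitz
    bound.\<close>
  have cc: "convergent (\<lambda>k. a (r k) m x)" for m x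
  proof (rule Cauchy_convergent, rule metric_CauchyI)
    fix e :: real assume e: "e > 0"
    define L where "L = 2 * real CARD('n) * M / \<mu> m + 1"
    have L: "L > 0" unfolding L_def using M0 \<mu>0[of m] by (intro add_nonneg_pos) auto
    have eL: "e / (3 * L) > 0" using e L by simp
    then obtain d where d: "d \<in> D" "dist x d < e / (3 * L)"
      using D(2)[of "ball x (e / (3 * L))"] by auto
    have close: "dist (a k m x) (a k m d) < e / 3" for k
    proof -
      have "dist (a k m x) (a k m d) \<le> L * dist x d"
        using al[of k m x d] unfolding dist_norm L_def by (simp add: distrib_right add_increasing2)
      also have "\<dots> < L * (e / (3 * L))" using d L by (intro mult_strict_left_mono)
      also have "\<dots> = e / 3" using L by simp
      finally show ?thesis .
    qed
    obtain N where N: "\<And>i j. i \<ge> N \<Longrightarrow> j \<ge> N \<Longrightarrow> dist (a (r i) m d) (a (r j) m d) < e / 3"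
      using metric_CauchyD[OF cD[OF d(1), of m], of "e / 3"] e by (metis divide_pos_pos zero_less_numeral)
    have "dist (a (r i) m x) (a (r j) m x) < e" if "i \<ge> N" "j \<ge> N" for i j
      using dist_triangle_third[of "a (r i) m x" "a (r i) m d" e "a (r j) m d" "a (r j) m x"]
        close[of "r i"] close[of "r j"] N[OF that] by (simp add: dist_commute)
    then show "\<exists>N. \<forall>i\<ge>N. \<forall>j\<ge>N. dist (a (r i) m x) (a (r j) m x) < e" by blast
  qed
  define A where "A m x = lim (\<lambda>k. a (r k) m x)" for m x
  have Al: "(\<lambda>k. a (r k) m x) \<longlonglongrightarrow> A m x" for m x
    using cc unfolding A_def by (simp add: convergent_LIMSEQ_iff)
  have Am: "A m \<in> borel_measurable borel" for m
    by (rule borel_measurable_LIMSEQ_metric[of "\<lambda>k. a (r k) m"]) (use am Al in auto)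
  have Ab: "norm (A m x) \<le> M / \<mu> m" for m x
    using LIMSEQ_le_const2[OF tendsto_norm[OF Al]] ab by blast
  have "l2_Cauchy (\<lambda>k. u (r k))"
    unfolding l2_Cauchy_def
  proof (intro allI impI)
    fix e :: real assume e: "e > 0"
    define c where "c = 2 * real CARD('n) * M + 1"
    have c: "c > 0" unfolding c_def using M0 by (intro add_nonneg_pos) auto
    obtain m where m: "s m < e / (6 * c)"
      using nat_approx_posE[of "e / (6 * c)"] e c unfolding s_def by auto
    \<comment> \<open>The radius \<open>s m\<close> and the cut-off \<open>R\<close> are chosen so
      that the averaging error and the part outside the ball are each below e / 6, as is the third
      piece from index N on.\<close>
    define R where "R = 6 * (M + 1) / e"
    have R: "R > 0" "M / R < e / 6"
      using e M0 by (auto simp: R_def field_simps)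
    let ?B = "ball (0::real^'n) R"
    have Bm [measurable]: "?B \<in> sets borel" by simp
    have Bi: "(\<lambda>x. indicat_real ?B x *\<^sub>R h x) \<in> borel_measurable borel" if "h \<in> borel_measurable borel" for h :: "real^'n \<Rightarrow> complex"
      using that by (intro borel_measurable_scaleR borel_measurable_indicator Bm)
    have Bbd: "sq_int (\<lambda>x. indicat_real ?B x *\<^sub>R h x)" if h: "h \<in> borel_measurable borel" "\<And>x. norm (h x) \<le> K" for h :: "real^'n \<Rightarrow> complex" and K
      by (rule sq_int_bound[OF sq_int_indicator_ball(1)[of R] Bi[OF h(1)], of K]) (use h(2) in \<open>auto simp: indicator_def\<close>)
    have Adiff: "norm (a k m x - A m x) \<le> 2 * M / \<mu> m" for k x
      using norm_triangle_ineq4[of "a k m x" "A m x"] ab[of k m x] Ab[of m x] by (simp add: add_divide_distrib)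
    have dm: "(\<lambda>x. a k m x - A m x) \<in> borel_measurable borel" for k
      using am Am by (intro borel_measurable_diff)
    have dsq: "sq_int (\<lambda>x. indicat_real ?B x *\<^sub>R (a k m x - A m x))" for k
      by (rule Bbd[OF dm Adiff])
    have "(\<lambda>k. LINT x|lborel. (norm (indicat_real ?B x *\<^sub>R (a (r k) m x - A m x)))\<^sup>2) \<longlonglongrightarrow> (LINT x|(lborel :: (real^'n) measure). (0::real))"
    proof (rule integral_dominated_convergence[where w="\<lambda>x. (2 * M / \<mu> m)\<^sup>2 * (norm (indicat_real ?B x))\<^sup>2"])
      show "integrable lborel (\<lambda>x. (2 * M / \<mu> m)\<^sup>2 * (norm (indicat_real ?B x))\<^sup>2)"
        by (intro integrable_mult_right sq_int_integrable sq_int_indicator_ball)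
      show "AE x in lborel. (\<lambda>k. (norm (indicat_real ?B x *\<^sub>R (a (r k) m x - A m x)))\<^sup>2) \<longlonglongrightarrow> 0"
      proof (rule AE_I2)
        fix x
        have "(\<lambda>k. (norm (indicat_real ?B x *\<^sub>R (a (r k) m x - A m x)))\<^sup>2) \<longlonglongrightarrow> (norm (indicat_real ?B x *\<^sub>R (A m x - A m x)))\<^sup>2"
          by (intro tendsto_intros Al)
        then show "(\<lambda>k. (norm (indicat_real ?B x *\<^sub>R (a (r k) m x - A m x)))\<^sup>2) \<longlonglongrightarrow> 0" by simp
      qed
      show "AE x in lborel. norm ((norm (indicat_real ?B x *\<^sub>R (a (r k) m x - A m x)))\<^sup>2) \<le> (2 * M / \<mu> m)\<^sup>2 * (norm (indicat_real ?B x))\<^sup>2" for k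
      proof (rule AE_I2)
        fix x
        have "(norm (indicat_real ?B x *\<^sub>R (a (r k) m x - A m x)))\<^sup>2 \<le> ((2 * M / \<mu> m) * norm (indicat_real ?B x))\<^sup>2"
          using Adiff by (intro power_mono) (auto simp: indicator_def)
        then show "norm ((norm (indicat_real ?B x *\<^sub>R (a (r k) m x - A m x)))\<^sup>2) \<le> (2 * M / \<mu> m)\<^sup>2 * (norm (indicat_real ?B x))\<^sup>2"
          unfolding power_mult_distrib[of "2 * M / \<mu> m"] by simp
      qed
      show "(\<lambda>x. (norm (indicat_real ?B x *\<^sub>R (a (r k) m x - A m x)))\<^sup>2) \<in> borel_measurable lborel" for k
        using borel_measurable_power[OF measurable_compose[OF Bi[OF dm] borel_measurable_norm]] by simp
    qed simp
    then have "(\<lambda>k. sqrt (LINT x|lborel. (norm (indicat_real ?B x *\<^sub>R (a (r k) m x - A m x)))\<^sup>2)) \<longlonglongrightarrow> sqrt 0"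
      by (intro tendsto_real_sqrt) simp
    then have "(\<lambda>k. l2norm (\<lambda>x. indicat_real ?B x *\<^sub>R (a (r k) m x - A m x))) \<longlonglongrightarrow> 0"
      by (simp add: l2norm_def)
    from order_tendstoD(2)[OF this, of "e / 6"] e obtain N where
      N: "\<And>k. k \<ge> N \<Longrightarrow> l2norm (\<lambda>x. indicat_real ?B x *\<^sub>R (a (r k) m x - A m x)) < e / 6"
      by (auto simp: eventually_sequentially)
    \<comment> \<open>A fixed comparison function: two members of the sequence within e / 2 of it
      are within e of each other.\<close>
    define w where "w x = indicat_real ?B x *\<^sub>R A m x" for x
    have wsq: "sq_int w" unfolding w_def[abs_def] by (rule Bbd[OF Am Ab])
    have est: "l2norm (\<lambda>x. u (r k) x - w x) < e / 2" if "k \<ge> N" for k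
    proof -
      let ?f1 = "\<lambda>x. indicat_real (- ?B) x *\<^sub>R u (r k) x"
      let ?f2 = "\<lambda>x. indicat_real ?B x *\<^sub>R (u (r k) x - a (r k) m x)"
      let ?f3 = "\<lambda>x. indicat_real ?B x *\<^sub>R (a (r k) m x - A m x)"
      have ud: "sq_int (\<lambda>x. u (r k) x - a (r k) m x)"
        "l2norm (\<lambda>x. u (r k) x - a (r k) m x) \<le> 2 * real CARD('n) * s m * l2norm (g (r k))"
        unfolding a_def by (rule ball_average_close[OF ug s0])+
      have m1: "?f1 \<in> borel_measurable borel"
        by (intro borel_measurable_scaleR borel_measurable_indicator um borel_comp Bm)
      have m2: "?f2 \<in> borel_measurable borel" using ud(1) by (intro Bi) (simp add: sq_int_def)
      have b1: "norm (?f1 x) \<le> (1 / R) * norm (norm x *\<^sub>R u (r k) x)" for x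
      proof (cases "x \<in> ?B")
        case False
        then have "1 * norm (u (r k) x) \<le> (norm x / R) * norm (u (r k) x)"
          using R(1) by (intro mult_right_mono) auto
        then show ?thesis using False by simp
      qed (use R(1) in auto)
      have f1: "sq_int ?f1" by (rule sq_int_bound[OF xu m1 AE_I2]) (rule b1)
      have f2: "sq_int ?f2" by (rule sq_int_bound[OF ud(1) m2, of 1]) (auto simp: indicator_def)
      have n1: "l2norm ?f1 < e / 6"
      proof -
        have "l2norm ?f1 \<le> (1 / R) * l2norm (\<lambda>x. norm x *\<^sub>R u (r k) x)"
          by (rule l2norm_mono[OF xu m1 AE_I2]) (use b1 R(1) in auto)
        also have "\<dots> \<le> (1 / R) * M" using M(3) R(1) by (intro mult_left_mono) auto
        also have "(1 / R) * M = M / R" by simp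
        finally show ?thesis using R(2) by (rule le_less_trans)
      qed
      have n2: "l2norm ?f2 < e / 6"
      proof -
        have "l2norm ?f2 \<le> 1 * l2norm (\<lambda>x. u (r k) x - a (r k) m x)"
          by (rule l2norm_mono[OF ud(1) m2]) (auto simp: indicator_def)
        also have "\<dots> \<le> 2 * real CARD('n) * s m * l2norm (g (r k))" using ud(2) by simp
        also have "\<dots> \<le> 2 * real CARD('n) * s m * M"
          using M(2) s0[of m] by (intro mult_left_mono) auto
        also have "\<dots> \<le> s m * c" using s0[of m] by (simp add: c_def algebra_simps)
        also have "\<dots> < e / (6 * c) * c" using m c by (rule mult_strict_right_mono)
        also have "\<dots> = e / 6" using c by simp
        finally show ?thesis .
      qed
      have "(\<lambda>x. u (r k) x - w x) = (\<lambda>x. ?f1 x + (?f2 x + ?f3 x))"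
        by (rule ext) (simp add: w_def indicator_def)
      then have "l2norm (\<lambda>x. u (r k) x - w x) \<le> l2norm ?f1 + l2norm (\<lambda>x. ?f2 x + ?f3 x)"
        using l2norm_triangle[OF f1 sq_int_add[OF f2 dsq]] by simp
      also have "\<dots> \<le> l2norm ?f1 + (l2norm ?f2 + l2norm ?f3)"
        using l2norm_triangle[OF f2 dsq] by simp
      finally show ?thesis using n1 n2 N[OF that] by simp
    qed
    have "l2norm (\<lambda>x. u (r i) x - u (r j) x) < e" if "i \<ge> N" "j \<ge> N" for i j
      using l2norm_triangle_diff[OF u[of "r i"] wsq u[of "r j"]] est[OF that(1)] est[OF that(2)]
        l2norm_minus_commute[of w "u (r j)"] by linarith
    then show "\<exists>N. \<forall>i\<ge>N. \<forall>j\<ge>N. l2norm (\<lambda>x. u (r i) x - u (r j) x) < e" by blast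
  qed
  from l2_complete[OF u this] r that show ?thesis by blast
qed

section \<open>The quadratic form\<close>

text \<open>An element of \<Sigma> together with one chosen representative of its gradient.\<close>

definition Sigma_pair :: "(real^'n::finite \<Rightarrow> complex) \<Rightarrow> (real^'n \<Rightarrow> complex^'n) \<Rightarrow> bool" where
  "Sigma_pair u g \<longleftrightarrow> weak_gradient u g \<and> sq_int (\<lambda>x. norm x *\<^sub>R u x)"

lemma borel_measurable_axis [measurable]:
  fixes f :: "'a::euclidean_space \<Rightarrow> complex"
  assumes "f \<in> borel_measurable borel"
  shows "(\<lambda>x. axis j (f x) :: complex^'n::finite) \<in> borel_measurable borel"
proof -
  have "linear (axis j :: complex \<Rightarrow> complex^'n)"
    by (rule linearI) (auto simp: axis_def vec_eq_iff)
  then have "(axis j :: complex \<Rightarrow> complex^'n) \<in> borel_measurable borel"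
    by (intro borel_measurable_continuous_onI linear_continuous_on) (simp add: linear_conv_bounded_linear)
  from measurable_compose[OF assms this] show ?thesis .
qed

lemma borel_measurable_vec_nth:
  fixes f :: "'a::euclidean_space \<Rightarrow> complex^'n::finite"
  assumes "f \<in> borel_measurable borel"
  shows "(\<lambda>x. f x $ j) \<in> borel_measurable borel"
proof -
  have "(\<lambda>v::complex^'n. v $ j) \<in> borel_measurable borel"
    by (intro borel_measurable_continuous_onI linear_continuous_on bounded_linear_vec_nth)
  from measurable_compose[OF assms this] show ?thesis .
qed

lemma norm_axis_complex: "norm (axis j z :: complex^'n::finite) = norm z"
  by (simp add: norm_eq_sqrt_inner inner_axis_axis)

lemma Sigma_space_iff: "u \<in> Sigma_space \<longleftrightarrow> (\<exists>g. Sigma_pair u g)"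
proof
  assume u: "u \<in> Sigma_space"
  then have su: "sq_int u" and "\<forall>j. \<exists>h. has_weak_partial j u h \<and> sq_int h"
    by (auto simp: Sigma_space_def H1_def square_integrable_iff)
  then obtain h where h: "\<And>j. has_weak_partial j u (h j)" "\<And>j. sq_int (h j)" by metis
  define g :: "real^'a \<Rightarrow> complex^'a" where "g x = (\<Sum>j\<in>UNIV. axis j (h j x))" for x
  have ax: "sq_int (\<lambda>x. axis j (h j x) :: complex^'a)" for j
    by (rule sq_int_bound[OF h(2)[of j], of _ 1]) (use h(2)[of j] in \<open>auto simp: sq_int_def norm_axis_complex intro!: borel_measurable_axis\<close>)
  have "sq_int (\<lambda>x. \<Sum>j\<in>S. axis j (h j x) :: complex^'a)" if "finite S" for S
    using that by (induction S rule: finite_induct) (auto intro!: sq_int_add ax)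
  then have "sq_int g" unfolding g_def[abs_def] by simp
  moreover have "g x $ j = h j x" for x j
    by (simp add: g_def axis_def if_distrib cong: if_cong)
  ultimately have "weak_gradient u g" using h su by (simp add: weak_gradient_def)
  then show "\<exists>g. Sigma_pair u g"
    using u by (auto simp: Sigma_pair_def Sigma_space_def square_integrable_iff scaleR_conv_of_real)
next
  assume "\<exists>g. Sigma_pair u g"
  then obtain g where "Sigma_pair u g" by blast
  then show "u \<in> Sigma_space"
    using sq_int_component(1)
    by (auto simp: Sigma_pair_def weak_gradient_def Sigma_space_def H1_def square_integrable_iff scaleR_conv_of_real)
qed

lemma Sigma_pairD:
  assumes "Sigma_pair u g"
  shows "sq_int u" "sq_int g" "sq_int (\<lambda>x. norm x *\<^sub>R u x)" "\<And>j. has_weak_partial j u (\<lambda>x. g x $ j)"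
    "weak_gradient u g"
  using assms by (auto simp: Sigma_pair_def weak_gradient_def)

lemma has_weak_partial_add:
  assumes "has_weak_partial j f g" "has_weak_partial j f' g'"
  shows "has_weak_partial j (\<lambda>x. f x + f' x) (\<lambda>x. g x + g' x)"
  using assms unfolding has_weak_partial_def
  by (auto intro!: locally_integrable_add
      simp: scaleR_add_right test_function_mult_integrable test_function_partial_deriv)

lemma has_weak_partial_scaleR:
  assumes "has_weak_partial j f g"
  shows "has_weak_partial j (\<lambda>x. c *\<^sub>R f x) (\<lambda>x. c *\<^sub>R g x)"
proof -
  have "locally_integrable (\<lambda>x. c *\<^sub>R f x)" if "locally_integrable f" for f :: "real^'a \<Rightarrow> complex"
    unfolding locally_integrable_def set_integrable_def scaleR_left_commute[of _ c]
    using that by (auto simp: locally_integrable_def set_integrable_def simp del: scaleR_scaleR)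
  moreover have "(LINT x|lborel. \<phi> x *\<^sub>R (c *\<^sub>R h x)) = c *\<^sub>R (LINT x|lborel. \<phi> x *\<^sub>R h x)"
    if "test_function \<phi>" "locally_integrable h" for \<phi> and h :: "real^'a \<Rightarrow> complex"
    unfolding scaleR_left_commute[of _ c] by (rule integral_scaleR_right)
  ultimately show ?thesis
    using assms unfolding has_weak_partial_def by (simp add: test_function_partial_deriv del: scaleR_scaleR)
qed

lemma Sigma_pair_midpoint:
  assumes "Sigma_pair u g" "Sigma_pair v h"
  shows "Sigma_pair (\<lambda>x. (1/2) *\<^sub>R (u x + v x)) (\<lambda>x. (1/2) *\<^sub>R (g x + h x))"
proof -
  have "sq_int (\<lambda>x. (1/2) *\<^sub>R (norm x *\<^sub>R u x + norm x *\<^sub>R v x))"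
    using assms by (intro sq_int_scaleR sq_int_add Sigma_pairD)
  moreover have "(\<lambda>x. (1/2) *\<^sub>R (norm x *\<^sub>R u x + norm x *\<^sub>R v x)) = (\<lambda>x. norm x *\<^sub>R ((1/2) *\<^sub>R (u x + v x)))"
    by (rule ext) (simp add: algebra_simps)
  moreover have "has_weak_partial j (\<lambda>x. (1/2) *\<^sub>R (u x + v x)) (\<lambda>x. ((1/2) *\<^sub>R (g x + h x)) $ j)" for j
    using has_weak_partial_scaleR[OF has_weak_partial_add[OF Sigma_pairD(4)[OF assms(1)] Sigma_pairD(4)[OF assms(2)]]]
    by simp
  ultimately show ?thesis
    using assms by (auto simp: Sigma_pair_def weak_gradient_def intro!: sq_int_scaleR sq_int_add)
qed

text \<open>Weak differentiation is a closed operator: both sides of its defining identity are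
  L2-continuous, as test functions and their partials are square integrable.\<close>

lemma has_weak_partial_l2_limit:
  assumes w: "\<And>k. has_weak_partial j (u k) (g k)"
    and sq: "\<And>k. sq_int (u k)" "\<And>k. sq_int (g k)" "sq_int v" "sq_int h"
    and lim: "(\<lambda>k. l2norm (\<lambda>x. u k x - v x)) \<longlonglongrightarrow> 0" "(\<lambda>k. l2norm (\<lambda>x. g k x - h x)) \<longlonglongrightarrow> 0"
  shows "has_weak_partial j v h"
proof -
  have conv: "(\<lambda>k. LINT x|lborel. \<phi> x *\<^sub>R a k x) \<longlonglongrightarrow> (LINT x|lborel. \<phi> x *\<^sub>R b x)"
    if \<phi>: "sq_int \<phi>" and ab: "\<And>k. sq_int (a k)" "sq_int b" "(\<lambda>k. l2norm (\<lambda>x. a k x - b x)) \<longlonglongrightarrow> 0"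
    for \<phi> :: "real^'a \<Rightarrow> real" and a :: "nat \<Rightarrow> real^'a \<Rightarrow> complex" and b
  proof (rule LIM_zero_cancel, rule Lim_null_comparison)
    show "\<forall>\<^sub>F k in sequentially. norm ((LINT x|lborel. \<phi> x *\<^sub>R a k x) - (LINT x|lborel. \<phi> x *\<^sub>R b x)) \<le> l2norm \<phi> * l2norm (\<lambda>x. a k x - b x)"
    proof (rule always_eventually, rule allI)
      fix k
      have "(LINT x|lborel. \<phi> x *\<^sub>R a k x) - (LINT x|lborel. \<phi> x *\<^sub>R b x) = (LINT x|lborel. \<phi> x *\<^sub>R (a k x - b x))"
        unfolding scaleR_diff_right
        by (intro Bochner_Integration.integral_diff[symmetric] norm_integral_mult_le \<phi> ab)
      then show "norm ((LINT x|lborel. \<phi> x *\<^sub>R a k x) - (LINT x|lborel. \<phi> x *\<^sub>R b x)) \<le> l2norm \<phi> * l2norm (\<lambda>x. a k x - b x)"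
        using norm_integral_mult_le(2)[OF \<phi> sq_int_diff[OF ab(1) ab(2)]] by simp
    qed
    show "(\<lambda>k. l2norm \<phi> * l2norm (\<lambda>x. a k x - b x)) \<longlonglongrightarrow> 0"
      using tendsto_mult_left[OF ab(3), of "l2norm \<phi>"] by simp
  qed
  show ?thesis
    unfolding has_weak_partial_def
  proof (intro conjI allI impI)
    fix \<phi> :: "real^'a \<Rightarrow> real" assume \<phi>: "test_function \<phi>"
    have 1: "(\<lambda>k. LINT x|lborel. partial_deriv j \<phi> x *\<^sub>R u k x) \<longlonglongrightarrow> (LINT x|lborel. partial_deriv j \<phi> x *\<^sub>R v x)"
      by (intro conv test_function_sq_int test_function_partial_deriv \<phi> sq lim)
    have "(\<lambda>k. - (LINT x|lborel. \<phi> x *\<^sub>R g k x)) \<longlonglongrightarrow> - (LINT x|lborel. \<phi> x *\<^sub>R h x)"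
      by (intro tendsto_minus conv test_function_sq_int \<phi> sq lim)
    moreover have "(LINT x|lborel. partial_deriv j \<phi> x *\<^sub>R u k x) = - (LINT x|lborel. \<phi> x *\<^sub>R g k x)" for k
      using w \<phi> by (simp add: has_weak_partial_def)
    ultimately show "(LINT x|lborel. partial_deriv j \<phi> x *\<^sub>R v x) = - (LINT x|lborel. \<phi> x *\<^sub>R h x)"
      using 1 LIMSEQ_unique by simp
  qed (intro sq_int_locally_integrable sq)+
qed

text \<open>Dyadic convex combinations; midpoints are the only ones that the parallelogram law
  refers to.\<close>

inductive_set midpoint_hull :: "('a \<Rightarrow> 'b::real_vector) set \<Rightarrow> ('a \<Rightarrow> 'b) set" for S where
  base: "f \<in> S \<Longrightarrow> f \<in> midpoint_hull S"
| midpoint: "f \<in> midpoint_hull S \<Longrightarrow> g \<in> midpoint_hull S \<Longrightarrow> (\<lambda>x. (1/2) *\<^sub>R (f x + g x)) \<in> midpoint_hull S"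

lemma midpoint_hull_mono:
  assumes "S \<subseteq> T" shows "midpoint_hull S \<subseteq> midpoint_hull T"
proof
  fix f assume "f \<in> midpoint_hull S"
  then show "f \<in> midpoint_hull T"
    by induction (use assms in \<open>auto intro: midpoint_hull.intros\<close>)
qed

section \<open>Completing the square in the rotating trap\<close>

locale rotating_trap =
  fixes i1 i2 :: "'n::finite" and \<gamma> \<Omega> :: real
  assumes i12: "i1 \<noteq> i2" and \<gamma>: "\<gamma> > 0" and \<Omega>: "\<bar>\<Omega>\<bar> < \<gamma>"
begin

text \<open>Completing the square, the quadratic part of the energy density is
  \<open>\<bar>\<nabla>u - i a u\<bar>\<^sup>2 / 2 + V \<bar>u\<bar>\<^sup>2 / 2\<close>, where \<open>a\<close> has the components \<open>- \<Omega> x\<^sub>2\<close>, \<open>\<Omega> x\<^sub>1\<close> in the rotation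
  plane and \<open>V = \<gamma>\<^sup>2 \<bar>x\<bar>\<^sup>2 - \<Omega>\<^sup>2 (x\<^sub>1\<^sup>2 + x\<^sub>2\<^sup>2)\<close>. The pair \<open>(u, \<nabla>u)\<close> is mapped linearly to
  \<open>(\<nabla>u - i a u, \<surd>V u)\<close>.\<close>

definition gauge :: "real^'n \<Rightarrow> complex \<Rightarrow> complex^'n" where
  "gauge x z = axis i1 (\<i> * of_real (- \<Omega> * x $ i2) * z) + axis i2 (\<i> * of_real (\<Omega> * x $ i1) * z)"

definition trap :: "real^'n \<Rightarrow> real" where
  "trap x = \<gamma>\<^sup>2 * (norm x)\<^sup>2 - \<Omega>\<^sup>2 * ((x $ i1)\<^sup>2 + (x $ i2)\<^sup>2)"

definition energy_root :: "real^'n \<Rightarrow> complex \<times> (complex^'n) \<Rightarrow> (complex^'n) \<times> complex" where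
  "energy_root x p = (snd p - gauge x (fst p), sqrt (trap x) *\<^sub>R fst p)"

text \<open>The strength of the confinement left after the centrifugal term; it is where the
  condition on the rotation speed enters the estimates.\<close>

definition gap :: real where "gap = sqrt (\<gamma>\<^sup>2 - \<Omega>\<^sup>2)"

lemma \<Omega>_sq_less: "\<Omega>\<^sup>2 < \<gamma>\<^sup>2"
  using \<Omega> \<gamma> by (metis abs_ge_zero abs_of_pos power2_abs power_strict_mono zero_less_numeral)

lemma gap_pos: "gap > 0"
  using \<Omega>_sq_less by (simp add: gap_def)

lemma plane_le_norm: "(x $ i1)\<^sup>2 + (x $ i2)\<^sup>2 \<le> (norm x)\<^sup>2"
proof -
  have "(x $ i1)\<^sup>2 + (x $ i2)\<^sup>2 = (\<Sum>j\<in>{i1, i2}. (x $ j)\<^sup>2)" using i12 by simp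
  also have "\<dots> \<le> (\<Sum>j\<in>UNIV. (x $ j)\<^sup>2)" by (intro sum_mono2) auto
  also have "\<dots> = (norm x)\<^sup>2" unfolding power2_norm_eq_inner inner_vec_def by (simp add: power2_eq_square)
  finally show ?thesis .
qed

lemma trap_ge: "gap\<^sup>2 * (norm x)\<^sup>2 \<le> trap x"
proof -
  have "\<Omega>\<^sup>2 * ((x $ i1)\<^sup>2 + (x $ i2)\<^sup>2) \<le> \<Omega>\<^sup>2 * (norm x)\<^sup>2"
    by (intro mult_left_mono plane_le_norm) simp
  then show ?thesis using \<Omega>_sq_less by (simp add: trap_def gap_def algebra_simps)
qed

lemma trap_nonneg: "0 \<le> trap x"
  using trap_ge[of x] by (meson mult_nonneg_nonneg order_trans zero_le_power2)

lemma trap_le: "trap x \<le> \<gamma>\<^sup>2 * (norm x)\<^sup>2"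
  by (simp add: trap_def)

lemma norm_gauge_le: "norm (gauge x z) \<le> 2 * \<bar>\<Omega>\<bar> * norm (norm x *\<^sub>R z)"
proof -
  have "norm (gauge x z) \<le> \<bar>\<Omega>\<bar> * \<bar>x $ i2\<bar> * norm z + \<bar>\<Omega>\<bar> * \<bar>x $ i1\<bar> * norm z"
    unfolding gauge_def by (rule norm_triangle_le) (simp add: norm_axis_complex norm_mult abs_mult)
  also have "\<dots> \<le> \<bar>\<Omega>\<bar> * norm x * norm z + \<bar>\<Omega>\<bar> * norm x * norm z"
    by (intro add_mono mult_right_mono mult_left_mono component_le_norm_cart) auto
  finally show ?thesis by (simp add: mult_ac)
qed

lemma gauge_add: "gauge x (y + z) = gauge x y + gauge x z"
  by (auto simp: gauge_def vec_eq_iff axis_def algebra_simps)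

lemma gauge_scaleR: "gauge x (c *\<^sub>R z) = c *\<^sub>R gauge x z"
  by (auto simp: gauge_def vec_eq_iff axis_def algebra_simps)

lemma energy_root_add: "energy_root x (p + q) = energy_root x p + energy_root x q"
  by (simp add: energy_root_def gauge_add scaleR_add_right)

lemma energy_root_scaleR: "energy_root x (c *\<^sub>R p) = c *\<^sub>R energy_root x p"
  by (simp add: energy_root_def gauge_scaleR scaleR_diff_right)

lemma energy_root_diff: "energy_root x (p - q) = energy_root x p - energy_root x q"
  using energy_root_add[of x p "- q"] energy_root_scaleR[of x "-1" q] by simp

text \<open>The cross term of the square is the rotation term. The square of the gauge term is
  \<Omega>^2 (x_1^2 + x_2^2) |z|^2, by orthogonality of the two axes, and cancels the amount removed
  from the harmonic potential in \<open>trap\<close>.\<close>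

lemma norm_energy_root_sq:
  "(norm (energy_root x (z, d)))\<^sup>2 = (norm d)\<^sup>2 + \<gamma>\<^sup>2 * (norm x)\<^sup>2 * (norm z)\<^sup>2
     - 2 * Re (of_real \<Omega> * cnj z * (\<i> * (of_real (x $ i2) * d $ i1 - of_real (x $ i1) * d $ i2)))"
proof -
  let ?a = "\<i> * of_real (- \<Omega> * x $ i2) * z" and ?b = "\<i> * of_real (\<Omega> * x $ i1) * z"
  have g: "(norm (gauge x z))\<^sup>2 = (norm ?a)\<^sup>2 + (norm ?b)\<^sup>2"
    using i12 unfolding gauge_def
    by (simp add: power2_norm_eq_inner inner_add inner_axis_axis del: mult_minus_left)
  have d: "d \<bullet> gauge x z = d $ i1 \<bullet> ?a + d $ i2 \<bullet> ?b"
    unfolding gauge_def by (simp add: inner_add inner_axis del: mult_minus_left)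
  have "(norm (energy_root x (z, d)))\<^sup>2 = (norm (d - gauge x z))\<^sup>2 + (norm (sqrt (trap x) *\<^sub>R z))\<^sup>2"
    by (simp add: energy_root_def norm_Pair)
  also have "\<dots> = (norm d)\<^sup>2 - 2 * (d \<bullet> gauge x z) + ((norm (gauge x z))\<^sup>2 + trap x * (norm z)\<^sup>2)"
    using trap_nonneg[of x]
    by (simp add: power2_norm_eq_inner[of "_ - _"] inner_diff inner_commute power_mult_distrib)
      (simp add: power2_norm_eq_inner)
  also have "(norm (gauge x z))\<^sup>2 + trap x * (norm z)\<^sup>2 = \<gamma>\<^sup>2 * (norm x)\<^sup>2 * (norm z)\<^sup>2"
    unfolding g by (simp add: norm_mult power_mult_distrib trap_def algebra_simps)
  also have "d \<bullet> gauge x z = Re (of_real \<Omega> * cnj z * (\<i> * (of_real (x $ i2) * d $ i1 - of_real (x $ i1) * d $ i2)))"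
    unfolding d by (simp add: inner_complex_def algebra_simps)
  finally show ?thesis by simp
qed

lemma norm_weight_le: "norm (norm x *\<^sub>R z) \<le> (1 / gap) * norm (energy_root x (z, d))"
proof -
  have "(gap * norm (norm x *\<^sub>R z))\<^sup>2 \<le> (norm (energy_root x (z, d)))\<^sup>2"
  proof -
    have "(gap * norm (norm x *\<^sub>R z))\<^sup>2 = gap\<^sup>2 * (norm x)\<^sup>2 * (norm z)\<^sup>2"
      by (simp add: power_mult_distrib mult.assoc)
    also have "\<dots> \<le> trap x * (norm z)\<^sup>2" by (intro mult_right_mono trap_ge) simp
    also have "\<dots> \<le> (norm (energy_root x (z, d)))\<^sup>2"
      using trap_nonneg[of x] by (simp add: energy_root_def norm_Pair power_mult_distrib)
    finally show ?thesis .
  qed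
  then have "gap * norm (norm x *\<^sub>R z) \<le> norm (energy_root x (z, d))"
    by (rule power2_le_imp_le) simp
  then show ?thesis using gap_pos by (simp add: field_simps)
qed

text \<open>The 1 stands for the covariant gradient and the second term for undoing the gauge shift,
  whose size 2 |\<Omega>| |x| |z| is controlled by the trap component.\<close>

definition grad_const :: real where "grad_const = 1 + 2 * \<bar>\<Omega>\<bar> / gap"

lemma grad_const_pos: "grad_const > 0"
  unfolding grad_const_def using gap_pos by (intro add_pos_nonneg) auto

lemma norm_gradient_le: "norm d \<le> grad_const * norm (energy_root x (z, d))"
proof -
  have "norm (d - gauge x z) \<le> norm (energy_root x (z, d))"
    using norm_fst_le[of "d - gauge x z" "sqrt (trap x) *\<^sub>R z"] by (simp add: energy_root_def)
  moreover have "norm (gauge x z) \<le> 2 * \<bar>\<Omega>\<bar> * ((1 / gap) * norm (energy_root x (z, d)))"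
    by (rule order_trans[OF norm_gauge_le]) (intro mult_left_mono norm_weight_le, simp)
  moreover have "norm d \<le> norm (d - gauge x z) + norm (gauge x z)"
    using norm_triangle_ineq[of "d - gauge x z" "gauge x z"] by simp
  ultimately show ?thesis by (simp add: grad_const_def distrib_right)
qed

lemma borel_measurable_energy_root:
  assumes [measurable]: "u \<in> borel_measurable borel" "g \<in> borel_measurable borel"
  shows "(\<lambda>x. energy_root x (u x, g x)) \<in> borel_measurable borel"
proof -
  have c: "(\<lambda>x::real^'n. x $ j) \<in> borel_measurable borel" for j
    by (intro borel_measurable_continuous_onI linear_continuous_on bounded_linear_vec_nth)
  have [measurable]: "(\<lambda>x. gauge x (u x)) \<in> borel_measurable borel"
    unfolding gauge_def
    using c[measurable] by (intro borel_measurable_add borel_measurable_axis) measurable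
  have [measurable]: "(\<lambda>x. sqrt (trap x)) \<in> borel_measurable borel"
    unfolding trap_def using c by measurable
  show ?thesis unfolding energy_root_def fst_conv snd_conv
    by (intro borel_measurable_Pair) measurable
qed

lemma energy_root_sq_int:
  assumes "Sigma_pair u g"
  shows "sq_int (\<lambda>x. energy_root x (u x, g x))"
proof -
  note s = Sigma_pairD[OF assms]
  have m [measurable]: "u \<in> borel_measurable borel" "g \<in> borel_measurable borel"
    using s by (auto simp: sq_int_def)
  let ?c = "2 * \<bar>\<Omega>\<bar> + \<gamma>"
  have "sq_int (\<lambda>x. norm (g x) + ?c *\<^sub>R norm (norm x *\<^sub>R u x))"
  proof (intro sq_int_add sq_int_scaleR)
    show "sq_int (\<lambda>x. norm (g x))" using s(2) by (auto simp: sq_int_def)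
    show "sq_int (\<lambda>x. norm (norm x *\<^sub>R u x))" by (rule sq_int_bound[OF s(3), of _ 1]) auto
  qed
  then show ?thesis
  proof (rule sq_int_bound[of _ _ 1])
    have "norm (energy_root x (u x, g x)) \<le> norm (g x) + ?c * norm (norm x *\<^sub>R u x)" for x
    proof -
      have "sqrt (trap x) \<le> \<gamma> * norm x"
        using trap_le[of x] \<gamma> by (intro real_le_lsqrt) (auto simp: power_mult_distrib)
      then have 1: "norm (sqrt (trap x) *\<^sub>R u x) \<le> \<gamma> * norm (norm x *\<^sub>R u x)"
        using trap_nonneg[of x] by (simp add: mult_right_mono flip: mult.assoc)
      have "norm (energy_root x (u x, g x)) \<le> norm (g x - gauge x (u x)) + norm (sqrt (trap x) *\<^sub>R u x)"
        unfolding energy_root_def fst_conv snd_conv by (rule norm_Pair_le)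
      also have "norm (g x - gauge x (u x)) \<le> norm (g x) + norm (gauge x (u x))" by (rule norm_triangle_ineq4)
      also have "norm (gauge x (u x)) \<le> 2 * \<bar>\<Omega>\<bar> * norm (norm x *\<^sub>R u x)" by (rule norm_gauge_le)
      finally show ?thesis using 1 by (simp add: distrib_right)
    qed
    then show "AE x in lborel. norm (energy_root x (u x, g x)) \<le> 1 * norm (norm (g x) + ?c *\<^sub>R norm (norm x *\<^sub>R u x))"
      using \<gamma> by (intro AE_I2) (simp add: order_trans[OF _ abs_ge_self])
  qed (intro borel_measurable_energy_root m)
qed

lemma l2norm_gradient_le:
  assumes "Sigma_pair u g"
  shows "l2norm g \<le> grad_const * l2norm (\<lambda>x. energy_root x (u x, g x))"
    "l2norm (\<lambda>x. norm x *\<^sub>R u x) \<le> (1 / gap) * l2norm (\<lambda>x. energy_root x (u x, g x))"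
proof -
  note s = Sigma_pairD[OF assms] and e = energy_root_sq_int[OF assms]
  show "l2norm g \<le> grad_const * l2norm (\<lambda>x. energy_root x (u x, g x))"
    using s(2) grad_const_pos by (intro l2norm_mono[OF e] AE_I2 norm_gradient_le) (auto simp: sq_int_def)
  show "l2norm (\<lambda>x. norm x *\<^sub>R u x) \<le> (1 / gap) * l2norm (\<lambda>x. energy_root x (u x, g x))"
    using s(3) gap_pos by (intro l2norm_mono[OF e] AE_I2 norm_weight_le) (auto simp: sq_int_def)
qed

text \<open>A hands-on form of Mazur's lemma. Almost-minimizers over the midpoint hulls of tails
  have L2-Cauchy energy roots; coercivity makes their gradients converge as well, and their first
  components still tend to \<open>v\<close>.\<close>

lemma energy_root_lsc:
  assumes p: "\<And>k. Sigma_pair (u k) (g k)" and v: "sq_int v"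
    and lim: "(\<lambda>k. l2norm (\<lambda>x. u k x - v x)) \<longlonglongrightarrow> 0"
    and q: "(\<lambda>k. l2norm (\<lambda>x. energy_root x (u k x, g k x))) \<longlonglongrightarrow> q"
  obtains h where "Sigma_pair v h" "l2norm (\<lambda>x. energy_root x (v x, h x)) \<le> q"
proof -
  define H where "H m = midpoint_hull ((\<lambda>k x. (u k x, g k x)) ` {m..})" for m :: nat
  define S where "S m = (\<lambda>P x. energy_root x (P x)) ` H m" for m
  have HP: "Sigma_pair (\<lambda>x. fst (P x)) (\<lambda>x. snd (P x))" if "P \<in> H m" for P m
    using that unfolding H_def
  proof induction
    case (base P)
    then show ?case using p by auto
  next
    case (midpoint P Q)
    then show ?case using Sigma_pair_midpoint[OF midpoint(3,4)] by simp
  qed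
  \<comment> \<open>The distance to \<open>v\<close> is convex, so a bound valid on a tail survives
    in its midpoint hull.\<close>
  have He: "l2norm (\<lambda>x. fst (P x) - v x) \<le> e"
    if "P \<in> H m" and e: "\<And>k. k \<ge> m \<Longrightarrow> l2norm (\<lambda>x. u k x - v x) \<le> e" for P m e
    using that(1)
  proof (induction P rule: midpoint_hull.induct[of _ "(\<lambda>k x. (u k x, g k x)) ` {m..}", folded H_def, consumes 1])
    case (1 P)
    then show ?case using e by auto
  next
    case (2 P Q)
    have sP: "sq_int (\<lambda>x. fst (P x) - v x)" "sq_int (\<lambda>x. fst (Q x) - v x)"
      by (rule sq_int_diff[OF Sigma_pairD(1)[OF HP[OF 2(1)]] v])
        (rule sq_int_diff[OF Sigma_pairD(1)[OF HP[OF 2(2)]] v])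
    have "(\<lambda>x. fst ((1/2) *\<^sub>R (P x + Q x)) - v x) = (\<lambda>x. (1/2) *\<^sub>R ((fst (P x) - v x) + (fst (Q x) - v x)))"
      by (rule ext) (simp add: scaleR_conv_of_real field_simps)
    then have "l2norm (\<lambda>x. fst ((1/2) *\<^sub>R (P x + Q x)) - v x) = (1/2) * l2norm (\<lambda>x. (fst (P x) - v x) + (fst (Q x) - v x))"
      by (simp only: l2norm_scaleR)
    also have "\<dots> \<le> (1/2) * (l2norm (\<lambda>x. fst (P x) - v x) + l2norm (\<lambda>x. fst (Q x) - v x))"
      by (intro mult_left_mono l2norm_triangle sP) simp
    also have "\<dots> \<le> e" using 2(3,4) by simp
    finally show ?case .
  qed
  have q0: "q \<ge> 0" using q by (rule LIMSEQ_le_const) auto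
  obtain B where B: "\<And>k. l2norm (\<lambda>x. energy_root x (u k x, g k x)) \<le> B"
    using convergent_imp_Bseq[OF convergentI[OF q]] unfolding Bseq_def by auto
  obtain f where f: "\<And>m. f m \<in> S m" "l2_Cauchy f"
    and fmin: "\<And>m g. g \<in> S m \<Longrightarrow> (l2norm (f m))\<^sup>2 \<le> (l2norm g)\<^sup>2 + 1 / real (Suc m)"
  proof (rule midpoint_closed_Cauchy_minimizers[of S B])
    show "sq_int f" if "f \<in> S m" for m f
      using that energy_root_sq_int[OF HP] by (auto simp: S_def)
    show "S (Suc m) \<subseteq> S m" for m
      unfolding S_def H_def by (intro image_mono midpoint_hull_mono) auto
    show "(\<lambda>x. (1/2) *\<^sub>R (f x + g x)) \<in> S m" if fg: "f \<in> S m" "g \<in> S m" for m f g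
    proof -
      obtain P Q where PQ: "P \<in> H m" "f = (\<lambda>x. energy_root x (P x))" "Q \<in> H m" "g = (\<lambda>x. energy_root x (Q x))"
        using fg by (auto simp: S_def)
      have "(\<lambda>x. (1/2) *\<^sub>R (P x + Q x)) \<in> H m"
        using PQ(1,3) unfolding H_def by (rule midpoint_hull.midpoint)
      then show ?thesis
        unfolding S_def PQ(2,4) by (rule rev_image_eqI) (simp add: energy_root_scaleR energy_root_add)
    qed
    show "\<exists>f\<in>S m. l2norm f \<le> B" for m
    proof (rule bexI)
      show "(\<lambda>x. energy_root x (u m x, g m x)) \<in> S m"
        unfolding S_def H_def by (intro image_eqI[OF refl] midpoint_hull.base) auto
    qed (rule B)
  qed blast
  have "\<exists>P. P \<in> H m \<and> f m = (\<lambda>x. energy_root x (P x))" for m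
    using f(1)[of m] by (auto simp: S_def)
  then obtain P where P: "\<And>m. P m \<in> H m" "\<And>m. f m = (\<lambda>x. energy_root x (P m x))" by metis
  define w where "w m x = fst (P m x)" for m x
  define d where "d m x = snd (P m x)" for m x
  have wd: "Sigma_pair (w m) (d m)" for m
    using HP[OF P(1)] unfolding w_def[abs_def] d_def[abs_def] by simp
  have fwd: "f m = (\<lambda>x. energy_root x (w m x, d m x))" for m
    by (simp add: P(2) w_def d_def)
  note wds = Sigma_pairD[OF wd]
  have wlim: "(\<lambda>m. l2norm (\<lambda>x. w m x - v x)) \<longlonglongrightarrow> 0"
  proof (rule LIMSEQ_I)
    fix e :: real assume e: "e > 0"
    then obtain N where N: "\<And>k. k \<ge> N \<Longrightarrow> l2norm (\<lambda>x. u k x - v x) \<le> e / 2"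
      using order_tendstoD(2)[OF lim, of "e / 2"] by (auto simp: eventually_sequentially intro: less_imp_le)
    have "l2norm (\<lambda>x. w m x - v x) \<le> e / 2" if "m \<ge> N" for m
      unfolding w_def using He[OF P(1)[of m], of "e / 2"] N that by (meson order_trans)
    then show "\<exists>N. \<forall>m\<ge>N. norm (l2norm (\<lambda>x. w m x - v x) - 0) < e"
      using e by (intro exI[of _ N]) fastforce
  qed
  \<comment> \<open>By linearity of \<open>energy_root\<close> the pointwise coercivity estimate
    applies to differences of pairs.\<close>
  have "l2_Cauchy d"
  proof (rule l2_Cauchy_mono[OF f(2) grad_const_pos])
    fix i j
    have "norm (d i x - d j x) \<le> grad_const * norm (f i x - f j x)" for x
      using norm_gradient_le[of "d i x - d j x" x "w i x - w j x"]
        energy_root_diff[of x "(w i x, d i x)" "(w j x, d j x)"] by (simp add: fwd)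
    moreover have "(\<lambda>x. d i x - d j x) \<in> borel_measurable borel"
      using sq_int_diff[OF wds(2) wds(2)] by (auto simp: sq_int_def)
    moreover have "sq_int (\<lambda>x. f i x - f j x)"
      unfolding fwd by (intro sq_int_diff energy_root_sq_int wd)
    ultimately show "l2norm (\<lambda>x. d i x - d j x) \<le> grad_const * l2norm (\<lambda>x. f i x - f j x)"
      using grad_const_pos by (intro l2norm_mono) auto
  qed
  then obtain h where h: "sq_int h" and hlim: "(\<lambda>m. l2norm (\<lambda>x. d m x - h x)) \<longlonglongrightarrow> 0"
    using l2_complete[of d, OF wds(2)] by blast
  obtain r1 where r1: "strict_mono r1" "AE x in lborel. (\<lambda>m. w (r1 m) x) \<longlonglongrightarrow> v x"
    using l2_AE_subseq[of w v, OF wds(1) v wlim] by blast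
  have "(\<lambda>m. l2norm (\<lambda>x. d (r1 m) x - h x)) \<longlonglongrightarrow> 0"
    using LIMSEQ_subseq_LIMSEQ[OF hlim r1(1)] by (simp add: o_def)
  then obtain r2 where r2: "strict_mono r2" "AE x in lborel. (\<lambda>m. d (r1 (r2 m)) x) \<longlonglongrightarrow> h x"
    using l2_AE_subseq[of "\<lambda>m. d (r1 m)" h, OF wds(2) h] by blast
  define r where "r m = r1 (r2 m)" for m
  have rm: "strict_mono r" unfolding r_def[abs_def] using r1(1) r2(1) by (auto simp: strict_mono_def)
  \<comment> \<open>For fixed x the root is a continuous linear map of the pair, so a common almost
    everywhere subsequence of both components identifies the limit.\<close>
  have ae: "AE x in lborel. (\<lambda>m. f (r m) x) \<longlonglongrightarrow> energy_root x (v x, h x)"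
    using r1(2) r2(2)
  proof eventually_elim
    case (elim x)
    have "(\<lambda>m. w (r m) x) \<longlonglongrightarrow> v x"
      using LIMSEQ_subseq_LIMSEQ[OF elim(1) r2(1)] by (simp add: o_def r_def)
    moreover have "(\<lambda>m. axis j (c * w (r m) x) :: complex^'n) \<longlonglongrightarrow> axis j (c * v x)" for j c
    proof -
      have "bounded_linear (axis j :: complex \<Rightarrow> complex^'n)"
        by (simp flip: linear_conv_bounded_linear) (rule linearI; auto simp: axis_def vec_eq_iff)
      then show ?thesis
        by (rule bounded_linear.tendsto) (intro tendsto_intros \<open>(\<lambda>m. w (r m) x) \<longlonglongrightarrow> v x\<close>)
    qed
    moreover have "(\<lambda>m. d (r m) x) \<longlonglongrightarrow> h x" using elim(2) by (simp add: r_def)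
    ultimately show ?case
      unfolding fwd energy_root_def gauge_def fst_conv snd_conv
      by (intro tendsto_intros)
  qed
  have fsq: "sq_int (f m)" for m unfolding fwd by (rule energy_root_sq_int[OF wd])
  have hm: "(\<lambda>x. energy_root x (v x, h x)) \<in> borel_measurable borel"
    using v h by (intro borel_measurable_energy_root) (auto simp: sq_int_def)
  \<comment> \<open>Every original term with index k >= m competes in \<open>S m\<close>, and these
    norms tend to \<open>q\<close>.\<close>
  have fle: "(l2norm (f m))\<^sup>2 \<le> q\<^sup>2 + 1 / real (Suc m)" for m
  proof (rule LIMSEQ_le_const)
    show "(\<lambda>k. (l2norm (\<lambda>x. energy_root x (u k x, g k x)))\<^sup>2 + 1 / real (Suc m)) \<longlonglongrightarrow> q\<^sup>2 + 1 / real (Suc m)"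
      by (intro tendsto_intros q)
    show "\<exists>N. \<forall>k\<ge>N. (l2norm (f m))\<^sup>2 \<le> (l2norm (\<lambda>x. energy_root x (u k x, g k x)))\<^sup>2 + 1 / real (Suc m)"
    proof (intro exI[of _ m] allI impI fmin)
      fix k assume "m \<le> k"
      then show "(\<lambda>x. energy_root x (u k x, g k x)) \<in> S m"
        unfolding S_def H_def by (intro image_eqI[OF refl] midpoint_hull.base) auto
    qed
  qed
  have fat: "sq_int (\<lambda>x. energy_root x (v x, h x)) \<and> l2norm (\<lambda>x. energy_root x (v x, h x)) \<le> sqrt (q\<^sup>2 + e)"
    if e: "e > 0" for e
  proof -
    obtain N where N: "1 / real (Suc N) < e" using nat_approx_posE[OF e] by blast
    have "\<forall>\<^sub>F m in sequentially. l2norm (f (r m)) \<le> sqrt (q\<^sup>2 + e)"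
      using eventually_ge_at_top[of N]
    proof eventually_elim
      case (elim m)
      then have "r m \<ge> N" using seq_suble[OF rm, of m] by linarith
      then have "1 / real (Suc (r m)) \<le> 1 / real (Suc N)" by (simp add: frac_le)
      then have "(l2norm (f (r m)))\<^sup>2 \<le> q\<^sup>2 + e" using fle[of "r m"] N by linarith
      then show ?case by (rule real_le_rsqrt)
    qed
    with l2_fatou[OF fsq hm ae] show ?thesis by blast
  qed
  have sq: "sq_int (\<lambda>x. energy_root x (v x, h x))" using fat[of 1] by simp
  have "l2norm (\<lambda>x. energy_root x (v x, h x)) \<le> q"
  proof -
    have "(l2norm (\<lambda>x. energy_root x (v x, h x)))\<^sup>2 \<le> q\<^sup>2"
    proof (rule field_le_epsilon)
      fix e :: real assume e: "e > 0"
      have "(l2norm (\<lambda>x. energy_root x (v x, h x)))\<^sup>2 \<le> (sqrt (q\<^sup>2 + e))\<^sup>2"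
        using fat[OF e] by (intro power_mono) auto
      then show "(l2norm (\<lambda>x. energy_root x (v x, h x)))\<^sup>2 \<le> q\<^sup>2 + e" using e by (simp add: add_nonneg_nonneg)
    qed
    then show ?thesis using q0 power2_le_imp_le by blast
  qed
  moreover have "Sigma_pair v h"
    unfolding Sigma_pair_def weak_gradient_def
  proof (intro conjI allI v h)
    have "(\<lambda>x. norm x *\<^sub>R v x) \<in> borel_measurable borel" using v by (auto simp: sq_int_def)
    then show "sq_int (\<lambda>x. norm x *\<^sub>R v x)"
      by (rule sq_int_bound[OF sq _ AE_I2]) (rule norm_weight_le)
    fix j
    show "has_weak_partial j v (\<lambda>x. h x $ j)"
    proof (rule has_weak_partial_l2_limit[of j w "\<lambda>k x. d k x $ j" v "\<lambda>x. h x $ j", OF wds(4) wds(1) sq_int_component(1)[OF wds(2)] v sq_int_component(1)[OF h] wlim])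
      show "(\<lambda>k. l2norm (\<lambda>x. d k x $ j - h x $ j)) \<longlonglongrightarrow> 0"
      proof (rule Lim_null_comparison[OF _ hlim], rule always_eventually, rule allI)
        fix k show "norm (l2norm (\<lambda>x. d k x $ j - h x $ j)) \<le> l2norm (\<lambda>x. d k x - h x)"
          using sq_int_component(2)[OF sq_int_diff[OF wds(2) h], of k j] by simp
      qed
    qed
  qed
  ultimately show ?thesis using that by blast
qed

end

section \<open>Estimates on level sets\<close>

text \<open>The Chebyshev factor 4 / t^2 times (2 n s)^2 gives 16 n^2 s^2 / t^2; the power is what
  s^2 contributes apart from its factor t^(-4/n). The type argument fixes the dimension.\<close>

definition level_const :: "real \<Rightarrow> 'n::finite itself \<Rightarrow> real" where
  "level_const c _ = 16 * (real CARD('n))\<^sup>2 * (4 * c\<^sup>2 / measure lborel (ball (0::real^'n) 1)) powr (2 / real CARD('n))"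

lemma level_const_nonneg: "level_const c TYPE('n::finite) \<ge> 0"
  by (simp add: level_const_def)

text \<open>A weak-type Gagliardo--Nirenberg inequality: the radius \<open>s\<close> is chosen such that the average of
  \<open>u\<close> over balls of radius \<open>s\<close> is at most \<open>t / 2\<close>.\<close>

lemma emeasure_level_set_le:
  fixes u :: "real^'n::finite \<Rightarrow> complex"
  assumes ug: "weak_gradient u g" and uc: "l2norm u = c" and c: "c > 0" and t: "t > 0"
  shows "emeasure lborel {x. norm (u x) > t}
    \<le> ennreal (level_const c TYPE('n) * t powr (- 2 - 4 / real CARD('n)) * (l2norm g)\<^sup>2)"
proof -
  let ?n = "real CARD('n)"
  have n: "?n > 0" by simp
  have u: "sq_int u" using ug weak_gradient_sq_int by blast
  then have [measurable]: "u \<in> borel_measurable borel" by (simp add: sq_int_def)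
  define b where "b = measure lborel (ball (0::real^'n) 1)"
  have b: "b > 0" unfolding b_def by (rule measure_ball_pos) simp
  \<comment> \<open>The ball of this radius has volume 4 c^2 / t^2, so
    \<open>ball_average_bound\<close> yields exactly t / 2.\<close>
  define s where "s = (4 * c\<^sup>2 / (t\<^sup>2 * b)) powr (1 / ?n)"
  have s: "s > 0" unfolding s_def using c t b by simp
  have "s ^ CARD('n) = 4 * c\<^sup>2 / (t\<^sup>2 * b)"
  proof -
    have "s ^ CARD('n) = s powr ?n" using s by (simp add: powr_realpow)
    also have "\<dots> = (4 * c\<^sup>2 / (t\<^sup>2 * b)) powr 1" unfolding s_def powr_powr by simp
    also have "\<dots> = 4 * c\<^sup>2 / (t\<^sup>2 * b)" using t b by simp
    finally show ?thesis .
  qed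
  then have "measure lborel (ball (0::real^'n) s) = 4 * c\<^sup>2 / t\<^sup>2"
    using content_ball_conv_unit_ball[of s "0::real^'n"] s b by (simp add: b_def)
  also have "\<dots> = (2 * c / t)\<^sup>2" by (simp add: power_divide)
  finally have "sqrt (measure lborel (ball (0::real^'n) s)) = 2 * c / t"
    using c t by simp
  then have A: "norm (ball_average s u x) \<le> t / 2" for x
    using ball_average_bound[OF u s, of x] uc c by simp
  let ?d = "\<lambda>x. u x - ball_average s u x"
  have d: "sq_int ?d" "l2norm ?d \<le> 2 * ?n * s * l2norm g"
    by (rule ball_average_close[OF ug s])+
  \<comment> \<open>Chebyshev's inequality: where |u| exceeds t, it differs from its average by at
    least t / 2.\<close>
  have "ennreal (t\<^sup>2 / 4) * emeasure lborel {x. norm (u x) > t} = (\<integral>\<^sup>+x. ennreal (t\<^sup>2 / 4) * indicator {x. norm (u x) > t} x \<partial>lborel)"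
    by (simp add: nn_integral_cmult_indicator)
  also have "\<dots> \<le> (\<integral>\<^sup>+x. ennreal ((norm (?d x))\<^sup>2) \<partial>lborel)"
  proof (rule nn_integral_mono)
    fix x
    show "ennreal (t\<^sup>2 / 4) * indicator {x. norm (u x) > t} x \<le> ennreal ((norm (?d x))\<^sup>2)"
    proof (cases "norm (u x) > t")
      case True
      have "norm (?d x) \<ge> t / 2" using A[of x] True norm_triangle_ineq2[of "u x" "ball_average s u x"] by linarith
      then have "(t / 2)\<^sup>2 \<le> (norm (?d x))\<^sup>2" using t by (intro power_mono) auto
      then show ?thesis using True by (simp add: power_divide ennreal_leI)
    qed simp
  qed
  also have "\<dots> = ennreal ((l2norm ?d)\<^sup>2)"
    unfolding l2norm_sq using sq_int_integrable[OF d(1)] by (simp add: nn_integral_eq_integral)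
  also have "\<dots> \<le> ennreal ((2 * ?n * s * l2norm g)\<^sup>2)"
    using d(2) by (intro ennreal_leI power_mono) auto
  finally have *: "ennreal (t\<^sup>2 / 4) * emeasure lborel {x. norm (u x) > t} \<le> ennreal ((2 * ?n * s * l2norm g)\<^sup>2)" .
  have "emeasure lborel {x. norm (u x) > t} = ennreal (4 / t\<^sup>2) * (ennreal (t\<^sup>2 / 4) * emeasure lborel {x. norm (u x) > t})"
    using t by (simp flip: mult.assoc ennreal_mult)
  also have "\<dots> \<le> ennreal (4 / t\<^sup>2) * ennreal ((2 * ?n * s * l2norm g)\<^sup>2)"
    by (intro mult_left_mono *) simp
  also have "\<dots> = ennreal (4 / t\<^sup>2 * (2 * ?n * s * l2norm g)\<^sup>2)"
    by (rule ennreal_mult[symmetric]) auto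
  also have "4 / t\<^sup>2 * (2 * ?n * s * l2norm g)\<^sup>2 = level_const c TYPE('n) * t powr (- 2 - 4 / ?n) * (l2norm g)\<^sup>2"
  proof -
    have "s\<^sup>2 = s powr 2" using s by (simp add: powr_numeral)
    also have "\<dots> = (4 * c\<^sup>2 / (t\<^sup>2 * b)) powr (2 / ?n)" unfolding s_def powr_powr by simp
    also have "4 * c\<^sup>2 / (t\<^sup>2 * b) = (4 * c\<^sup>2 / b) * (t powr (- 2))"
      using t by (simp add: powr_minus powr_numeral divide_simps)
    also have "\<dots> powr (2 / ?n) = (4 * c\<^sup>2 / b) powr (2 / ?n) * t powr (- 4 / ?n)"
      by (subst powr_mult) (use b t in \<open>simp_all add: powr_powr\<close>)
    finally have s2: "s\<^sup>2 = (4 * c\<^sup>2 / b) powr (2 / ?n) * t powr (- 4 / ?n)" .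
    have "t powr (- 2 - 4 / ?n) = t powr (- 2) * t powr (- 4 / ?n)"
      by (simp flip: powr_add)
    moreover have "t powr (- 2) = 1 / t\<^sup>2"
      using t by (simp add: powr_minus powr_numeral divide_simps)
    ultimately show ?thesis
      unfolding level_const_def b_def[symmetric] by (simp add: power_mult_distrib s2)
  qed
  finally show ?thesis .
qed

text \<open>Dyadic layers above \<Lambda>: on the i-th one |u|^q is at most (2 * 2^i \<Lambda>)^q,
  and the level set estimate makes the sum geometric with ratio 2^(-\<delta>). Positivity of
  \<delta> is the subcriticality of q.\<close>

lemma tail_integral_le:
  fixes u :: "real^'n::finite \<Rightarrow> complex"
  assumes ug: "weak_gradient u g" and uc: "l2norm u = c" and c: "c > 0" and \<Lambda>: "\<Lambda> > 0"
    and q: "q \<ge> 0" and \<delta>: "\<delta> = 2 + 4 / real CARD('n) - q" "\<delta> > 0"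
  shows "(\<integral>\<^sup>+x. indicator {x. norm (u x) > \<Lambda>} x * ennreal (norm (u x) powr q) \<partial>lborel)
    \<le> ennreal (2 powr q * level_const c TYPE('n) * \<Lambda> powr (- \<delta>) / (1 - 2 powr (- \<delta>)) * (l2norm g)\<^sup>2)"
proof -
  let ?K = "level_const c TYPE('n)"
  have u: "sq_int u" using ug weak_gradient_sq_int by blast
  then have [measurable]: "u \<in> borel_measurable borel" by (simp add: sq_int_def)
  define l where "l i = 2 ^ i * \<Lambda>" for i :: nat
  have l: "l i > 0" for i using \<Lambda> by (simp add: l_def)
  have pt: "indicator {x. norm (u x) > \<Lambda>} x * ennreal (norm (u x) powr q)
      \<le> (\<Sum>i. ennreal ((2 * l i) powr q) * indicator {x. norm (u x) > l i} x)" for x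
  proof (cases "norm (u x) > \<Lambda>")
    case True
    have ex: "\<exists>i. norm (u x) \<le> l (Suc i)"
    proof -
      obtain i where "norm (u x) / \<Lambda> < 2 ^ i" using real_arch_pow[of 2 "norm (u x) / \<Lambda>"] by auto
      then have "norm (u x) < l i" using \<Lambda> by (simp add: l_def field_simps)
      moreover have "l i \<le> l (Suc i)" using \<Lambda> by (simp add: l_def)
      ultimately show ?thesis by (intro exI[of _ i]) linarith
    qed
    \<comment> \<open>The layer containing |u(x)|; minimality gives the strict lower bound l i, and
      for i = 0 this bound is \<Lambda> itself.\<close>
    define i where "i = (LEAST i. norm (u x) \<le> l (Suc i))"
    have i: "norm (u x) \<le> l (Suc i)" unfolding i_def by (rule LeastI_ex[OF ex])
    have li: "norm (u x) > l i"
    proof (cases i)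
      case 0 then show ?thesis using True by (simp add: l_def)
    next
      case (Suc k)
      then have "\<not> norm (u x) \<le> l (Suc k)" using not_less_Least[of k "\<lambda>i. norm (u x) \<le> l (Suc i)"] by (simp add: i_def)
      then show ?thesis using Suc by simp
    qed
    have "norm (u x) powr q \<le> (2 * l i) powr q"
      using i q by (intro powr_mono2) (auto simp: l_def mult.assoc)
    then have "indicator {x. norm (u x) > \<Lambda>} x * ennreal (norm (u x) powr q) \<le> ennreal ((2 * l i) powr q) * indicator {x. norm (u x) > l i} x"
      using True li by (simp add: ennreal_leI)
    also have "\<dots> \<le> (\<Sum>i. ennreal ((2 * l i) powr q) * indicator {x. norm (u x) > l i} x)"
    proof -
      define F where "F k = ennreal ((2 * l k) powr q) * indicator {x. norm (u x) > l k} x" for k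
      have "sum F {i} \<le> suminf F" by (rule sum_le_suminf) auto
      then have "F i \<le> suminf F" by simp
      then show ?thesis unfolding F_def[abs_def] .
    qed
    finally show ?thesis .
  qed simp
  have "(\<integral>\<^sup>+x. indicator {x. norm (u x) > \<Lambda>} x * ennreal (norm (u x) powr q) \<partial>lborel)
      \<le> (\<integral>\<^sup>+x. (\<Sum>i. ennreal ((2 * l i) powr q) * indicator {x. norm (u x) > l i} x) \<partial>lborel)"
    by (intro nn_integral_mono pt)
  also have "\<dots> = (\<Sum>i. \<integral>\<^sup>+x. ennreal ((2 * l i) powr q) * indicator {x. norm (u x) > l i} x \<partial>lborel)"
    by (intro nn_integral_suminf) measurable
  also have "\<dots> = (\<Sum>i. ennreal ((2 * l i) powr q) * emeasure lborel {x. norm (u x) > l i})"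
    by (simp add: nn_integral_cmult_indicator)
  also have "\<dots> \<le> (\<Sum>i. ennreal (2 powr q * ?K * (l2norm g)\<^sup>2 * \<Lambda> powr (- \<delta>) * (2 powr (- \<delta>)) ^ i))"
  proof (intro suminf_le allI)
    fix i
    have "ennreal ((2 * l i) powr q) * emeasure lborel {x. norm (u x) > l i}
      \<le> ennreal ((2 * l i) powr q) * ennreal (?K * l i powr (- 2 - 4 / real CARD('n)) * (l2norm g)\<^sup>2)"
      by (intro mult_left_mono emeasure_level_set_le[OF ug uc c l]) simp
    also have "\<dots> = ennreal ((2 * l i) powr q * (?K * l i powr (- 2 - 4 / real CARD('n)) * (l2norm g)\<^sup>2))"
      by (simp add: ennreal_mult level_const_nonneg)
    also have "(2 * l i) powr q * (?K * l i powr (- 2 - 4 / real CARD('n)) * (l2norm g)\<^sup>2)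
      = 2 powr q * ?K * (l2norm g)\<^sup>2 * (l i powr q * l i powr (- 2 - 4 / real CARD('n)))"
      using l[of i] by (simp add: powr_mult)
    also have "l i powr q * l i powr (- 2 - 4 / real CARD('n)) = l i powr (- \<delta>)"
      unfolding \<delta>(1) powr_add[symmetric] by (rule arg_cong[of _ _ "(powr) (l i)"]) simp
    also have "l i powr (- \<delta>) = \<Lambda> powr (- \<delta>) * (2 powr (- \<delta>)) ^ i"
      using \<Lambda> by (simp add: l_def powr_mult powr_realpow[symmetric] powr_powr mult.commute)
    finally show "ennreal ((2 * l i) powr q) * emeasure lborel {x. norm (u x) > l i}
      \<le> ennreal (2 powr q * ?K * (l2norm g)\<^sup>2 * \<Lambda> powr (- \<delta>) * (2 powr (- \<delta>)) ^ i)"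
      by (simp add: mult.assoc)
  qed auto
  also have "\<dots> = ennreal (2 powr q * ?K * (l2norm g)\<^sup>2 * \<Lambda> powr (- \<delta>) * (1 / (1 - 2 powr (- \<delta>))))"
  proof (rule suminf_ennreal_eq)
    have "2 powr (- \<delta>) < (1::real)" using \<delta>(2) by (simp add: powr_less_one)
    then show "(\<lambda>i. 2 powr q * ?K * (l2norm g)\<^sup>2 * \<Lambda> powr (- \<delta>) * (2 powr (- \<delta>)) ^ i)
      sums (2 powr q * ?K * (l2norm g)\<^sup>2 * \<Lambda> powr (- \<delta>) * (1 / (1 - 2 powr (- \<delta>))))"
      by (intro sums_mult geometric_sums) simp
  qed (simp add: level_const_nonneg)
  finally show ?thesis by (simp add: mult_ac)
qed

text \<open>Square roots reduce this to \<open>l2_fatou\<close>. The bounds may vary with i, because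
  in use they are built from convergent energies.\<close>

lemma fatou_real:
  fixes f :: "nat \<Rightarrow> 'a::euclidean_space \<Rightarrow> real"
  assumes f: "\<And>i. integrable lborel (f i)" "\<And>i x. f i x \<ge> 0" and h: "h \<in> borel_measurable borel" "\<And>x. h x \<ge> 0"
    and lim: "AE x in lborel. (\<lambda>i. f i x) \<longlonglongrightarrow> h x"
    and bd: "\<And>i. (LINT x|lborel. f i x) \<le> \<beta> i" "\<beta> \<longlonglongrightarrow> \<beta>'"
  shows "integrable lborel h" "(LINT x|lborel. h x) \<le> \<beta>'"
proof -
  have eq: "(norm (sqrt (f i x)))\<^sup>2 = f i x" "(norm (sqrt (h x)))\<^sup>2 = h x" for i x
    using f(2) h(2) by simp_all
  have fs: "sq_int (\<lambda>x. sqrt (f i x))" for i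
    unfolding sq_int_def eq using f(1)[of i] by auto
  have b0: "0 \<le> \<beta> i" for i 
    by (rule order_trans[OF Bochner_Integration.integral_nonneg bd(1)]) (rule f(2))
  have hm: "(\<lambda>x. sqrt (h x)) \<in> borel_measurable borel" using h(1) by measurable
  have ae: "AE x in lborel. (\<lambda>i. sqrt (f i x)) \<longlonglongrightarrow> sqrt (h x)"
    using lim by eventually_elim (intro tendsto_real_sqrt)
  have key: "sq_int (\<lambda>x. sqrt (h x)) \<and> l2norm (\<lambda>x. sqrt (h x)) \<le> sqrt (\<beta>' + e)" if e: "e > 0" for e
  proof -
    have "\<forall>\<^sub>F i in sequentially. l2norm (\<lambda>x. sqrt (f i x)) \<le> sqrt (\<beta>' + e)"
      using order_tendstoD(2)[OF bd(2), of "\<beta>' + e"] e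
      by (auto elim!: eventually_mono simp: l2norm_def f(2) intro: order_trans[OF bd(1)])
    from l2_fatou[OF fs hm ae this] show ?thesis by blast
  qed
  have sq: "sq_int (\<lambda>x. sqrt (h x))" using key[of 1] by simp
  then show "integrable lborel h" by (simp add: sq_int_def eq del: real_norm_def)
  have b'0: "\<beta>' \<ge> 0" using bd(2) b0 by (intro LIMSEQ_le_const) auto
  show "(LINT x|lborel. h x) \<le> \<beta>'"
  proof (rule field_le_epsilon)
    fix e :: real assume e: "e > 0"
    have "(l2norm (\<lambda>x. sqrt (h x)))\<^sup>2 \<le> (sqrt (\<beta>' + e))\<^sup>2" using key[OF e] by (intro power_mono) auto
    then show "(LINT x|lborel. h x) \<le> \<beta>' + e" using b'0 e by (simp add: l2norm_sq eq del: real_norm_def)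
  qed
qed

section \<open>Test functions in the energy space, and the mass sphere\<close>

lemma test_function_Sigma_pair:
  assumes \<psi>: "test_function (\<psi> :: real^'n::finite \<Rightarrow> real)"
  shows "\<exists>g. Sigma_pair (\<lambda>x. complex_of_real (\<psi> x)) g"
proof -
  have sq: "sq_int (\<lambda>x. complex_of_real (\<phi> x))" if "test_function \<phi>" for \<phi> :: "real^'n \<Rightarrow> real"
    using test_function_sq_int[OF that] by (auto simp: sq_int_def)
  obtain R where R: "R > 0" "\<And>x. norm x > R \<Longrightarrow> \<psi> x = 0" using test_function_supportE[OF \<psi>] by blast
  have "sq_int (\<lambda>x. norm x *\<^sub>R complex_of_real (\<psi> x))"
  proof (rule sq_int_bound[OF sq[OF \<psi>]])
    show "AE x in lborel. norm (norm x *\<^sub>R complex_of_real (\<psi> x)) \<le> R * norm (complex_of_real (\<psi> x))"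
    proof (rule AE_I2)
      fix x show "norm (norm x *\<^sub>R complex_of_real (\<psi> x)) \<le> R * norm (complex_of_real (\<psi> x))"
        using R(2)[of x] by (cases "norm x \<le> R") (auto intro: mult_right_mono)
    qed
    show "(\<lambda>x. norm x *\<^sub>R complex_of_real (\<psi> x)) \<in> borel_measurable borel"
      using test_function_borel[OF \<psi>] by measurable
  qed
  then have "(\<lambda>x. complex_of_real (\<psi> x)) \<in> Sigma_space"
    using sq[OF \<psi>] sq[OF test_function_partial_deriv[OF \<psi>]] test_function_has_weak_partial[OF \<psi>]
    by (auto simp: Sigma_space_def H1_def square_integrable_iff scaleR_conv_of_real)
  then show ?thesis by (simp add: Sigma_space_iff)
qed

lemma Sigma_pair_scaleR:
  assumes "Sigma_pair u g"
  shows "Sigma_pair (\<lambda>x. c *\<^sub>R u x) (\<lambda>x. c *\<^sub>R g x)"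
proof -
  have "sq_int (\<lambda>x. c *\<^sub>R (norm x *\<^sub>R u x))" using assms by (intro sq_int_scaleR Sigma_pairD)
  then have "sq_int (\<lambda>x. norm x *\<^sub>R (c *\<^sub>R u x))" by (simp only: scaleR_left_commute)
  moreover have "has_weak_partial j (\<lambda>x. c *\<^sub>R u x) (\<lambda>x. (c *\<^sub>R g x) $ j)" for j
    using has_weak_partial_scaleR[OF Sigma_pairD(4)[OF assms]] by simp
  ultimately show ?thesis
    using assms by (auto simp: Sigma_pair_def weak_gradient_def intro!: sq_int_scaleR)
qed

lemma mass_sphere_iff:
  assumes "c > 0"
  shows "u \<in> mass_sphere c \<longleftrightarrow> (\<exists>g. Sigma_pair u g) \<and> l2norm u = c"
proof -
  have "(LINT x|lborel. (cmod (u x))\<^sup>2) = c\<^sup>2 \<longleftrightarrow> l2norm u = c"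
    using assms power2_eq_iff_nonneg[of "l2norm u" c] by (simp flip: l2norm_sq)
  then show ?thesis by (auto simp: mass_sphere_def Sigma_space_iff)
qed

text \<open>A bump positive on the unit ball has positive norm and can be rescaled. The real infimum
  in the direct method is taken over a nonempty set for this reason.\<close>

lemma mass_sphere_nonempty:
  assumes c: "c > 0"
  shows "mass_sphere c \<noteq> ({} :: (real^'n::finite \<Rightarrow> complex) set)"
proof -
  let ?\<psi> = "bump 1 (\<chi> i. -1) (\<chi> i. 1) :: real^'n \<Rightarrow> real"
  let ?u = "\<lambda>x. complex_of_real (?\<psi> x)"
  have \<psi>: "test_function ?\<psi>" by (rule test_function_bump) simp
  obtain g where g: "Sigma_pair ?u g" using test_function_Sigma_pair[OF \<psi>] by blast
  have "l2norm ?u \<noteq> 0"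
  proof
    assume "l2norm ?u = 0"
    then have "(LINT x|lborel. (norm (?u x))\<^sup>2) = 0" unfolding l2norm_sq[symmetric] by simp
    then have "AE x in lborel. (norm (?u x))\<^sup>2 = 0"
      using sq_int_integrable[OF Sigma_pairD(1)[OF g]] by (subst (asm) integral_nonneg_eq_0_iff_AE) auto
    then have "AE x in lborel. x \<notin> ball (0::real^'n) 1"
    proof eventually_elim
      case (elim x)
      show ?case
      proof
        assume "x \<in> ball 0 1"
        then have "\<bar>x $ i\<bar> < 1" for i using component_le_norm_cart[of x i] by simp
        then have "x \<in> box (\<chi> i. -1) (\<chi> i. 1)" by (auto simp: mem_box_cart abs_less_iff minus_less_iff)
        then show False using bump_pos[of x "\<chi> i. -1" "\<chi> i. 1" 1] elim by simp
      qed
    qed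
    then have "emeasure lborel (ball (0::real^'n) 1) = 0"
      by (subst (asm) AE_iff_measurable[OF _ refl]) (auto simp: ball_def)
    then have "measure lborel (ball (0::real^'n) 1) = 0" by (simp add: measure_def)
    then show False using measure_ball_pos[of 1 "0::real^'n"] by simp
  qed
  then have "l2norm (\<lambda>x. (c / l2norm ?u) *\<^sub>R ?u x) = c"
    using c by (simp only: l2norm_scaleR) simp
  then have "(\<lambda>x. (c / l2norm ?u) *\<^sub>R ?u x) \<in> mass_sphere c"
    using Sigma_pair_scaleR[OF g] mass_sphere_iff[OF c] by blast
  then show ?thesis by blast
qed

section \<open>Existence of minimizers\<close>

text \<open>Up to r = L the superquadratic part is at most L^(p-1) r^2, so \<open>G\<close> lies
  below the truncation level. Beyond L >= 1 the quadratic part is dominated by r^(p+1), whence the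
  factor 2 C.\<close>

lemma le_truncation_plus_tail:
  fixes G C p L v r :: real
  assumes G: "G \<le> C * (v + v powr ((p + 1) / 2))" and C: "C > 0" and p: "p \<ge> 1" and L: "L \<ge> 1" and r: "r \<ge> 0" and v: "v = r\<^sup>2"
  shows "G \<le> min G (C * (1 + L powr (p - 1)) * v) + 2 * C * (indicator {L<..} r * r powr (p + 1))"
proof -
  have vp: "v powr ((p + 1) / 2) = r powr (p + 1)"
  proof (cases "r = 0")
    case False
    then have "v = r powr 2" using r v by (simp add: powr_numeral)
    moreover have "2 * ((p + 1) / 2) = p + 1" by simp
    ultimately show ?thesis by (simp only: powr_powr)
  qed (use v in simp)
  have le: "G \<le> C * (1 + L powr (p - 1)) * v" if "\<bar>r\<bar> \<le> L"
  proof -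
    have "r powr (p + 1) \<le> L powr (p - 1) * v"
    proof (cases "r = 0")
      case False
      have "r powr (p + 1) = r powr ((p - 1) + 2)" by (rule arg_cong[of _ _ "(powr) r"]) simp
      also have "\<dots> = r powr (p - 1) * r powr 2" by (rule powr_add)
      also have "\<dots> \<le> L powr (p - 1) * r powr 2"
        using p r that by (intro mult_right_mono powr_mono2) auto
      finally show ?thesis using False r v by (simp add: powr_numeral)
    qed (use v in simp)
    then have "C * (v + r powr (p + 1)) \<le> C * (v + L powr (p - 1) * v)"
      using C by (intro mult_left_mono add_left_mono) auto
    then show ?thesis using G vp by (simp add: algebra_simps)
  qed
  show "G \<le> min G (C * (1 + L powr (p - 1)) * v) + 2 * C * (indicator {L<..} r * r powr (p + 1))"
  proof (cases "r \<le> L")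
    case True
    then show ?thesis using le r by (simp add: min_def)
  next
    case False
    have "v = r powr 2" using False L v by (simp add: powr_numeral)
    also have "\<dots> \<le> r powr (p + 1)" using False L p by (intro powr_mono) auto
    finally have "C * (v + v powr ((p + 1) / 2)) \<le> C * (r powr (p + 1) + r powr (p + 1))"
      unfolding vp using C by (intro mult_left_mono add_right_mono) auto
    then have "G \<le> 2 * C * r powr (p + 1)" using G by simp
    moreover have "min G (C * (1 + L powr (p - 1)) * v) \<ge> min G 0"
      using C v by (intro min.mono) auto
    ultimately show ?thesis using False C by (cases "G \<ge> 0") (auto simp: min_def split: if_splits)
  qed
qed

section \<open>The energy with the nonlinear term, and the direct method\<close>

locale nonlinear_trap = rotating_trap i1 i2 \<gamma> \<Omega> for i1 i2 :: "'n::finite" and \<gamma> \<Omega> :: real +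
  fixes G :: "real^'n \<Rightarrow> real \<Rightarrow> real" and c :: real
  assumes contG: "continuous_on (UNIV \<times> {0..}) (\<lambda>(x, v). G x v)"
    and G_nonneg: "\<And>x v. v \<ge> 0 \<Longrightarrow> 0 \<le> G x v"
    and c: "c > 0"
begin

definition dens :: "(real^'n \<Rightarrow> complex) \<Rightarrow> real^'n \<Rightarrow> real" where
  "dens u x = G x ((cmod (u x))\<^sup>2)"

lemma dens_nonneg: "0 \<le> dens u x"
  unfolding dens_def by (intro G_nonneg) simp

lemma dens_measurable:
  assumes [measurable]: "u \<in> borel_measurable borel"
  shows "dens u \<in> borel_measurable borel"
proof -
  \<comment> \<open>Clamping the second argument extends \<open>G\<close> continuously to the whole
    space; squared moduli are unaffected.\<close>
  let ?G = "\<lambda>z::(real^'n) \<times> real. G (fst z) (max 0 (snd z))"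
  have "continuous_on UNIV ?G"
  proof -
    have "continuous_on UNIV (\<lambda>z. (\<lambda>(x, v). G x v) (fst z, max 0 (snd z)))"
      by (rule continuous_on_compose2[OF contG]) (auto intro!: continuous_intros)
    then show ?thesis by simp
  qed
  then have "?G \<in> borel_measurable borel" by (rule borel_measurable_continuous_onI)
  moreover have "(\<lambda>x. (x, (cmod (u x))\<^sup>2)) \<in> borel_measurable borel"
    by (intro borel_measurable_Pair) measurable
  ultimately have "(\<lambda>x. ?G (x, (cmod (u x))\<^sup>2)) \<in> borel_measurable borel"
    using measurable_compose by blast
  then show ?thesis by (simp add: dens_def[abs_def])
qed

lemma dens_tendsto:
  assumes "(\<lambda>k. u k x) \<longlonglongrightarrow> v x"
  shows "(\<lambda>k. dens (u k) x) \<longlonglongrightarrow> dens v x"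
proof -
  have "continuous_on {0..} (\<lambda>t. (\<lambda>(x, v). G x v) (x, t))"
    by (rule continuous_on_compose2[OF contG]) (auto intro!: continuous_intros)
  then have "continuous_on {0..} (G x)" by simp
  then have "(\<lambda>k. G x ((cmod (u k x))\<^sup>2)) \<longlonglongrightarrow> G x ((cmod (v x))\<^sup>2)"
    by (rule continuous_on_tendsto_compose) (auto intro!: tendsto_intros assms)
  then show ?thesis by (simp add: dens_def)
qed

definition quad :: "(real^'n \<Rightarrow> complex) \<Rightarrow> (real^'n \<Rightarrow> complex^'n) \<Rightarrow> real" where
  "quad u g = l2norm (\<lambda>x. energy_root x (u x, g x))"

text \<open>Almost everywhere the integrand has real part |T|^2 / 2 - \<kappa> G and imaginary part
  - Im Z, where |T|^2 and Im Z are always integrable. Integrability of the integrand is thus decided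
  by the density alone, and a Bochner integral of a nonintegrable function is 0.\<close>

lemma energy_cases:
  assumes p: "Sigma_pair u g"
  shows "integrable lborel (dens u) \<Longrightarrow>
      energy i1 i2 \<Omega> \<gamma> \<kappa> G u = 1/2 * (quad u g)\<^sup>2 - \<kappa> * (LINT x|lborel. dens u x)"
    and "\<not> integrable lborel (dens u) \<Longrightarrow> \<kappa> \<noteq> 0 \<Longrightarrow> energy i1 i2 \<Omega> \<gamma> \<kappa> G u = 0"
proof -
  note s = Sigma_pairD[OF p]
  have [measurable]: "u \<in> borel_measurable borel" "g \<in> borel_measurable borel"
    using s by (auto simp: sq_int_def)
  have [measurable]: "dens u \<in> borel_measurable borel" by (rule dens_measurable) measurable
  have [measurable]: "(\<lambda>x::real^'n. x $ j) \<in> borel_measurable borel" for j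
    by (intro borel_measurable_continuous_onI linear_continuous_on bounded_linear_vec_nth)
  have [measurable]: "(\<lambda>x. g x $ j) \<in> borel_measurable borel" for j
    by (rule borel_measurable_vec_nth) measurable
  have [measurable]: "weak_partial j u \<in> borel_measurable borel" for j
    using weak_partial_AE(1)[OF s(4)] by (auto simp: has_weak_partial_def locally_integrable_def)
  let ?T = "\<lambda>x. energy_root x (u x, g x)"
  have Tsq: "sq_int ?T" by (rule energy_root_sq_int[OF p])
  define F where "F x = complex_of_real (1/2 * grad_norm_sq u x + \<gamma>\<^sup>2 / 2 * (norm x)\<^sup>2 * (cmod (u x))\<^sup>2 - \<kappa> * dens u x)
      - complex_of_real \<Omega> * cnj (u x) * L_z i1 i2 u x" for x
  have E: "energy i1 i2 \<Omega> \<gamma> \<kappa> G u = Re (LINT x|lborel. F x)"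
    by (simp add: energy_def F_def dens_def)
  have cu [measurable]: "(\<lambda>x. cnj (u x)) \<in> borel_measurable borel"
    by (rule measurable_compose[OF _ borel_measurable_continuous_onI[where f=cnj]]) (auto intro: continuous_intros)
  have wj: "(\<lambda>x. complex_of_real (x $ i) * weak_partial j u x) \<in> borel_measurable borel" for i j
    by (intro borel_measurable_times) measurable
  have "L_z i1 i2 u \<in> borel_measurable borel"
    unfolding L_z_def[abs_def] by (intro borel_measurable_times borel_measurable_diff borel_measurable_const wj)
  then have Lm: "(\<lambda>x. complex_of_real \<Omega> * cnj (u x) * L_z i1 i2 u x) \<in> borel_measurable borel"
    by (intro borel_measurable_times borel_measurable_const cu)
  have [measurable]: "grad_norm_sq u \<in> borel_measurable borel"
    unfolding grad_norm_sq_def[abs_def] by measurable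
  have Fm [measurable]: "F \<in> borel_measurable borel"
    unfolding F_def[abs_def] by (intro borel_measurable_diff Lm) measurable
  define Z where "Z x = complex_of_real \<Omega> * cnj (u x) * (\<i> * (of_real (x $ i2) * g x $ i1 - of_real (x $ i1) * g x $ i2))" for x
  have gj: "(\<lambda>x. complex_of_real (x $ i) * g x $ j) \<in> borel_measurable borel" for i j
    by (intro borel_measurable_times borel_measurable_vec_nth) measurable
  have Zm [measurable]: "Z \<in> borel_measurable borel"
    unfolding Z_def[abs_def] by (intro borel_measurable_times borel_measurable_diff borel_measurable_const cu gj)
  \<comment> \<open>The imaginary part is kept although only the real part of the integral counts,
    because integrability of a complex function involves both.\<close>
  define F' where "F' x = complex_of_real (1/2 * (norm (?T x))\<^sup>2 - \<kappa> * dens u x) - \<i> * complex_of_real (Im (Z x))" for x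
  have Tm [measurable]: "?T \<in> borel_measurable borel" using Tsq by (simp add: sq_int_def)
  have F'm [measurable]: "F' \<in> borel_measurable borel" unfolding F'_def[abs_def] by measurable
  have "AE x in lborel. \<forall>j\<in>UNIV. weak_partial j u x = g x $ j"
    by (intro AE_finite_allI weak_partial_AE(2)[OF s(4)]) simp
  then have ae: "AE x in lborel. F x = F' x"
  proof eventually_elim
    case (elim x)
    have "grad_norm_sq u x = (norm (g x))\<^sup>2"
      unfolding grad_norm_sq_def power2_norm_eq_inner inner_vec_def using elim by (simp add: power2_norm_eq_inner)
    moreover have "complex_of_real \<Omega> * cnj (u x) * L_z i1 i2 u x = Z x"
      using elim by (simp add: L_z_def Z_def)
    ultimately have Fx: "F x = complex_of_real (1/2 * (norm (g x))\<^sup>2 + \<gamma>\<^sup>2 / 2 * (norm x)\<^sup>2 * (cmod (u x))\<^sup>2 - \<kappa> * dens u x) - Z x"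
      by (simp add: F_def)
    have "(norm (?T x))\<^sup>2 = (norm (g x))\<^sup>2 + \<gamma>\<^sup>2 * (norm x)\<^sup>2 * (norm (u x))\<^sup>2 - 2 * Re (Z x)"
      unfolding Z_def by (rule norm_energy_root_sq)
    then show ?case unfolding Fx F'_def by (simp add: complex_eq_iff)
  qed
  have E': "energy i1 i2 \<Omega> \<gamma> \<kappa> G u = Re (LINT x|lborel. F' x)"
    unfolding E by (intro arg_cong[of _ _ Re] integral_cong_AE ae) measurable
  have Ti: "integrable lborel (\<lambda>x. 1/2 * (norm (?T x))\<^sup>2)"
    by (intro integrable_mult_right sq_int_integrable Tsq)
  have Zi: "integrable lborel (\<lambda>x. Im (Z x))"
  proof (rule Bochner_Integration.integrable_bound)
    show "integrable lborel (\<lambda>x. (2 * \<bar>\<Omega>\<bar>) * (norm (norm x *\<^sub>R u x) * norm (g x)))"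
      by (intro integrable_mult_right l2_Cauchy_Schwarz s)
    show "AE x in lborel. norm (Im (Z x)) \<le> norm ((2 * \<bar>\<Omega>\<bar>) * (norm (norm x *\<^sub>R u x) * norm (g x)))"
    proof (rule AE_I2)
      fix x
      have c: "norm (complex_of_real (x $ i) * g x $ j) \<le> norm x * norm (g x)" for i j
        by (simp add: norm_mult mult_mono component_le_norm_cart Finite_Cartesian_Product.norm_nth_le)
      have "norm (Im (Z x)) \<le> norm (Z x)" by (simp add: abs_Im_le_cmod)
      also have "\<dots> = \<bar>\<Omega>\<bar> * norm (u x) * norm (of_real (x $ i2) * g x $ i1 - of_real (x $ i1) * g x $ i2)"
        by (simp add: Z_def norm_mult)
      also have "\<dots> \<le> \<bar>\<Omega>\<bar> * norm (u x) * (norm x * norm (g x) + norm x * norm (g x))"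
        by (intro mult_left_mono norm_triangle_le_diff add_mono c) auto
      also have "\<dots> = norm ((2 * \<bar>\<Omega>\<bar>) * (norm (norm x *\<^sub>R u x) * norm (g x)))"
        by (simp add: abs_mult)
      finally show "norm (Im (Z x)) \<le> norm ((2 * \<bar>\<Omega>\<bar>) * (norm (norm x *\<^sub>R u x) * norm (g x)))" .
    qed
  qed measurable
  show "energy i1 i2 \<Omega> \<gamma> \<kappa> G u = 1/2 * (quad u g)\<^sup>2 - \<kappa> * (LINT x|lborel. dens u x)"
    if i: "integrable lborel (dens u)"
  proof -
    have "integrable lborel F'"
      unfolding F'_def[abs_def]
      by (intro Bochner_Integration.integrable_diff integrable_of_real integrable_mult_right Ti i Zi sq_int_integrable Tsq)
    then have "energy i1 i2 \<Omega> \<gamma> \<kappa> G u = (LINT x|lborel. Re (F' x))"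
      unfolding E' by (rule integral_Re[symmetric])
    also have "\<dots> = (LINT x|lborel. 1/2 * (norm (?T x))\<^sup>2 - \<kappa> * dens u x)"
      by (simp add: F'_def)
    also have "\<dots> = (LINT x|lborel. 1/2 * (norm (?T x))\<^sup>2) - (LINT x|lborel. \<kappa> * dens u x)"
      by (intro Bochner_Integration.integral_diff Ti integrable_mult_right i)
    finally show ?thesis by (simp only: quad_def l2norm_sq integral_mult_right_zero)
  qed
  show "energy i1 i2 \<Omega> \<gamma> \<kappa> G u = 0" if ni: "\<not> integrable lborel (dens u)" and \<kappa>: "\<kappa> \<noteq> 0"
  proof -
    have "\<not> integrable lborel F'"
    proof
      assume "integrable lborel F'"
      then have "integrable lborel (\<lambda>x. Re (F' x))" by (rule integrable_Re)
      then have "integrable lborel (\<lambda>x. 1/2 * (norm (?T x))\<^sup>2 - \<kappa> * dens u x)" by (simp add: F'_def)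
      from Bochner_Integration.integrable_diff[OF Ti this]
      have "integrable lborel (\<lambda>x. \<kappa> * dens u x)" by simp
      then show False using ni \<kappa> by simp
    qed
    then show ?thesis unfolding E' by (simp add: not_integrable_integral_eq)
  qed
qed

lemma l2norm_gradient_le_quad: "Sigma_pair u g \<Longrightarrow> l2norm g \<le> grad_const * quad u g"
  unfolding quad_def by (rule l2norm_gradient_le)

text \<open>The part of the direct method common to both signs, for any functional with quadratic
  coercivity on the sphere. The convergence of \<open>quad\<close> to \<open>q\<close> and the
  gradient bound \<open>B\<close> are exported for the nonlinear term.\<close>

lemma minimizing_sequence:
  assumes a: "a > 0"
    and coer: "\<And>u g. Sigma_pair u g \<Longrightarrow> l2norm u = c \<Longrightarrow> a * (quad u g)\<^sup>2 - b \<le> E u"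
  obtains I u g B v q h where "\<forall>w\<in>mass_sphere c. I \<le> E w"
    "\<forall>k::nat. Sigma_pair (u k) (g k) \<and> l2norm (u k) = c \<and> l2norm (g k) \<le> B"
    "(\<lambda>k. E (u k)) \<longlonglongrightarrow> I" "AE x in lborel. (\<lambda>k. u k x) \<longlonglongrightarrow> v x"
    "(\<lambda>k. quad (u k) (g k)) \<longlonglongrightarrow> q" "Sigma_pair v h" "l2norm v = c" "quad v h \<le> q"
proof -
  let ?M = "mass_sphere c :: (real^'n \<Rightarrow> complex) set"
  define I where "I = Inf (E ` ?M)"
  have lower: "- b \<le> E w" if w: "w \<in> ?M" for w
  proof -
    obtain g where "Sigma_pair w g" "l2norm w = c" using w mass_sphere_iff[OF c] by blast
    from coer[OF this] show ?thesis using a by (smt (verit) mult_nonneg_nonneg zero_le_power2)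
  qed
  have bb: "bdd_below (E ` ?M)" using lower by (intro bdd_belowI2[of _ "- b"])
  have IE: "I \<le> E w" if "w \<in> ?M" for w
    unfolding I_def using bb that by (intro cINF_lower)
  have "\<exists>u g. Sigma_pair u g \<and> l2norm u = c \<and> E u < I + 1 / real (Suc k)" for k
  proof -
    have "I < I + 1 / real (Suc k)" by simp
    then obtain u where "u \<in> ?M" "E u < I + 1 / real (Suc k)"
      unfolding I_def using cINF_less_iff[OF mass_sphere_nonempty[OF c] bb] by blast
    then show ?thesis using mass_sphere_iff[OF c] by blast
  qed
  then obtain u g where ug: "\<And>k. Sigma_pair (u k) (g k)" "\<And>k. l2norm (u k) = c" "\<And>k. E (u k) < I + 1 / real (Suc k)"
    by metis
  have uM: "u k \<in> ?M" for k using ug mass_sphere_iff[OF c] by blast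
  have EI: "(\<lambda>k. E (u k)) \<longlonglongrightarrow> I"
  proof (rule tendsto_sandwich)
    show "\<forall>\<^sub>F k in sequentially. I \<le> E (u k)" using IE[OF uM] by simp
    show "\<forall>\<^sub>F k in sequentially. E (u k) \<le> I + 1 / real (Suc k)" using ug(3) by (simp add: less_imp_le)
    have "(\<lambda>k. I + 1 / real (Suc k)) \<longlonglongrightarrow> I + 0"
      by (intro tendsto_intros LIMSEQ_inverse_real_of_nat[unfolded inverse_eq_divide])
    then show "(\<lambda>k. I + 1 / real (Suc k)) \<longlonglongrightarrow> I" by simp
  qed simp
  define Q where "Q = sqrt ((I + 1 + b) / a)"
  have Q: "quad (u k) (g k) \<le> Q" for k
  proof -
    have "1 / real (Suc k) \<le> 1" by simp
    then have "a * (quad (u k) (g k))\<^sup>2 \<le> I + 1 + b" using coer[OF ug(1,2), of k] ug(3)[of k] by linarith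
    then show ?thesis unfolding Q_def using a by (intro real_le_rsqrt) (simp add: field_simps)
  qed
  have quad0: "0 \<le> quad w k" for w k by (simp add: quad_def)
  have Q0: "Q \<ge> 0" using Q[of 0] quad0 order_trans by blast
  have gB: "l2norm (g k) \<le> grad_const * Q" for k
    by (rule order_trans[OF l2norm_gradient_le_quad[OF ug(1)]]) (use Q grad_const_pos in \<open>auto intro: mult_left_mono\<close>)
  have xB: "l2norm (\<lambda>x. norm x *\<^sub>R u k x) \<le> (1 / gap) * Q" for k
    by (rule order_trans[OF l2norm_gradient_le(2)[OF ug(1)]])
      (use Q gap_pos in \<open>auto intro!: mult_left_mono divide_right_mono simp: quad_def\<close>)
  define M where "M = max c (max (grad_const * Q) ((1 / gap) * Q))"
  have M: "l2norm (u k) \<le> M" "l2norm (g k) \<le> M" "l2norm (\<lambda>x. norm x *\<^sub>R u k x) \<le> M" for k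
    unfolding M_def using ug(2)[of k] gB[of k] xB[of k] by (auto simp: le_max_iff_disj)
  obtain r1 v where r1: "strict_mono r1" and v: "sq_int v" "(\<lambda>k. l2norm (\<lambda>x. u (r1 k) x - v x)) \<longlonglongrightarrow> 0"
    using rellich[of u g M, OF Sigma_pairD(5)[OF ug(1)] Sigma_pairD(3)[OF ug(1)] M] by blast
  obtain r2 where r2: "strict_mono r2" and ae: "AE x in lborel. (\<lambda>k. u (r1 (r2 k)) x) \<longlonglongrightarrow> v x"
    using l2_AE_subseq[of "\<lambda>k. u (r1 k)" v, OF Sigma_pairD(1)[OF ug(1)] v] by blast
  \<comment> \<open>A third extraction makes the quadratic part converge; as the energies converge
    too, so will the integrals of the density.\<close>
  have "bounded (range (\<lambda>k. quad (u (r1 (r2 k))) (g (r1 (r2 k)))))"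
    using Q quad0 by (intro boundedI[of _ Q]) auto
  then obtain q r3 where r3: "strict_mono r3" and q: "((\<lambda>k. quad (u (r1 (r2 k))) (g (r1 (r2 k)))) \<circ> r3) \<longlonglongrightarrow> q"
    using bounded_imp_convergent_subsequence by blast
  define r where "r k = r1 (r2 (r3 k))" for k
  have r: "strict_mono r" unfolding r_def[abs_def] using r1 r2 r3 by (auto simp: strict_mono_def)
  have lim: "(\<lambda>k. l2norm (\<lambda>x. u (r k) x - v x)) \<longlonglongrightarrow> 0"
    using LIMSEQ_subseq_LIMSEQ[OF v(2) strict_mono_o[OF r2 r3]] by (simp add: o_def r_def)
  have aer: "AE x in lborel. (\<lambda>k. u (r k) x) \<longlonglongrightarrow> v x"
    using ae
  proof eventually_elim
    case (elim x)
    then show ?case using LIMSEQ_subseq_LIMSEQ[OF elim r3] by (simp add: o_def r_def)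
  qed
  have qr: "(\<lambda>k. quad (u (r k)) (g (r k))) \<longlonglongrightarrow> q" using q by (simp add: o_def r_def)
  obtain h where h: "Sigma_pair v h" "quad v h \<le> q"
    using energy_root_lsc[of "\<lambda>k. u (r k)" "\<lambda>k. g (r k)" v q, OF ug(1) v(1) lim] qr unfolding quad_def by blast
  \<comment> \<open>Strong convergence keeps the limit on the sphere; no mass escapes to
    infinity.\<close>
  have vc: "l2norm v = c"
  proof -
    have "\<bar>c - l2norm v\<bar> \<le> l2norm (\<lambda>x. u (r k) x - v x)" for k
      using l2norm_triangle_le[OF Sigma_pairD(1)[OF ug(1)[of "r k"]] v(1)]
        l2norm_triangle_le[OF v(1) Sigma_pairD(1)[OF ug(1)[of "r k"]]] ug(2)[of "r k"]
        l2norm_minus_commute[of v "u (r k)"] by linarith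
    then have "\<bar>c - l2norm v\<bar> \<le> 0" using lim by (intro LIMSEQ_le_const) auto
    then show ?thesis by simp
  qed
  show ?thesis
    by (rule that[of I "\<lambda>k. u (r k)" "\<lambda>k. g (r k)" "grad_const * Q" v q h])
      (use IE ug gB LIMSEQ_subseq_LIMSEQ[OF EI r] aer qr h vc in \<open>auto simp: o_def\<close>)
qed

text \<open>Both cases of \<open>energy_cases\<close> give nonnegative energy, so the infimum is
  bounded below by 0 and a function of energy 0 is a minimizer.\<close>

lemma ex_minimizer_defocusing:
  "\<exists>v\<in>mass_sphere c. \<forall>w\<in>mass_sphere c. energy i1 i2 \<Omega> \<gamma> (-1) G v \<le> energy i1 i2 \<Omega> \<gamma> (-1) G w"
proof -
  let ?E = "energy i1 i2 \<Omega> \<gamma> (-1) G"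
  have dn: "0 \<le> (LINT x|lborel. dens u x)" for u
    by (rule Bochner_Integration.integral_nonneg) (rule dens_nonneg)
  have E0: "0 \<le> ?E w" if w: "w \<in> mass_sphere c" for w
  proof -
    obtain g where g: "Sigma_pair w g" using w mass_sphere_iff[OF c] by blast
    show ?thesis
      using energy_cases[OF g, of "-1"] dn[of w] by (cases "integrable lborel (dens w)") auto
  qed
  show ?thesis
  proof (cases "\<exists>u\<in>mass_sphere c. \<not> integrable lborel (dens u)")
    case True
    then obtain u where u: "u \<in> mass_sphere c" "\<not> integrable lborel (dens u)" by blast
    then obtain g where g: "Sigma_pair u g" using mass_sphere_iff[OF c] by blast
    have "?E u = 0" using energy_cases(2)[OF g u(2), of "-1"] by simp
    then show ?thesis using E0 u(1) by (intro bexI[of _ u]) auto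
  next
    case False
    then have int: "integrable lborel (dens u)" if "Sigma_pair u g" "l2norm u = c" for u g
      using that mass_sphere_iff[OF c] by blast
    have En: "?E u = 1/2 * (quad u g)\<^sup>2 + (LINT x|lborel. dens u x)" if "Sigma_pair u g" "l2norm u = c" for u g
      using energy_cases(1)[OF that(1) int[OF that], of "-1"] by simp
    have coer: "1/2 * (quad u g)\<^sup>2 - 0 \<le> ?E u" if "Sigma_pair u g" "l2norm u = c" for u g
      using En[OF that] dn[of u] by simp
    have half: "(1/2 :: real) > 0" by simp
    obtain I u g B v q h where IE: "\<forall>w\<in>mass_sphere c. I \<le> ?E w"
      and uB: "\<forall>k::nat. Sigma_pair (u k) (g k) \<and> l2norm (u k) = c \<and> l2norm (g k) \<le> B"
      and EI: "(\<lambda>k. ?E (u k)) \<longlonglongrightarrow> I" and ae: "AE x in lborel. (\<lambda>k. u k x) \<longlonglongrightarrow> v x"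
      and q: "(\<lambda>k. quad (u k) (g k)) \<longlonglongrightarrow> q" and v: "Sigma_pair v h" "l2norm v = c" "quad v h \<le> q"
      by (rule minimizing_sequence[of "1/2" 0 ?E, OF half coer])
    have u: "Sigma_pair (u k) (g k)" "l2norm (u k) = c" for k
      using uB by blast+
    have aeG: "AE x in lborel. (\<lambda>k. dens (u k) x) \<longlonglongrightarrow> dens v x"
      using ae by eventually_elim (rule dens_tendsto)
    \<comment> \<open>The limit of the density integrals is read off from the energies, and Fatou
      compares it with the integral for \<open>v\<close>.\<close>
    have "(\<lambda>k. ?E (u k) - 1/2 * (quad (u k) (g k))\<^sup>2) \<longlonglongrightarrow> I - 1/2 * q\<^sup>2"
      by (intro tendsto_intros EI q)
    then have J: "(\<lambda>k. LINT x|lborel. dens (u k) x) \<longlonglongrightarrow> I - 1/2 * q\<^sup>2"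
      by (simp add: En[OF u])
    have "(LINT x|lborel. dens v x) \<le> I - 1/2 * q\<^sup>2"
      by (rule fatou_real(2)[of "\<lambda>k. dens (u k)", OF int[OF u] dens_nonneg _ dens_nonneg aeG order_refl J])
        (use Sigma_pairD(1)[OF v(1)] in \<open>auto intro!: dens_measurable simp: sq_int_def\<close>)
    moreover have "(quad v h)\<^sup>2 \<le> q\<^sup>2" using v(3) by (intro power_mono) (auto simp: quad_def)
    ultimately have "?E v \<le> I" using En[OF v(1,2)] by simp
    then show ?thesis
      using v mass_sphere_iff[OF c] IE by (intro bexI[of _ v]) (force intro: order_trans)+
  qed
qed

text \<open>The hypothesis expresses that the nonlinear energy is, up to a small multiple of the
  kinetic energy, given by a density bounded by D |u|^2. One instance yields coercivity, and letting
  e tend to 0 yields convergence.\<close>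

lemma ex_minimizer_focusing:
  assumes trunc: "\<And>e. e > 0 \<Longrightarrow> \<exists>D\<ge>0. \<forall>u g. Sigma_pair u g \<longrightarrow> l2norm u = c \<longrightarrow>
      integrable lborel (dens u) \<and>
      (LINT x|lborel. dens u x) \<le> (LINT x|lborel. min (dens u x) (D * (cmod (u x))\<^sup>2)) + e * (l2norm g)\<^sup>2"
  shows "\<exists>v\<in>mass_sphere c. \<forall>w\<in>mass_sphere c. energy i1 i2 \<Omega> \<gamma> 1 G v \<le> energy i1 i2 \<Omega> \<gamma> 1 G w"
proof -
  let ?E = "energy i1 i2 \<Omega> \<gamma> 1 G"
  have int: "integrable lborel (dens u)" if "Sigma_pair u g" "l2norm u = c" for u g
    using trunc[of 1] that by auto
  have En: "?E u = 1/2 * (quad u g)\<^sup>2 - (LINT x|lborel. dens u x)" if "Sigma_pair u g" "l2norm u = c" for u g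
    using energy_cases(1)[OF that(1) int[OF that], of 1] by simp
  have mi: "integrable lborel (\<lambda>x. min (dens u x) (D * (cmod (u x))\<^sup>2))" and
    Di: "integrable lborel (\<lambda>x. D * (cmod (u x))\<^sup>2)" "(LINT x|lborel. D * (cmod (u x))\<^sup>2) = D * c\<^sup>2"
    if "Sigma_pair u g" "l2norm u = c" for u g D
  proof -
    show Di: "integrable lborel (\<lambda>x. D * (cmod (u x))\<^sup>2)"
      by (intro integrable_mult_right sq_int_integrable Sigma_pairD(1)[OF that(1)])
    show "integrable lborel (\<lambda>x. min (dens u x) (D * (cmod (u x))\<^sup>2))"
      by (intro integrable_min int[OF that] Di)
    show "(LINT x|lborel. D * (cmod (u x))\<^sup>2) = D * c\<^sup>2"
      using that(2) by (simp flip: l2norm_sq)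
  qed
  \<comment> \<open>With this choice the gradient error absorbs at most half of the available
    \<open>1/2 * (quad u g)\<^sup>2\<close>.\<close>
  define e0 where "e0 = 1 / (4 * grad_const\<^sup>2)"
  have e0: "e0 > 0" using grad_const_pos by (simp add: e0_def)
  obtain D0 where D0: "D0 \<ge> 0" "\<And>u g. Sigma_pair u g \<Longrightarrow> l2norm u = c \<Longrightarrow>
      (LINT x|lborel. dens u x) \<le> (LINT x|lborel. min (dens u x) (D0 * (cmod (u x))\<^sup>2)) + e0 * (l2norm g)\<^sup>2"
    using trunc[OF e0] by blast
  have coer: "1/4 * (quad u g)\<^sup>2 - D0 * c\<^sup>2 \<le> ?E u" if ug: "Sigma_pair u g" "l2norm u = c" for u g
  proof -
    have "(LINT x|lborel. min (dens u x) (D0 * (cmod (u x))\<^sup>2)) \<le> (LINT x|lborel. D0 * (cmod (u x))\<^sup>2)"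
      by (intro integral_mono mi[OF ug] Di[OF ug]) simp
    moreover have "e0 * (l2norm g)\<^sup>2 \<le> e0 * (grad_const * quad u g)\<^sup>2"
      using e0 l2norm_gradient_le_quad[OF ug(1)] by (intro mult_left_mono power_mono) auto
    moreover have "e0 * (grad_const * quad u g)\<^sup>2 = 1/4 * (quad u g)\<^sup>2"
      using grad_const_pos by (simp add: e0_def power_mult_distrib)
    ultimately show ?thesis using En[OF ug] D0(2)[OF ug] Di(2)[OF ug, of D0] by linarith
  qed
  have quarter: "(1/4 :: real) > 0" by simp
  obtain I u g B v q h where IE: "\<forall>w\<in>mass_sphere c. I \<le> ?E w"
    and uB: "\<forall>k::nat. Sigma_pair (u k) (g k) \<and> l2norm (u k) = c \<and> l2norm (g k) \<le> B"
    and EI: "(\<lambda>k. ?E (u k)) \<longlonglongrightarrow> I" and ae: "AE x in lborel. (\<lambda>k. u k x) \<longlonglongrightarrow> v x"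
    and q: "(\<lambda>k. quad (u k) (g k)) \<longlonglongrightarrow> q" and v: "Sigma_pair v h" "l2norm v = c" "quad v h \<le> q"
    by (rule minimizing_sequence[of "1/4" "D0 * c\<^sup>2" ?E, OF quarter coer])
  have u: "Sigma_pair (u k) (g k)" "l2norm (u k) = c" and B: "l2norm (g k) \<le> B" for k
    using uB by blast+
  define J0 where "J0 = 1/2 * q\<^sup>2 - I"
  have "(\<lambda>k. 1/2 * (quad (u k) (g k))\<^sup>2 - ?E (u k)) \<longlonglongrightarrow> J0"
    unfolding J0_def by (intro tendsto_intros EI q)
  then have J: "(\<lambda>k. LINT x|lborel. dens (u k) x) \<longlonglongrightarrow> J0"
    by (simp add: En[OF u])
  have B0: "B \<ge> 0" using B[of 0] l2norm_nonneg order_trans by blast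
  have vm [measurable]: "v \<in> borel_measurable borel" using Sigma_pairD(1)[OF v(1)] by (simp add: sq_int_def)
  have dm [measurable]: "dens v \<in> borel_measurable borel" by (rule dens_measurable[OF vm])
  have le: "J0 \<le> (LINT x|lborel. dens v x) + e * (B\<^sup>2)" if e: "e > 0" for e
  proof -
    obtain D where D: "D \<ge> 0" "\<And>u g. Sigma_pair u g \<Longrightarrow> l2norm u = c \<Longrightarrow>
        (LINT x|lborel. dens u x) \<le> (LINT x|lborel. min (dens u x) (D * (cmod (u x))\<^sup>2)) + e * (l2norm g)\<^sup>2"
      using trunc[OF e] by blast
    \<comment> \<open>Nonnegative by truncation, and the integral of its first part is D c^2 for
      every function on the sphere; Fatou for \<open>f\<close> is therefore upper semicontinuity of
      the truncated nonlinear term.\<close>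
    define f where "f w x = D * (cmod (w x))\<^sup>2 - min (dens w x) (D * (cmod (w x))\<^sup>2)" for w :: "real^'n \<Rightarrow> complex" and x
    have fi: "integrable lborel (f w)" "(LINT x|lborel. f w x) = D * c\<^sup>2 - (LINT x|lborel. min (dens w x) (D * (cmod (w x))\<^sup>2))"
      if "Sigma_pair w k" "l2norm w = c" for w k
      using Bochner_Integration.integral_diff[OF Di(1)[OF that, of D] mi[OF that, of D]]
        Bochner_Integration.integrable_diff[OF Di(1)[OF that, of D] mi[OF that, of D]] Di(2)[OF that, of D]
      unfolding f_def[abs_def] by auto
    have f0: "f w x \<ge> 0" for w x by (simp add: f_def)
    have fm: "f v \<in> borel_measurable borel" unfolding f_def[abs_def] by measurable
    have aef: "AE x in lborel. (\<lambda>k. f (u k) x) \<longlonglongrightarrow> f v x"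
      using ae unfolding f_def by eventually_elim (intro tendsto_intros dens_tendsto)
    have bd: "(LINT x|lborel. f (u k) x) \<le> D * c\<^sup>2 - (LINT x|lborel. dens (u k) x) + e * B\<^sup>2" for k
    proof -
      have "e * (l2norm (g k))\<^sup>2 \<le> e * B\<^sup>2" using e B by (intro mult_left_mono power_mono) auto
      then show ?thesis using D(2)[OF u, of k] fi(2)[OF u, of k] by linarith
    qed
    have "(LINT x|lborel. f v x) \<le> D * c\<^sup>2 - J0 + e * B\<^sup>2"
      by (rule fatou_real(2)[of "\<lambda>k. f (u k)", OF fi(1)[OF u] f0 fm f0 aef bd]) (intro tendsto_intros J)
    moreover have "(LINT x|lborel. min (dens v x) (D * (cmod (v x))\<^sup>2)) \<le> (LINT x|lborel. dens v x)"
      by (intro integral_mono mi[OF v(1,2)] int[OF v(1,2)]) simp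
    ultimately show ?thesis using fi(2)[OF v(1,2)] by linarith
  qed
  have "J0 \<le> (LINT x|lborel. dens v x)"
  proof (rule field_le_epsilon)
    fix e :: real assume e: "e > 0"
    have p: "B\<^sup>2 + 1 > 0" by (simp add: add_nonneg_pos)
    have "e / (B\<^sup>2 + 1) * B\<^sup>2 \<le> e / (B\<^sup>2 + 1) * (B\<^sup>2 + 1)" using e p by (intro mult_left_mono) auto
    also have "\<dots> = e" using p by simp
    finally show "J0 \<le> (LINT x|lborel. dens v x) + e"
      using le[of "e / (B\<^sup>2 + 1)"] e p by simp
  qed
  moreover have "(quad v h)\<^sup>2 \<le> q\<^sup>2" using v(3) by (intro power_mono) (auto simp: quad_def)
  ultimately have "?E v \<le> I" using En[OF v(1,2)] by (simp add: J0_def)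
  then show ?thesis
    using v mass_sphere_iff[OF c] IE by (intro bexI[of _ v]) (force intro: order_trans)+
qed

text \<open>Since \<delta> = 1 + 4/n - p is positive, the tail above level L carries a factor
  L^(-\<delta>), which is small for large L. The remaining constants involve only the mass, so L
  serves all functions on the sphere.\<close>

lemma truncation_estimate:
  assumes C: "C > 0" and p: "1 \<le> p" "p < 1 + 4 / real CARD('n)"
    and G: "\<And>x v. v \<ge> 0 \<Longrightarrow> G x v \<le> C * (v + v powr ((p + 1) / 2))"
    and e: "e > 0"
  shows "\<exists>D\<ge>0. \<forall>u g. Sigma_pair u g \<longrightarrow> l2norm u = c \<longrightarrow>
      integrable lborel (dens u) \<and>
      (LINT x|lborel. dens u x) \<le> (LINT x|lborel. min (dens u x) (D * (cmod (u x))\<^sup>2)) + e * (l2norm g)\<^sup>2"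
proof -
  define \<delta> where "\<delta> = 2 + 4 / real CARD('n) - (p + 1)"
  have \<delta>: "\<delta> > 0" using p by (simp add: \<delta>_def)
  define K where "K = 2 powr (p + 1) * level_const c TYPE('n) / (1 - 2 powr (- \<delta>))"
  have d1: "2 powr (- \<delta>) < (1::real)" using \<delta> by (simp add: powr_less_one)
  have K: "K \<ge> 0" unfolding K_def using d1 level_const_nonneg by (intro divide_nonneg_pos mult_nonneg_nonneg) auto
  have "((\<lambda>L. 2 * C * K * L powr (- \<delta>)) \<longlongrightarrow> 2 * C * K * 0) at_top"
    using \<delta> by (intro tendsto_intros tendsto_neg_powr filterlim_ident) auto
  then have "((\<lambda>L. 2 * C * K * L powr (- \<delta>)) \<longlongrightarrow> 0) at_top" by simp
  from order_tendstoD(2)[OF this e] have "\<forall>\<^sub>F L in at_top. 2 * C * K * L powr (- \<delta>) < e \<and> L \<ge> 1"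
    using eventually_ge_at_top[of 1] by (rule eventually_conj)
  then obtain L where L: "2 * C * K * L powr (- \<delta>) < e" "L \<ge> 1"
    using eventually_happens'[OF trivial_limit_at_top_linorder] by blast
  define D where "D = C * (1 + L powr (p - 1))"
  have D: "D \<ge> 0" using C by (simp add: D_def)
  have "integrable lborel (dens u) \<and>
      (LINT x|lborel. dens u x) \<le> (LINT x|lborel. min (dens u x) (D * (cmod (u x))\<^sup>2)) + e * (l2norm g)\<^sup>2"
    if ug: "Sigma_pair u g" "l2norm u = c" for u g
  proof -
    have u: "sq_int u" by (rule Sigma_pairD(1)[OF ug(1)])
    then have [measurable]: "u \<in> borel_measurable borel" by (simp add: sq_int_def)
    have [measurable]: "dens u \<in> borel_measurable borel" by (rule dens_measurable) measurable
    let ?t = "\<lambda>x. indicat_real {L<..} (cmod (u x)) * cmod (u x) powr (p + 1)"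
    let ?m = "\<lambda>x. min (dens u x) (D * (cmod (u x))\<^sup>2)"
    have tm [measurable]: "?t \<in> borel_measurable borel" by measurable
    have "(\<integral>\<^sup>+x. ennreal (?t x) \<partial>lborel) = (\<integral>\<^sup>+x. indicator {x. norm (u x) > L} x * ennreal (norm (u x) powr (p + 1)) \<partial>lborel)"
      by (intro nn_integral_cong) (auto simp: indicator_def)
    also have "\<dots> \<le> ennreal (2 powr (p + 1) * level_const c TYPE('n) * L powr (- \<delta>) / (1 - 2 powr (- \<delta>)) * (l2norm g)\<^sup>2)"
      using p L \<delta> c by (intro tail_integral_le[OF Sigma_pairD(5)[OF ug(1)] ug(2)]) (auto simp: \<delta>_def)
    also have "\<dots> = ennreal (K * L powr (- \<delta>) * (l2norm g)\<^sup>2)" by (simp add: K_def)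
    finally have t: "(\<integral>\<^sup>+x. ennreal (?t x) \<partial>lborel) \<le> ennreal (K * L powr (- \<delta>) * (l2norm g)\<^sup>2)" .
    have ti: "integrable lborel ?t"
      using t by (intro integrableI_nonneg) (auto intro: le_less_trans)
    have "ennreal (LINT x|lborel. ?t x) \<le> ennreal (K * L powr (- \<delta>) * (l2norm g)\<^sup>2)"
      using t ti by (simp add: nn_integral_eq_integral)
    then have tle: "(LINT x|lborel. ?t x) \<le> K * L powr (- \<delta>) * (l2norm g)\<^sup>2"
      using K by (simp add: ennreal_le_iff)
    have pt: "dens u x \<le> ?m x + 2 * C * ?t x" for x
      unfolding dens_def D_def
      by (rule le_truncation_plus_tail[OF G C p(1) L(2)]) auto
    have mi: "integrable lborel ?m"
    proof (rule Bochner_Integration.integrable_bound)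
      show "integrable lborel (\<lambda>x. D * (cmod (u x))\<^sup>2)" by (intro integrable_mult_right sq_int_integrable u)
      show "AE x in lborel. norm (?m x) \<le> norm (D * (cmod (u x))\<^sup>2)"
        using dens_nonneg[of u] D by (intro AE_I2) (auto simp: min_def)
    qed measurable
    have Si: "integrable lborel (\<lambda>x. ?m x + 2 * C * ?t x)"
      by (intro Bochner_Integration.integrable_add mi integrable_mult_right ti)
    have int: "integrable lborel (dens u)"
    proof (rule Bochner_Integration.integrable_bound[OF Si])
      show "AE x in lborel. norm (dens u x) \<le> norm (?m x + 2 * C * ?t x)"
      proof (rule AE_I2)
        fix x show "norm (dens u x) \<le> norm (?m x + 2 * C * ?t x)"
          using pt[of x] dens_nonneg[of u x] unfolding real_norm_def by linarith
      qed
    qed measurable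
    have "(LINT x|lborel. dens u x) \<le> (LINT x|lborel. ?m x + 2 * C * ?t x)"
      by (intro integral_mono int Si pt)
    also have "\<dots> = (LINT x|lborel. ?m x) + 2 * C * (LINT x|lborel. ?t x)"
      using Bochner_Integration.integral_add[OF mi integrable_mult_right[OF ti, of "2 * C"]]
      by (simp only: integral_mult_right_zero)
    also have "2 * C * (LINT x|lborel. ?t x) \<le> 2 * C * (K * L powr (- \<delta>) * (l2norm g)\<^sup>2)"
      using C by (intro mult_left_mono tle) auto
    also have "\<dots> = (2 * C * K * L powr (- \<delta>)) * (l2norm g)\<^sup>2" by simp
    also have "\<dots> \<le> e * (l2norm g)\<^sup>2" using L(1) by (intro mult_right_mono) auto
    finally show ?thesis using int by simp
  qed
  then show ?thesis using D by blast
qed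

end

theorem theorem7p2:
  fixes i1 i2 :: "'n::finite"
    and \<gamma> \<Omega> \<kappa> C p c :: real
    and G :: "real^'n \<Rightarrow> real \<Rightarrow> real"
  assumes "CARD('n) \<ge> 2" and "i1 \<noteq> i2"
    and "\<gamma> > 0" and "\<bar>\<Omega>\<bar> < \<gamma>" and "\<kappa> \<in> {1, -1}"
    and "continuous_on (UNIV \<times> {0..}) (\<lambda>(x, v). G x v)"
    and "(\<lambda>(x, v). G x v) differentiable_on (UNIV \<times> {0..})"
    and "C > 0"
    and "\<And>x v. v \<ge> 0 \<Longrightarrow> 0 \<le> G x v \<and> G x v \<le> C * (v + v powr ((p + 1) / 2))"
    and "c > 0"
  shows "(1 \<le> p \<and> p < 1 + 4 / real CARD('n) \<and> \<kappa> = 1 \<longrightarrow>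
            (\<exists>u \<in> mass_sphere c.
               ereal (energy i1 i2 \<Omega> \<gamma> \<kappa> G u) = min_energy i1 i2 \<Omega> \<gamma> \<kappa> G c))
       \<and> (1 \<le> p \<and> ereal p < energy_critical_exponent CARD('n) \<and> \<kappa> = -1 \<longrightarrow>
            (\<exists>u \<in> mass_sphere c.
               ereal (energy i1 i2 \<Omega> \<gamma> \<kappa> G u) = min_energy i1 i2 \<Omega> \<gamma> \<kappa> G c))"
proof -
  interpret nonlinear_trap i1 i2 \<gamma> \<Omega> G c
    using assms by unfold_locales auto
  \<comment> \<open>A minimizer for the real-valued energy attains the extended real infimum, which
    is then finite.\<close>
  have min: "\<exists>u\<in>mass_sphere c. ereal (energy i1 i2 \<Omega> \<gamma> k G u) = min_energy i1 i2 \<Omega> \<gamma> k G c"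
    if ex: "\<exists>v\<in>mass_sphere c. \<forall>w\<in>mass_sphere c. energy i1 i2 \<Omega> \<gamma> k G v \<le> energy i1 i2 \<Omega> \<gamma> k G w" for k
  proof -
    obtain v where v: "v \<in> mass_sphere c" "\<And>w. w \<in> mass_sphere c \<Longrightarrow> energy i1 i2 \<Omega> \<gamma> k G v \<le> energy i1 i2 \<Omega> \<gamma> k G w"
      using ex by blast
    have "ereal (energy i1 i2 \<Omega> \<gamma> k G v) = min_energy i1 i2 \<Omega> \<gamma> k G c"
      unfolding min_energy_def
      by (intro antisym INF_greatest INF_lower v) (simp add: v)
    then show ?thesis using v(1) by blast
  qed
  have "\<exists>u\<in>mass_sphere c. ereal (energy i1 i2 \<Omega> \<gamma> 1 G u) = min_energy i1 i2 \<Omega> \<gamma> 1 G c"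
    if p: "1 \<le> p" "p < 1 + 4 / real CARD('n)"
  proof (intro min ex_minimizer_focusing)
    fix e :: real assume "e > 0"
    then show "\<exists>D\<ge>0. \<forall>u g. Sigma_pair u g \<longrightarrow> l2norm u = c \<longrightarrow>
        integrable lborel (dens u) \<and>
        (LINT x|lborel. dens u x) \<le> (LINT x|lborel. min (dens u x) (D * (cmod (u x))\<^sup>2)) + e * (l2norm g)\<^sup>2"
      using assms(8,9) p by (intro truncation_estimate[of C p]) auto
  qed
  then show ?thesis using min[OF ex_minimizer_defocusing] by auto
qed

end
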